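(* For every $1<p<\infty$ and $0\le\alpha\le\alpha_p=1-\frac1p+\frac{d_h}p$, \[ \mathcal B^{\alpha}_{p,\infty}(K)=\big(L^p(K,\mu),W^{1,p}(K)\big)_{\alpha/\alpha_p,\infty}. \]
   Context: Vicsek set. In $\mathbb R^2$ let $q_1=(-\sqrt2/2,\sqrt2/2)$, $q_2=(\sqrt2/2,\sqrt2/2)$, $q_3=(\sqrt2/2,-\sqrt2/2)$, $q_4=(-\sqrt2/2,-\sqrt2/2)$, $q_5=(0,0)$ and $\psi_i(z)=\frac13(z-q_i)+q_i$, $1\le i\le5$. $K$ is the unique non-empty compact set with $K=\bigcup_{i=1}^5\psi_i(K)$. Geodesic distance. Let $\bar V_0$ be the union of the four segments $[q_5,q_i]$, $1\le i\le4$, and $\bar V_{n+1}=\bigcup_i\psi_i(\bar V_n)$; each $\bar V_n\subset K$ is a tree and $\bigcup_n\bar V_n$ is dense in $K$. For $x,y\in\bar V_n$, $d(x,y)$ is the length of the path in $\bar V_n$ from $x$ to $y$, and $d$ is extended by continuity to $K\times K$; $B(x,r)=\{y\in K:d(x,y)\le r\}$. $\mu$ is the Borel probability measure on $K$ with $\mu(\psi_{i_1}\circ\cdots\circ\psi_{i_n}(K))=5^{-n}$; $d_h=\log5/\log3$. For $f\in L^p(K,\mu)$, $r>0$ let $E_p(f,r)=\int_K\int_{B(x,r)}\frac{|f(y)-f(x)|^p}{\mu(B(x,r))}d\mu(y)d\mu(x)$. The space $\mathcal B^\alpha_{p,\infty}(K)$ is the set of $f\in L^p(K,\mu)$ with finite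 seminorm $\sup_{r>0}r^{-\alpha}E_p(f,r)^{1/p}$. $W^{1,p}(K)$ is the set of $f\in L^p(K,\mu)$ with finite seminorm $\|f\|_{W^{1,p}(K)}=\limsup_{r\to0^+}r^{-\alpha_p}E_p(f,r)^{1/p}$. Interpolation ($K$-method for seminormed spaces). For $f\in L^p(K,\mu)+W^{1,p}(K)$ and $t>0$, $K(f,t)=\inf\{\|g\|_{L^p(K,\mu)}+t\|h\|_{W^{1,p}(K)}: f=g+h\}$. For $0\le\theta\le1$, $(L^p(K,\mu),W^{1,p}(K))_{\theta,\infty}$ consists of all $f\in L^p(K,\mu)+W^{1,p}(K)$ with finite seminorm $\sup_{t>0}t^{-\theta}K(f,t)$. Equality of the spaces is understood in the usual sense of interpolation theory: same functions, with equivalent seminorms. *)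

theory Defs
  imports "HOL-Analysis.Analysis" "HOL-Probability.Probability_Measure"
begin

section \<open>The Vicsek set\<close>

definition vicsek_q :: "nat \<Rightarrow> real^2" where
  "vicsek_q i =
     (if i = 1 then vector [- (sqrt 2 / 2), sqrt 2 / 2]
      else if i = 2 then vector [sqrt 2 / 2, sqrt 2 / 2]
      else if i = 3 then vector [sqrt 2 / 2, - (sqrt 2 / 2)]
      else if i = 4 then vector [- (sqrt 2 / 2), - (sqrt 2 / 2)]
      else 0)"

definition vicsek_psi :: "nat \<Rightarrow> real^2 \<Rightarrow> real^2" where
  "vicsek_psi i z = (1/3) *\<^sub>R (z - vicsek_q i) + vicsek_q i"

definition vicsek_K :: "(real^2) set" where
  "vicsek_K = (THE K. K \<noteq> {} \<and> compact K \<and> K = (\<Union>i\<in>{1..5}. vicsek_psi i ` K))"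

fun vicsek_V :: "nat \<Rightarrow> (real^2) set" where
  "vicsek_V 0 = (\<Union>i\<in>{1..4}. closed_segment (vicsek_q 5) (vicsek_q i))"
| "vicsek_V (Suc n) = (\<Union>i\<in>{1..5}. vicsek_psi i ` vicsek_V n)"


section \<open>Geodesic distance\<close>

definition path_length :: "(real \<Rightarrow> 'a::metric_space) \<Rightarrow> ennreal" where
  "path_length g =
     (SUP (n, t) \<in> {(n::nat, t::nat \<Rightarrow> real). mono t \<and> range t \<subseteq> {0..1}}.
        ennreal (\<Sum>i<n. dist (g (t i)) (g (t (Suc i)))))"

text \<open>
  The path from \<open>x\<close> to \<open>y\<close> in the tree \<open>vicsek_V n\<close> is the injective one, unique up to
  reparametrisation.  Since \<open>arc\<close> excludes constant paths, \<open>x = y\<close> is treated apart.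
  The trees increase with \<open>n\<close>, so the length does not depend on \<open>n\<close>.
\<close>

definition vicsek_skel_dist :: "real^2 \<Rightarrow> real^2 \<Rightarrow> real" where
  "vicsek_skel_dist x y =
     (if x = y then 0
      else (THE l. 0 \<le> l \<and>
              (\<exists>n g. arc g \<and> path_image g \<subseteq> vicsek_V n \<and> pathstart g = x \<and> pathfinish g = y \<and>
                     path_length g = ennreal l)))"

text \<open>Extension by continuity from the dense subset \<open>\<Union>n. vicsek_V n\<close> of \<open>vicsek_K\<close>;
  meaningful for \<open>x\<close> and \<open>y\<close> in \<open>vicsek_K\<close> only.\<close>

definition vicsek_dist :: "real^2 \<Rightarrow> real^2 \<Rightarrow> real" where
  "vicsek_dist x y =
     Lim (at (x, y) within (\<Union>n. vicsek_V n) \<times> (\<Union>n. vicsek_V n)) (\<lambda>(u, v). vicsek_skel_dist u v)"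

definition vicsek_ball :: "real^2 \<Rightarrow> real \<Rightarrow> (real^2) set" where
  "vicsek_ball x r = {y \<in> vicsek_K. vicsek_dist x y \<le> r}"


section \<open>The self-similar measure and the critical exponents\<close>

text \<open>A list \<open>[i\<^sub>1, \<dots>, i\<^sub>n]\<close> stands for the word indexing the cell
  \<open>(\<psi>\<^bsub>i\<^sub>1\<^esub> \<circ> \<dots> \<circ> \<psi>\<^bsub>i\<^sub>n\<^esub>) K\<close>.\<close>

definition vicsek_cell :: "nat list \<Rightarrow> (real^2) set" where
  "vicsek_cell w = foldr (\<lambda>i h. vicsek_psi i \<circ> h) w id ` vicsek_K"

definition vicsek_mu :: "(real^2) measure" where
  "vicsek_mu =
     (THE M. prob_space M \<and> space M = vicsek_K \<and> sets M = sets (restrict_space borel vicsek_K) \<and>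
             (\<forall>w. set w \<subseteq> {1..5} \<longrightarrow> emeasure M (vicsek_cell w) = ennreal ((1/5) ^ length w)))"

definition vicsek_dh :: real where
  "vicsek_dh = ln 5 / ln 3"

definition vicsek_alpha :: "real \<Rightarrow> real" where
  "vicsek_alpha p = 1 - 1 / p + vicsek_dh / p"


section \<open>Function spaces\<close>

text \<open>Elements of \<open>L\<^sup>p\<close> are represented by measurable functions.  The (semi)norms take values in
  \<open>[0, \<infinity>]\<close>; none of them changes when a function is modified on a null set.\<close>

definition ennreal_powr :: "ennreal \<Rightarrow> real \<Rightarrow> ennreal" where
  "ennreal_powr x a = (if x = \<infinity> then \<infinity> else ennreal (enn2real x powr a))"

definition Lp_norm :: "'a measure \<Rightarrow> real \<Rightarrow> ('a \<Rightarrow> real) \<Rightarrow> ennreal" where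
  "Lp_norm M p f = ennreal_powr (\<integral>\<^sup>+x. ennreal (\<bar>f x\<bar> powr p) \<partial>M) (1 / p)"

definition Lp :: "'a measure \<Rightarrow> real \<Rightarrow> ('a \<Rightarrow> real) set" where
  "Lp M p = {f \<in> borel_measurable M. Lp_norm M p f < \<infinity>}"

definition vicsek_E :: "real \<Rightarrow> (real^2 \<Rightarrow> real) \<Rightarrow> real \<Rightarrow> ennreal" where
  "vicsek_E p f r =
     (\<integral>\<^sup>+x. (\<integral>\<^sup>+y\<in>vicsek_ball x r.
        ennreal (\<bar>f y - f x\<bar> powr p) / emeasure vicsek_mu (vicsek_ball x r) \<partial>vicsek_mu) \<partial>vicsek_mu)"

definition besov_seminorm :: "real \<Rightarrow> real \<Rightarrow> (real^2 \<Rightarrow> real) \<Rightarrow> ennreal" where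
  "besov_seminorm p \<alpha> f =
     (SUP r\<in>{0<..}. ennreal (r powr (- \<alpha>)) * ennreal_powr (vicsek_E p f r) (1 / p))"

definition besov_space :: "real \<Rightarrow> real \<Rightarrow> (real^2 \<Rightarrow> real) set" where
  "besov_space p \<alpha> = {f \<in> Lp vicsek_mu p. besov_seminorm p \<alpha> f < \<infinity>}"

definition sobolev_seminorm :: "real \<Rightarrow> (real^2 \<Rightarrow> real) \<Rightarrow> ennreal" where
  "sobolev_seminorm p f =
     Limsup (at_right 0)
       (\<lambda>r. ennreal (r powr (- vicsek_alpha p)) * ennreal_powr (vicsek_E p f r) (1 / p))"

definition sobolev_space :: "real \<Rightarrow> (real^2 \<Rightarrow> real) set" where
  "sobolev_space p = {f \<in> Lp vicsek_mu p. sobolev_seminorm p f < \<infinity>}"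


section \<open>The K-method for seminormed function spaces\<close>

text \<open>Decompositions \<open>f = g + h\<close> are taken pointwise.  As the spaces used here are invariant under
  changes on null sets (and off the support of the measure), this gives the same sum space and the
  same infimum as decompositions of almost-everywhere classes.\<close>

definition K_functional ::
    "('a \<Rightarrow> real) set \<Rightarrow> (('a \<Rightarrow> real) \<Rightarrow> ennreal) \<Rightarrow> ('a \<Rightarrow> real) set \<Rightarrow> (('a \<Rightarrow> real) \<Rightarrow> ennreal) \<Rightarrow>
     ('a \<Rightarrow> real) \<Rightarrow> real \<Rightarrow> ennreal" where
  "K_functional X nX Y nY f t =
     (INF (g, h) \<in> {(g, h). g \<in> X \<and> h \<in> Y \<and> f = (\<lambda>x. g x + h x)}. nX g + ennreal t * nY h)"

definition interp_seminorm ::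
    "('a \<Rightarrow> real) set \<Rightarrow> (('a \<Rightarrow> real) \<Rightarrow> ennreal) \<Rightarrow> ('a \<Rightarrow> real) set \<Rightarrow> (('a \<Rightarrow> real) \<Rightarrow> ennreal) \<Rightarrow>
     real \<Rightarrow> ('a \<Rightarrow> real) \<Rightarrow> ennreal" where
  "interp_seminorm X nX Y nY \<theta> f =
     (SUP t\<in>{0<..}. ennreal (t powr (- \<theta>)) * K_functional X nX Y nY f t)"

definition interp_space ::
    "('a \<Rightarrow> real) set \<Rightarrow> (('a \<Rightarrow> real) \<Rightarrow> ennreal) \<Rightarrow> ('a \<Rightarrow> real) set \<Rightarrow> (('a \<Rightarrow> real) \<Rightarrow> ennreal) \<Rightarrow>
     real \<Rightarrow> ('a \<Rightarrow> real) set" where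
  "interp_space X nX Y nY \<theta> =
     {f. (\<exists>g\<in>X. \<exists>h\<in>Y. f = (\<lambda>x. g x + h x)) \<and> interp_seminorm X nX Y nY \<theta> f < \<infinity>}"

end

theory Submission
  imports Defs "HOL-Probability.Probability"
begin

text \<open>
  Fix \<open>n\<close> and sum, over all pairs of intersecting cells of generation \<open>n\<close>, the double integrals of
  \<open>\<bar>f y - f x\<bar> powr p\<close>; with the factor \<open>5 ^ n\<close> this energy is comparable to the Besov integral at radius
  \<open>3 ^ (- n)\<close>, because the geodesic distance of two points in disjoint cells of generation \<open>n\<close> is at least
  \<open>2 / 3 ^ n\<close>.  Two facts about the energies give the theorem.

  Monotonicity: joining two cells of generation \<open>n + k\<close> by a chain of at most about \<open>3 ^ k\<close> adjacent
  cells and applying Hoelder's inequality, the energy at \<open>n\<close> is at most a constant times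
  \<open>(5 * 3 powr (p - 1)) ^ k\<close> times the energy at \<open>n + k\<close>.  The factor is \<open>3 powr (k * p * vicsek_alpha p)\<close>, so the
  upper limit in the Sobolev seminorm controls the supremum over all radii.  Hence the Besov
  integral at radius \<open>r\<close> is bounded by the K-functional at \<open>r powr vicsek_alpha p\<close>.

  Approximation: choose a value of \<open>f\<close> in every cell of generation \<open>n\<close> and interpolate them along the
  diagonals of the cells.  The interpolant varies only on \<open>3 ^ k\<close> of the \<open>5 ^ k\<close> subcells of each arm, by
  about \<open>3 ^ (- k)\<close>; so its energies decay at the critical rate, and its Sobolev seminorm and its \<open>L\<^sup>p\<close>
  distance to \<open>f\<close> are controlled by the energy of \<open>f\<close> at \<open>n\<close>.  For \<open>t \<ge> 1\<close> a constant is good enough.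
\<close>

subsection \<open>Lengths of arcs in trees\<close>

text \<open>The set, the distance and the measure are given by definite descriptions and a limit, so
  existence and uniqueness come before any estimate. The distance is the delicate one: it is
  extended along the Euclidean topology, which requires the tree metrics to be Lipschitz for the
  Euclidean metric with one constant for all generations. The critical exponent is a count. A pair
  of cells of generation \<open>n\<close> is covered by \<open>25 ^ k\<close> pairs of generation
  \<open>n + k\<close>; passing from the prefactor \<open>5 ^ n\<close> to
  \<open>5 ^ (n + k)\<close> absorbs one factor \<open>5 ^ k\<close>, so \<open>5 ^ k\<close>
  remains, and Hoelder over a chain of length about \<open>3 ^ k\<close> contributes
  \<open>3 powr (k * (p - 1))\<close>. For the interpolant the same factor appears in the
  denominator: the masses give \<open>5 ^ (- k)\<close>, and \<open>3 ^ k\<close> subcells with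
  variation about \<open>3 ^ (- k)\<close> give \<open>3 powr (- k * (p - 1))\<close>. Since both
  rates agree, the two sides of the interpolation inequality can be balanced at
  \<open>t = r powr vicsek_alpha p\<close>.\<close>

definition len_between :: "(real \<Rightarrow> 'a::metric_space) \<Rightarrow> real \<Rightarrow> real \<Rightarrow> ennreal" where
  "len_between g a b =
     (SUP (n, t) \<in> {(n::nat, t::nat \<Rightarrow> real). mono t \<and> range t \<subseteq> {a..b}}.
        ennreal (\<Sum>i<n. dist (g (t i)) (g (t (Suc i)))))"

lemma path_length_eq_len_between: "path_length g = len_between g 0 1"
  by (simp add: path_length_def len_between_def)

lemma len_between_upper:
  assumes "mono t" "range t \<subseteq> {a..b}"
  shows "ennreal (\<Sum>i<n. dist (g (t i)) (g (t (Suc i)))) \<le> len_between g a b"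
  unfolding len_between_def using assms by (intro SUP_upper2[of "(n, t)"]) auto

lemma len_between_least:
  assumes "\<And>n t. mono t \<Longrightarrow> range t \<subseteq> {a..b} \<Longrightarrow> ennreal (\<Sum>i<n. dist (g (t i)) (g (t (Suc i)))) \<le> L"
  shows "len_between g a b \<le> L"
  unfolding len_between_def using assms by (intro SUP_least) auto

lemma len_between_ge_dist:
  assumes "a \<le> b" shows "ennreal (dist (g a) (g b)) \<le> len_between g a b"
proof -
  \<comment> \<open>Partitions are infinite monotone sequences of which only the first
    \<open>n\<close> steps count, so the two-point partition is continued by the constant
    \<open>b\<close>.\<close>
  define t where "t i = (if i = 0 then a else b)" for i :: nat
  have "ennreal (\<Sum>i<Suc 0. dist (g (t i)) (g (t (Suc i)))) \<le> len_between g a b"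
    by (rule len_between_upper) (use assms in \<open>auto simp: t_def mono_def\<close>)
  then show ?thesis by (simp add: t_def)
qed

text \<open>Truncating a partition at \<open>s\<close> from above and from below gives a partition
  of each half. A step that straddles \<open>s\<close> is split there by the triangle
  inequality.\<close>

lemma len_between_split_le:
  assumes s: "a \<le> s" "s \<le> b"
  shows "len_between g a b \<le> len_between g a s + len_between g s b"
proof (rule len_between_least)
  fix n :: nat and t :: "nat \<Rightarrow> real" assume t: "mono t" "range t \<subseteq> {a..b}"
  let ?l = "\<lambda>i. min (t i) s" and ?r = "\<lambda>i. max (t i) s"
  have ti: "t i \<le> t (Suc i)" for i using t(1) by (simp add: mono_def)
  have "(\<Sum>i<n. dist (g (t i)) (g (t (Suc i)))) \<le>
      (\<Sum>i<n. dist (g (?l i)) (g (?l (Suc i))) + dist (g (?r i)) (g (?r (Suc i))))"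
  proof (rule sum_mono)
    fix i
    show "dist (g (t i)) (g (t (Suc i))) \<le> dist (g (?l i)) (g (?l (Suc i))) + dist (g (?r i)) (g (?r (Suc i)))"
      using ti[of i] dist_triangle[of "g (t i)" "g (t (Suc i))" "g s"]
      by (cases "t i \<le> s"; cases "t (Suc i) \<le> s") (auto simp: min_def max_def)
  qed
  then have "ennreal (\<Sum>i<n. dist (g (t i)) (g (t (Suc i)))) \<le>
      ennreal (\<Sum>i<n. dist (g (?l i)) (g (?l (Suc i)))) + ennreal (\<Sum>i<n. dist (g (?r i)) (g (?r (Suc i))))"
    by (simp add: sum.distrib sum_nonneg flip: ennreal_plus)
  also have "\<dots> \<le> len_between g a s + len_between g s b"
  proof (intro add_mono len_between_upper)
    show "mono ?l" "mono ?r" using t(1) by (auto simp: mono_def min_def max_def intro: order_trans)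
    show "range ?l \<subseteq> {a..s}" "range ?r \<subseteq> {s..b}" using t(2) s by (auto simp: subset_iff)
  qed
  finally show "ennreal (\<Sum>i<n. dist (g (t i)) (g (t (Suc i)))) \<le> len_between g a s + len_between g s b" .
qed

text \<open>Partitions of the two halves can be concatenated; the additional step that joins them
  only increases the sum.\<close>

lemma len_between_split_ge:
  assumes s: "a \<le> s" "s \<le> b"
  shows "len_between g a s + len_between g s b \<le> len_between g a b"
proof -
  have *: "ennreal (\<Sum>i<n. dist (g (t i)) (g (t (Suc i)))) + ennreal (\<Sum>i<m. dist (g (u i)) (g (u (Suc i))))
      \<le> len_between g a b"
    if t: "mono t" "range t \<subseteq> {a..s}" and u: "mono u" "range u \<subseteq> {s..b}" for n t m u
  proof -
    \<comment> \<open>The first partition occupies the indices up to and including \<open>n\<close>,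
      the second starts at \<open>Suc n\<close>. The joining step between them accounts for the
      upper limit \<open>Suc n + m\<close>.\<close>
    define T where "T i = (if i \<le> n then t i else u (i - Suc n))" for i
    have ts: "t i \<le> s" "a \<le> t i" "s \<le> u i" "u i \<le> b" for i
      using subsetD[OF t(2) rangeI[of t i]] subsetD[OF u(2) rangeI[of u i]] by auto
    have m: "mono T"
    proof (rule monoI)
      fix i j :: nat assume "i \<le> j"
      then show "T i \<le> T j"
        using t(1) u(1) ts(1)[of i] ts(3)[of "j - Suc n"]
        by (auto simp: T_def mono_def intro: order_trans)
    qed
    have r: "range T \<subseteq> {a..b}" using order_trans[OF ts(1) s(2)] order_trans[OF s(1) ts(3)] ts by (auto simp: T_def)
    have "(\<Sum>i<n. dist (g (t i)) (g (t (Suc i)))) + (\<Sum>i<m. dist (g (u i)) (g (u (Suc i))))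
       \<le> (\<Sum>i<Suc n + m. dist (g (T i)) (g (T (Suc i))))"
    proof (induction m)
      case 0 then show ?case by (simp add: T_def)
    next
      case (Suc m) then show ?case by (simp add: T_def)
    qed
    then have "ennreal (\<Sum>i<n. dist (g (t i)) (g (t (Suc i)))) + ennreal (\<Sum>i<m. dist (g (u i)) (g (u (Suc i))))
       \<le> ennreal (\<Sum>i<Suc n + m. dist (g (T i)) (g (T (Suc i))))"
      by (simp add: sum_nonneg flip: ennreal_plus)
    also have "\<dots> \<le> len_between g a b" by (rule len_between_upper[OF m r])
    finally show ?thesis .
  qed
  have ne: "{(n::nat, t::nat \<Rightarrow> real). mono t \<and> range t \<subseteq> {a..s}} \<noteq> {}"
    "{(n::nat, t::nat \<Rightarrow> real). mono t \<and> range t \<subseteq> {s..b}} \<noteq> {}"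
    using s by (auto intro!: exI[of _ "\<lambda>_. s"] simp: mono_def)
  show ?thesis
    unfolding len_between_def[of g a s] len_between_def[of g s b]
    apply (subst ennreal_SUP_add_left[OF ne(1), symmetric])
    apply (rule SUP_least)
    apply (subst ennreal_SUP_add_right[OF ne(2)])
    apply (rule SUP_least)
    using * by auto
qed

text \<open>Additivity is proved for \<open>len_between\<close>, which involves no change of
  parameter. The passage to subpaths is an affine reparametrisation that is increasing in both
  directions.\<close>

lemma path_length_subpath:
  assumes "a < b" shows "path_length (subpath a b g) = len_between g a b"
proof (rule antisym)
  show "path_length (subpath a b g) \<le> len_between g a b"
    unfolding path_length_eq_len_between
  proof (rule len_between_least)
    fix n :: nat and t :: "nat \<Rightarrow> real" assume t: "mono t" "range t \<subseteq> {0..1}"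
    have "mono (\<lambda>i. (b - a) * t i + a)" using t(1) assms by (auto simp: mono_def)
    moreover have "range (\<lambda>i. (b - a) * t i + a) \<subseteq> {a..b}"
    proof (rule image_subsetI)
      fix i
      have "t i \<in> {0..1}" using subsetD[OF t(2) rangeI[of t i]] .
      then show "(b - a) * t i + a \<in> {a..b}"
        proof -
        assume "t i \<in> {0..1}"
        then have "(b - a) * t i \<le> (b - a) * 1" "0 \<le> (b - a) * t i"
          using assms by (intro mult_left_mono mult_nonneg_nonneg; simp)+
        then show ?thesis by auto
      qed
    qed
    ultimately show "ennreal (\<Sum>i<n. dist (subpath a b g (t i)) (subpath a b g (t (Suc i)))) \<le> len_between g a b"
      using len_between_upper[of "\<lambda>i. (b - a) * t i + a" a b g n] by (simp add: subpath_def)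
  qed
  show "len_between g a b \<le> path_length (subpath a b g)"
    unfolding path_length_eq_len_between
  proof (rule len_between_least)
    fix n :: nat and t :: "nat \<Rightarrow> real" assume t: "mono t" "range t \<subseteq> {a..b}"
    have "mono (\<lambda>i. (t i - a) / (b - a))" using t(1) assms by (auto simp: mono_def intro!: divide_right_mono)
    moreover have "range (\<lambda>i. (t i - a) / (b - a)) \<subseteq> {0..1}"
      using t(2) assms by (auto simp: subset_iff)
    ultimately show "ennreal (\<Sum>i<n. dist (g (t i)) (g (t (Suc i)))) \<le> len_between (subpath a b g) 0 1"
      using len_between_upper[of "\<lambda>i. (t i - a) / (b - a)" 0 1 "subpath a b g" n] assms
      by (simp add: subpath_def)
  qed
qed

lemma path_length_split:
  assumes "0 < s" "s < 1"
  shows "path_length g = path_length (subpath 0 s g) + path_length (subpath s 1 g)"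
  using assms len_between_split_le[of 0 s 1 g] len_between_split_ge[of 0 s 1 g]
  by (simp add: path_length_subpath) (simp add: path_length_eq_len_between)

lemma path_length_scale:
  assumes "\<And>x y. dist (f x) (f y) = c * dist x y" "0 \<le> c"
  shows "path_length (f \<circ> g) = ennreal c * path_length g"
  unfolding path_length_def SUP_mult_left_ennreal
  by (rule SUP_cong) (auto simp: assms sum_distrib_left sum_nonneg ennreal_mult'[symmetric] simp flip: ennreal_mult')

text \<open>Every partition sum telescopes to at most \<open>u 1 - u 0\<close>. It is meant for arcs
  in a segment, with \<open>u\<close> the coordinate along the segment or its negative.\<close>

lemma path_length_monotone_real:
  fixes u :: "real \<Rightarrow> real"
  assumes u: "mono_on {0..1} u" and g: "\<And>s t. s \<in> {0..1} \<Longrightarrow> t \<in> {0..1} \<Longrightarrow> dist (g s) (g t) = \<bar>u s - u t\<bar>"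
  shows "path_length g = ennreal (dist (g 0) (g 1))"
proof (rule antisym)
  show "ennreal (dist (g 0) (g 1)) \<le> path_length g"
    unfolding path_length_eq_len_between by (rule len_between_ge_dist) simp
  show "path_length g \<le> ennreal (dist (g 0) (g 1))"
    unfolding path_length_eq_len_between
  proof (rule len_between_least)
    fix n :: nat and t :: "nat \<Rightarrow> real" assume t: "mono t" "range t \<subseteq> {0..1}"
    have t01: "t i \<in> {0..1}" for i using subsetD[OF t(2) rangeI[of t i]] .
    have "(\<Sum>i<n. dist (g (t i)) (g (t (Suc i)))) = (\<Sum>i<n. u (t (Suc i)) - u (t i))"
    proof (rule sum.cong[OF refl])
      fix i
      have "u (t i) \<le> u (t (Suc i))" using t t01 by (intro mono_onD[OF u]) (auto simp: mono_def)
      then show "dist (g (t i)) (g (t (Suc i))) = u (t (Suc i)) - u (t i)" using g[OF t01 t01] by simp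
    qed
    also have "\<dots> = u (t n) - u (t 0)" by (rule sum_lessThan_telescope)
    also have "\<dots> \<le> u 1 - u 0"
      using mono_onD[OF u, of "t n" 1] mono_onD[OF u, of 0 "t 0"] t01[of n] t01[of 0] by auto
    also have "\<dots> \<le> dist (g 0) (g 1)" using g[of 0 1] by auto
    finally show "ennreal (\<Sum>i<n. dist (g (t i)) (g (t (Suc i)))) \<le> ennreal (dist (g 0) (g 1))"
      by (rule ennreal_leI)
  qed
qed

section \<open>Arcs in a union of two closed sets with one common point\<close>

lemma connected_meets_cut_point:
  fixes S :: "'a::topological_space set"
  assumes "connected S" "closed A" "closed B" "A \<inter> B = {v}" "S \<subseteq> A \<union> B" "x \<in> S" "x \<in> A" "y \<in> S" "y \<in> B"
  shows "v \<in> S"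
  using connected_closedD[OF assms(1), of A B] assms by auto

lemma path_meets_cut_point:
  fixes g :: "real \<Rightarrow> 'a::real_normed_vector"
  assumes "closed A" "closed B" "A \<inter> B = {v}" "path g" "path_image g \<subseteq> A \<union> B"
    and I: "connected I" "I \<subseteq> {0..1}" "s \<in> I" "t \<in> I" "g s \<in> A" "g t \<in> B"
  shows "v \<in> g ` I"
proof -
  have "connected (g ` I)"
    using assms(4) I by (intro connected_continuous_image) (auto simp: path_def intro: continuous_on_subset)
  moreover have "g ` I \<subseteq> A \<union> B" using assms(5) I by (auto simp: path_image_def)
  ultimately show ?thesis
    using connected_meets_cut_point[of "g ` I" A B v "g s" "g t"] assms by auto
qed

lemma arc_eqI: "arc g \<Longrightarrow> s \<in> {0..1} \<Longrightarrow> t \<in> {0..1} \<Longrightarrow> g s = g t \<Longrightarrow> s = t"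
  by (auto simp: arc_def inj_on_def)

text \<open>An excursion out of \<open>A\<close> would pass through \<open>v\<close> on the way out
  and again on the way back, which injectivity forbids.\<close>

lemma arc_stays_in_part:
  fixes g :: "real \<Rightarrow> 'a::real_normed_vector"
  assumes AB: "closed A" "closed B" "A \<inter> B = {v}" and g: "arc g" "path_image g \<subseteq> A \<union> B"
    and ends: "pathstart g \<in> A" "pathfinish g \<in> A"
  shows "path_image g \<subseteq> A"
proof (rule ccontr)
  assume "\<not> ?thesis"
  then obtain t where t: "t \<in> {0..1}" "g t \<notin> A" unfolding path_image_def by blast
  then have tB: "g t \<in> B" using g(2) unfolding path_image_def by blast
  have ends': "g 0 \<in> A" "g 1 \<in> A" using ends by (auto simp: pathstart_def pathfinish_def)
  note cut = path_meets_cut_point[OF AB arc_imp_path[OF g(1)] g(2)]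
  \<comment> \<open>One passage through \<open>v\<close> happens up to time \<open>t\<close>,
    another from \<open>t\<close> on. Injectivity makes the two times equal, and then both are
    \<open>t\<close>.\<close>
  have "v \<in> g ` {0..t}" by (rule cut[of _ 0 t]) (use t tB ends' in auto)
  then obtain s1 where s1: "s1 \<in> {0..t}" "g s1 = v" by auto
  have "v \<in> g ` {t..1}" by (rule cut[of _ 1 t]) (use t tB ends' in auto)
  then obtain s2 where s2: "s2 \<in> {t..1}" "g s2 = v" by auto
  have "s1 = s2" using arc_eqI[OF g(1), of s1 s2] s1 s2 t by auto
  then have "g t = v" using s1 s2 by auto
  then show False using t AB by auto
qed

text \<open>By injectivity \<open>v\<close> is passed at exactly one time \<open>s\<close>. A point
  outside \<open>A\<close> before \<open>s\<close>, or outside \<open>B\<close> after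
  \<open>s\<close>, would force a second passage.\<close>

lemma arc_splits_at_cut_point:
  fixes g :: "real \<Rightarrow> 'a::real_normed_vector"
  assumes AB: "closed A" "closed B" "A \<inter> B = {v}" and g: "arc g" "path_image g \<subseteq> A \<union> B"
    and ends: "pathstart g \<in> A" "pathfinish g \<in> B" "pathstart g \<noteq> v" "pathfinish g \<noteq> v"
  obtains s where "0 < s" "s < 1" "g s = v" "g ` {0..s} \<subseteq> A" "g ` {s..1} \<subseteq> B"
proof -
  have ends': "g 0 \<in> A" "g 1 \<in> B" "g 0 \<noteq> v" "g 1 \<noteq> v" using ends by (auto simp: pathstart_def pathfinish_def)
  have img: "g s \<in> A \<or> g s \<in> B" if "0 \<le> s" "s \<le> 1" for s
    using subsetD[OF g(2), of "g s"] that by (auto simp: path_image_def)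
  note cut = path_meets_cut_point[OF AB arc_imp_path[OF g(1)] g(2)]
  have "v \<in> g ` {0..1}" by (rule cut[of _ 0 1]) (use ends' in auto)
  then obtain s where s: "s \<in> {0..1}" "g s = v" by auto
  have s01: "0 < s" "s < 1" using s ends' by (auto simp: order_le_less)
  have A1: "g t \<in> A" if t: "0 \<le> t" "t < s" for t
  proof (rule ccontr)
    assume "g t \<notin> A"
    then have "g t \<in> B" using img[of t] t s by auto
    then have "v \<in> g ` {0..t}" by (intro cut[of _ 0 t]) (use ends' t s in auto)
    then obtain r where "r \<in> {0..t}" "g r = v" by auto
    then show False using arc_eqI[OF g(1), of r s] s t by auto
  qed
  have B1: "g t \<in> B" if t: "s < t" "t \<le> 1" for t
  proof (rule ccontr)
    assume "g t \<notin> B"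
    then have "g t \<in> A" using img[of t] t s by auto
    then have "v \<in> g ` {t..1}" by (intro cut[of _ t 1]) (use ends' t s in auto)
    then obtain r where "r \<in> {t..1}" "g r = v" by auto
    then show False using arc_eqI[OF g(1), of r s] s t by auto
  qed
  have "g ` {0..s} \<subseteq> A" "g ` {s..1} \<subseteq> B" using A1 B1 s AB by (force simp: order_le_less)+
  then show ?thesis using that s01 s by auto
qed

text \<open>Two points may be joined by several arcs (reparametrisations), so it is the length that is required
  to be unique.  Gluing two such sets at a single common point gives such a set again, because
  an arc cannot pass twice through the cut point.\<close>

definition geo_tree :: "'a::euclidean_space set \<Rightarrow> ('a \<Rightarrow> 'a \<Rightarrow> real) \<Rightarrow> bool" where
  "geo_tree A D \<longleftrightarrow> closed A \<and> (\<forall>x\<in>A. D x x = 0) \<and> (\<forall>x\<in>A. \<forall>y\<in>A. D x y = D y x) \<and>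
     (\<forall>x\<in>A. \<forall>y\<in>A. \<forall>z\<in>A. D x z \<le> D x y + D y z) \<and>
     (\<forall>x\<in>A. \<forall>y\<in>A. x \<noteq> y \<longrightarrow> (\<exists>g. arc g \<and> path_image g \<subseteq> A \<and> pathstart g = x \<and> pathfinish g = y)) \<and>
     (\<forall>x\<in>A. \<forall>y\<in>A. dist x y \<le> D x y) \<and>
     (\<forall>g. arc g \<and> path_image g \<subseteq> A \<longrightarrow> path_length g = ennreal (D (pathstart g) (pathfinish g)))"

lemma geo_treeD:
  assumes "geo_tree A D"
  shows "closed A" "x \<in> A \<Longrightarrow> D x x = 0" "x \<in> A \<Longrightarrow> y \<in> A \<Longrightarrow> D x y = D y x"
    "x \<in> A \<Longrightarrow> y \<in> A \<Longrightarrow> z \<in> A \<Longrightarrow> D x z \<le> D x y + D y z"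
    "x \<in> A \<Longrightarrow> y \<in> A \<Longrightarrow> x \<noteq> y \<Longrightarrow> \<exists>g. arc g \<and> path_image g \<subseteq> A \<and> pathstart g = x \<and> pathfinish g = y"
    "x \<in> A \<Longrightarrow> y \<in> A \<Longrightarrow> dist x y \<le> D x y"
    "arc g \<Longrightarrow> path_image g \<subseteq> A \<Longrightarrow> path_length g = ennreal (D (pathstart g) (pathfinish g))"
  using assms unfolding geo_tree_def by blast+

lemma geo_tree_nonneg: "geo_tree A D \<Longrightarrow> x \<in> A \<Longrightarrow> y \<in> A \<Longrightarrow> 0 \<le> D x y"
  using geo_treeD(6)[of A D x y] zero_le_dist[of x y] by linarith

text \<open>Both distances are the length of one and the same arc, since an arc in the smaller tree
  is an arc in the larger one. This is why the distance between two points does not depend on the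
  generation.\<close>

lemma geo_tree_subset_eq:
  assumes A: "geo_tree A D" and B: "geo_tree B E" and "A \<subseteq> B" "x \<in> A" "y \<in> A"
  shows "D x y = E x y"
proof (cases "x = y")
  case True then show ?thesis using assms geo_treeD(2)[OF A] geo_treeD(2)[OF B] by auto
next
  case False
  then obtain g where g: "arc g" "path_image g \<subseteq> A" "pathstart g = x" "pathfinish g = y"
    using geo_treeD(5)[OF A] assms by blast
  have "ennreal (D x y) = ennreal (E x y)"
    using geo_treeD(7)[OF A g(1,2)] geo_treeD(7)[OF B g(1)] g assms(3) by auto
  moreover have "0 \<le> D x y" "0 \<le> E x y"
    using geo_tree_nonneg[OF A] geo_tree_nonneg[OF B] assms(3-5) by (blast dest: subsetD)+
  ultimately show ?thesis by simp
qed

section \<open>Gluing of two trees at a single common point\<close>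

definition glue :: "'a set \<Rightarrow> ('a \<Rightarrow> 'a \<Rightarrow> real) \<Rightarrow> 'a set \<Rightarrow> ('a \<Rightarrow> 'a \<Rightarrow> real) \<Rightarrow> 'a \<Rightarrow> 'a \<Rightarrow> 'a \<Rightarrow> real" where
  "glue A D B E v x y =
     (if x \<in> A \<and> y \<in> A then D x y else if x \<in> B \<and> y \<in> B then E x y
      else if x \<in> A then D x v + E v y else E x v + D v y)"

text \<open>The clause on lengths is the essential one: an arc with both ends in one part stays in
  that part, and an arc between the parts splits at \<open>v\<close> into one arc in each, whose
  lengths add up.\<close>

lemma geo_tree_glue:
  assumes A: "geo_tree A D" and B: "geo_tree B E" and v: "A \<inter> B = {v}"
  shows "geo_tree (A \<union> B) (glue A D B E v)"
proof -
  let ?G = "glue A D B E v"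
  have vA: "v \<in> A" "v \<in> B" using v by auto
  have D0: "D v v = 0" "E v v = 0" using A B vA by (auto simp: geo_tree_def)
  have eqv: "x = v" if "x \<in> A" "x \<in> B" for x using v that by auto
  have AA: "?G x y = D x y" if "x \<in> A" "y \<in> A" for x y using that by (simp add: glue_def)
  have BB: "?G x y = E x y" if "x \<in> B" "y \<in> B" for x y
    using that eqv[of x] eqv[of y] D0 by (auto simp: glue_def)
  have ABx: "?G x y = D x v + E v y" if "x \<in> A" "y \<in> B" for x y
    using that eqv[of x] eqv[of y] D0 by (auto simp: glue_def)
  have BAx: "?G x y = E x v + D v y" if "x \<in> B" "y \<in> A" for x y
    using that eqv[of x] eqv[of y] D0 by (auto simp: glue_def)
  note G = AA BB ABx BAx
  note clA = geo_treeD(1)[OF A] and clB = geo_treeD(1)[OF B]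
  have sym: "?G x y = ?G y x" if "x \<in> A \<union> B" "y \<in> A \<union> B" for x y
    using that geo_treeD(3)[OF A] geo_treeD(3)[OF B] vA by (auto simp: G)
  have Dn: "0 \<le> D x y" if "x \<in> A" "y \<in> A" for x y using geo_tree_nonneg[OF A that] .
  have En: "0 \<le> E x y" if "x \<in> B" "y \<in> B" for x y using geo_tree_nonneg[OF B that] .
  have tri: "?G x z \<le> ?G x y + ?G y z" if xyz: "x \<in> A \<union> B" "y \<in> A \<union> B" "z \<in> A \<union> B" for x y z
  proof -
    have DT: "D x z \<le> D x y + D y z" if "x \<in> A" "y \<in> A" "z \<in> A" for x y z
      using geo_treeD(4)[OF A that] .
    have ET: "E x z \<le> E x y + E y z" if "x \<in> B" "y \<in> B" "z \<in> B" for x y z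
      using geo_treeD(4)[OF B that] .
    have DS: "D x v = D v x" if "x \<in> A" for x using geo_treeD(3)[OF A that vA(1)] .
    have ES: "E x v = E v x" if "x \<in> B" for x using geo_treeD(3)[OF B that vA(2)] .
    consider "x \<in> A" "y \<in> A" "z \<in> A" | "x \<in> A" "y \<in> A" "z \<in> B" | "x \<in> A" "y \<in> B" "z \<in> A" | "x \<in> A" "y \<in> B" "z \<in> B"
      | "x \<in> B" "y \<in> A" "z \<in> A" | "x \<in> B" "y \<in> A" "z \<in> B" | "x \<in> B" "y \<in> B" "z \<in> A" | "x \<in> B" "y \<in> B" "z \<in> B"
      using xyz by blast
    then show ?thesis
    proof cases
      case 1 then show ?thesis using DT[of x y z] by (simp add: G)
    next
      case 2 then show ?thesis using DT[of x y v] vA by (simp add: G)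
    next
      case 3 then show ?thesis using DT[of x v z] vA En[of v y] En[of y v] by (simp add: G)
    next
      case 4 then show ?thesis using ET[of v y z] vA by (simp add: G)
    next
      case 5 then show ?thesis using DT[of v y z] vA by (simp add: G)
    next
      case 6 then show ?thesis using ET[of x v z] vA Dn[of v y] Dn[of y v] by (simp add: G)
    next
      case 7 then show ?thesis using ET[of x y v] vA by (simp add: G)
    next
      case 8 then show ?thesis using ET[of x y z] by (simp add: G)
    qed
  qed
  have dst: "dist x y \<le> ?G x y" if "x \<in> A \<union> B" "y \<in> A \<union> B" for x y
  proof -
    have d: "dist x v \<le> D x v" "dist v x \<le> D v x" if "x \<in> A" for x
      using geo_treeD(6)[OF A that vA(1)] geo_treeD(6)[OF A vA(1) that] by auto
    have e: "dist x v \<le> E x v" "dist v x \<le> E v x" if "x \<in> B" for x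
      using geo_treeD(6)[OF B that vA(2)] geo_treeD(6)[OF B vA(2) that] by auto
    show ?thesis
      using that dist_triangle[of x y v] d[of x] d[of y] e[of x] e[of y] geo_treeD(6)[OF A, of x y] geo_treeD(6)[OF B, of x y]
      by (auto simp: G)
  qed
  have ex: "\<exists>g. arc g \<and> path_image g \<subseteq> A \<union> B \<and> pathstart g = x \<and> pathfinish g = y"
    if xy: "x \<in> A \<union> B" "y \<in> A \<union> B" "x \<noteq> y" for x y
  proof -
    have *: "\<exists>g. arc g \<and> path_image g \<subseteq> A \<union> B \<and> pathstart g = x \<and> pathfinish g = y"
      if xy: "x \<in> A" "y \<in> B" "x \<noteq> v" "y \<noteq> v" for x y
    proof -
      obtain g where g: "arc g" "path_image g \<subseteq> A" "pathstart g = x" "pathfinish g = v"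
        using geo_treeD(5)[OF A] xy vA by blast
      obtain h where h: "arc h" "path_image h \<subseteq> B" "pathstart h = v" "pathfinish h = y"
        using geo_treeD(5)[OF B] xy vA by metis
      have "arc (g +++ h)" using g h v by (intro arc_join) auto
      moreover have "path_image (g +++ h) \<subseteq> A \<union> B" using g h by (subst path_image_join) auto
      ultimately show ?thesis using g h by (intro exI[of _ "g +++ h"]) auto
    qed
    consider "x \<in> A" "y \<in> A" | "x \<in> B" "y \<in> B" | "x \<in> A" "y \<in> B" "x \<noteq> v" "y \<noteq> v" | "x \<in> B" "y \<in> A" "x \<noteq> v" "y \<noteq> v"
      using xy vA by blast
    then show ?thesis
    proof cases
      case 1 then show ?thesis using geo_treeD(5)[OF A 1 xy(3)] by blast
    next
      case 2 then show ?thesis using geo_treeD(5)[OF B 2 xy(3)] by blast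
    next
      case 3 then show ?thesis using * by blast
    next
      case 4
      then obtain g where "arc g" "path_image g \<subseteq> A \<union> B" "pathstart g = y" "pathfinish g = x" using *[of y x] by blast
      then show ?thesis by (intro exI[of _ "reversepath g"]) (auto simp: arc_reversepath)
    qed
  qed
  \<comment> \<open>Stated for arbitrary trees so that it serves both directions of passage through
    \<open>v\<close>.\<close>
  have split: "path_length g = ennreal (D1 (pathstart g) v + E1 v (pathfinish g))"
    if T: "geo_tree A1 D1" "geo_tree B1 E1" "A1 \<inter> B1 = {v}"
      and g: "arc g" "path_image g \<subseteq> A1 \<union> B1" and ends: "pathstart g \<in> A1" "pathfinish g \<in> B1" "pathstart g \<noteq> v" "pathfinish g \<noteq> v"
    for g A1 D1 B1 E1
  proof -
    obtain s where s: "0 < s" "s < 1" "g s = v" "g ` {0..s} \<subseteq> A1" "g ` {s..1} \<subseteq> B1"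
      using arc_splits_at_cut_point[OF geo_treeD(1)[OF T(1)] geo_treeD(1)[OF T(2)] T(3) g ends] by blast
    have p1: "path_length (subpath 0 s g) = ennreal (D1 (pathstart g) v)"
      using s g geo_treeD(7)[OF T(1), of "subpath 0 s g"]
      by (simp add: arc_subpath_arc path_image_subpath) (simp add: pathstart_def)
    have p2: "path_length (subpath s 1 g) = ennreal (E1 v (pathfinish g))"
      using s g geo_treeD(7)[OF T(2), of "subpath s 1 g"]
      by (simp add: arc_subpath_arc path_image_subpath) (simp add: pathfinish_def)
    have "0 \<le> D1 (pathstart g) v" "0 \<le> E1 v (pathfinish g)"
      by (intro geo_tree_nonneg[OF T(1)] geo_tree_nonneg[OF T(2)]; use T(3) ends in auto)+
    then show ?thesis using path_length_split[OF s(1,2), of g] p1 p2 by simp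
  qed
  have len: "path_length g = ennreal (?G (pathstart g) (pathfinish g))" if g: "arc g" "path_image g \<subseteq> A \<union> B" for g
  proof -
    have e: "pathstart g \<in> A \<union> B" "pathfinish g \<in> A \<union> B"
      using g by (auto simp: subset_iff)
    consider "pathstart g \<in> A" "pathfinish g \<in> A" | "pathstart g \<in> B" "pathfinish g \<in> B"
      | "pathstart g \<in> A" "pathfinish g \<in> B" "pathstart g \<noteq> v" "pathfinish g \<noteq> v"
      | "pathstart g \<in> B" "pathfinish g \<in> A" "pathstart g \<noteq> v" "pathfinish g \<noteq> v"
      using e vA by blast
    then show ?thesis
    proof cases
      case 1
      then show ?thesis using geo_treeD(7)[OF A g(1) arc_stays_in_part[OF clA clB v g 1]] by (simp add: G)
    next
      case 2
      have v': "B \<inter> A = {v}" and g': "path_image g \<subseteq> B \<union> A" using v g by auto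
      show ?thesis using geo_treeD(7)[OF B g(1) arc_stays_in_part[OF clB clA v' g(1) g' 2]] 2 by (simp add: G)
    next
      case 3 then show ?thesis using split[OF A B v g] by (simp add: G)
    next
      case 4
      have v': "B \<inter> A = {v}" and g': "path_image g \<subseteq> B \<union> A" using v g by auto
      show ?thesis using split[OF B A v' g(1) g'] 4 by (simp add: G)
    qed
  qed
  show ?thesis
    unfolding geo_tree_def
  proof (intro conjI ballI allI impI)
    show "closed (A \<union> B)" using clA clB by auto
    fix x assume "x \<in> A \<union> B"
    then show "?G x x = 0" using geo_treeD(2)[OF A] geo_treeD(2)[OF B] by (auto simp: G)
  qed (use sym tri dst ex len in auto)
qed

text \<open>The glued tree on \<open>A \<union> B\<close> is contained in \<open>C\<close>, so its
  distance, which is additive at \<open>v\<close> by construction, agrees with that of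
  \<open>C\<close>.\<close>

lemma geo_tree_cut_point:
  assumes C: "geo_tree C F" and A: "geo_tree A D" and B: "geo_tree B E" and v: "A \<inter> B = {v}"
    and sub: "A \<subseteq> C" "B \<subseteq> C" and xy: "x \<in> A" "y \<in> B"
  shows "F x y = F x v + F v y"
proof -
  have vA: "v \<in> A" "v \<in> B" using v by auto
  note G = geo_tree_glue[OF A B v]
  have "F x y = glue A D B E v x y"
    using geo_tree_subset_eq[OF G C] sub xy by simp
  also have "\<dots> = D x v + E v y"
  proof -
    have "x = v" if "x \<in> B" using v xy that by auto
    moreover have "y = v" if "y \<in> A" using v xy that by auto
    ultimately show ?thesis
      using xy vA geo_treeD(2)[OF A vA(1)] geo_treeD(2)[OF B vA(2)] by (auto simp: glue_def)
  qed
  also have "D x v = F x v" using geo_tree_subset_eq[OF A C] sub xy vA by simp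
  also have "E v y = F v y" using geo_tree_subset_eq[OF B C] sub xy vA by simp
  finally show ?thesis .
qed

text \<open>\<open>\<phi>\<close> is an isometric coordinate on the segment, so an arc becomes a
  continuous injective real function on an interval.\<close>

lemma geo_tree_segment:
  fixes a b :: "'a::euclidean_space"
  assumes "a \<noteq> b"
  shows "geo_tree (closed_segment a b) dist"
proof -
  let ?S = "closed_segment a b"
  define \<phi> where "\<phi> z = (z - a) \<bullet> (b - a) / norm (b - a)" for z
  have iso: "dist z w = \<bar>\<phi> z - \<phi> w\<bar>" if "z \<in> ?S" "w \<in> ?S" for z w
  proof -
    obtain s t where st: "z = a + s *\<^sub>R (b - a)" "w = a + t *\<^sub>R (b - a)"
      using \<open>z \<in> ?S\<close> \<open>w \<in> ?S\<close> by (auto simp: in_segment algebra_simps)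
    have "dist z w = norm ((s - t) *\<^sub>R (b - a))" unfolding st dist_norm by (simp add: algebra_simps)
    also have "\<dots> = \<bar>s - t\<bar> * norm (b - a)" by simp
    also have "\<phi> z = s * norm (b - a)" "\<phi> w = t * norm (b - a)"
      using assms by (auto simp: \<phi>_def st power2_norm_eq_inner[symmetric] power2_eq_square)
    then have "\<bar>s - t\<bar> * norm (b - a) = \<bar>\<phi> z - \<phi> w\<bar>" by (simp add: left_diff_distrib[symmetric] abs_mult)
    finally show ?thesis .
  qed
  have len: "path_length g = ennreal (dist (pathstart g) (pathfinish g))" if g: "arc g" "path_image g \<subseteq> ?S" for g
  proof -
    have cont: "continuous_on {0..1} g" and inj: "inj_on g {0..1}" using g by (auto simp: arc_def path_def)
    have gS: "g t \<in> ?S" if "t \<in> {0..1}" for t using g that by (auto simp: path_image_def)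
    define u where "u = \<phi> \<circ> g"
    have cu: "continuous_on {0..1} u" unfolding u_def \<phi>_def o_def
      by (intro continuous_intros cont) (use assms in auto)
    have d: "dist (g s) (g t) = \<bar>u s - u t\<bar>" if "s \<in> {0..1}" "t \<in> {0..1}" for s t
      using iso[OF gS gS] that by (simp add: u_def)
    have iu: "inj_on u {0..1}"
    proof (rule inj_onI)
      fix s t :: real assume "s \<in> {0..1}" "t \<in> {0..1}" "u s = u t"
      then show "s = t" using d[of s t] inj by (auto simp: inj_on_def)
    qed
    have pm: "pathstart g = g 0" "pathfinish g = g 1" by (auto simp: pathstart_def pathfinish_def)
    \<comment> \<open>A continuous injective function on an interval is monotone. The decreasing
      case is treated with \<open>- u\<close>, because only \<open>\<bar>u s - u t\<bar>\<close>
      enters.\<close>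
    have ex: "mono_on {0..1} u \<or> mono_on {0..1} (\<lambda>t. - u t)"
      using iu injective_eq_monotone_map[of "{0..1}" u] cu
      by (force simp: monotone_on_def is_interval_cc order_le_less)
    then show ?thesis
    proof
      assume "mono_on {0..1} u" then show ?thesis unfolding pm by (rule path_length_monotone_real) (use d in auto)
    next
      assume "mono_on {0..1} (\<lambda>t. - u t)" then show ?thesis unfolding pm by (rule path_length_monotone_real) (use d in auto)
    qed
  qed
  show ?thesis unfolding geo_tree_def
  proof (intro conjI ballI allI impI)
    fix x y assume xy: "x \<in> ?S" "y \<in> ?S" "x \<noteq> y"
    show "\<exists>g. arc g \<and> path_image g \<subseteq> ?S \<and> pathstart g = x \<and> pathfinish g = y"
      using xy by (intro exI[of _ "linepath x y"]) (simp add: arc_linepath subset_closed_segment)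
  qed (use len dist_triangle dist_commute in auto)
qed

lemma geo_tree_image:
  fixes f :: "'a::euclidean_space \<Rightarrow> 'a"
  assumes A: "geo_tree A D" and f: "\<And>x y. dist (f x) (f y) = c * dist x y" and c: "0 < c"
    and h: "\<And>x. h (f x) = x" "\<And>x. f (h x) = x"
  shows "geo_tree (f ` A) (\<lambda>x y. c * D (h x) (h y))"
proof -
  have contf: "continuous_on UNIV f"
    by (rule Lipschitz.lipschitz_on_continuous_on[of c]) (use f c in \<open>auto simp: lipschitz_on_def\<close>)
  have dh: "dist (h x) (h y) = (1/c) * dist x y" for x y using f[of "h x" "h y"] h c by (simp add: field_simps)
  have conth: "continuous_on UNIV h"
    by (rule Lipschitz.lipschitz_on_continuous_on[of "1/c"]) (use dh c in \<open>auto simp: lipschitz_on_def\<close>)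
  have im: "f ` A = h -` A" using h by (auto simp: image_iff) metis
  have cl: "closed (f ` A)" unfolding im using continuous_closed_vimage[of A h] geo_treeD(1)[OF A] conth
    by (simp add: continuous_on_eq_continuous_within)
  have injf: "inj f" "inj h" using h by (metis injI)+
  show ?thesis unfolding geo_tree_def
  proof (intro conjI ballI allI impI)
    fix x y assume "x \<in> f ` A" "y \<in> f ` A" "x \<noteq> y"
    then obtain x' y' where xy: "x' \<in> A" "y' \<in> A" "x = f x'" "y = f y'" "x' \<noteq> y'" by auto
    then obtain g where g: "arc g" "path_image g \<subseteq> A" "pathstart g = x'" "pathfinish g = y'"
      using geo_treeD(5)[OF A] by blast
    have "arc (f \<circ> g)" using g(1) injf contf unfolding arc_def
      by (auto intro!: path_continuous_image comp_inj_on intro: continuous_on_subset inj_on_subset)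
    then show "\<exists>g. arc g \<and> path_image g \<subseteq> f ` A \<and> pathstart g = x \<and> pathfinish g = y"
      using g xy by (intro exI[of _ "f \<circ> g"]) (auto simp: path_image_compose pathstart_compose pathfinish_compose)
  next
    fix g assume "arc g \<and> path_image g \<subseteq> f ` A"
    then have g: "arc g" "path_image g \<subseteq> f ` A" by auto
    have "arc (h \<circ> g)" using g(1) injf conth unfolding arc_def
      by (auto intro!: path_continuous_image comp_inj_on intro: continuous_on_subset inj_on_subset)
    moreover have "path_image (h \<circ> g) \<subseteq> A" using g(2) h unfolding im by (auto simp: path_image_compose)
    ultimately have "path_length (h \<circ> g) = ennreal (D (h (pathstart g)) (h (pathfinish g)))"
      using geo_treeD(7)[OF A] by (simp add: pathstart_compose pathfinish_compose)
    moreover have "path_length (f \<circ> (h \<circ> g)) = ennreal c * path_length (h \<circ> g)"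
      using c by (intro path_length_scale f) auto
    moreover have "f \<circ> (h \<circ> g) = g" using h by auto
    ultimately show "path_length g = ennreal (c * D (h (pathstart g)) (h (pathfinish g)))"
      using c by (simp add: ennreal_mult')
  next
    fix x y z assume "x \<in> f ` A" "y \<in> f ` A" "z \<in> f ` A"
    then have "D (h x) (h z) \<le> D (h x) (h y) + D (h y) (h z)" using geo_treeD(4)[OF A] h by auto
    then show "c * D (h x) (h z) \<le> c * D (h x) (h y) + c * D (h y) (h z)"
      using c by (simp flip: distrib_left)
  next
    fix x y assume "x \<in> f ` A" "y \<in> f ` A"
    then show "dist x y \<le> c * D (h x) (h y)" using geo_treeD(6)[OF A] h c f by auto
  qed (use cl h geo_treeD(2,3)[OF A] in auto)
qed

subsection \<open>The trees approximating the Vicsek set\<close>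

text \<open>The modulus of all coordinates of the four corners. The bound
  \<open>1/2 \<le> hs\<close> turns a separation in one coordinate into a numerical lower bound for
  the distance.\<close>

definition hs :: real where "hs = sqrt 2 / 2"

lemma hs_ge: "1/2 \<le> hs" and hs_sq: "hs\<^sup>2 = 1/2"
  by (simp_all add: hs_def power_divide)

lemma hs_pos: "0 < hs" using hs_ge by linarith

text \<open>Index of the diagonally opposite corner. It is needed because the cell of corner
  \<open>i\<close> touches the central cell at the image of its corner \<open>opp i\<close>. All
  other indices go to \<open>5\<close>, so that \<open>vicsek_q (opp i) = - vicsek_q i\<close> holds
  without exception.\<close>

definition opp :: "nat \<Rightarrow> nat" where
  "opp i = (if i = 1 then 3 else if i = 2 then 4 else if i = 3 then 1 else if i = 4 then 2 else 5)"

definition psi_inv :: "nat \<Rightarrow> real^2 \<Rightarrow> real^2" where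
  "psi_inv i x = 3 *\<^sub>R x - 2 *\<^sub>R vicsek_q i"

lemma q_nth:
  "vicsek_q 1 $ 1 = - hs" "vicsek_q 1 $ 2 = hs" "vicsek_q 2 $ 1 = hs" "vicsek_q 2 $ 2 = hs"
  "vicsek_q 3 $ 1 = hs" "vicsek_q 3 $ 2 = - hs" "vicsek_q 4 $ 1 = - hs" "vicsek_q 4 $ 2 = - hs"
  "vicsek_q (Suc 0) $ 1 = - hs" "vicsek_q (Suc 0) $ 2 = hs"
  "vicsek_q 5 = 0"
  by (auto simp: vicsek_q_def hs_def)

lemma le4_cases:
  assumes "i \<in> {1..4}" obtains "i = 1" | "i = 2" | "i = 3" | "i = (4::nat)"
  using assms by force

lemma le5_cases:
  assumes "i \<in> {1..5}" obtains "i \<in> {1..4}" | "i = (5::nat)"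
  using assms by force

lemma psi_alt: "vicsek_psi i z = (1/3) *\<^sub>R z + (2/3) *\<^sub>R vicsek_q i"
  by (auto simp: vicsek_psi_def vec_eq_iff algebra_simps)

lemma psi_inv_psi [simp]: "psi_inv i (vicsek_psi i x) = x" by (auto simp: psi_inv_def psi_alt vec_eq_iff)
lemma psi_psi_inv [simp]: "vicsek_psi i (psi_inv i x) = x" by (auto simp: psi_inv_def psi_alt vec_eq_iff diff_divide_distrib)

lemma psi_eq_iff [simp]: "vicsek_psi i x = vicsek_psi i y \<longleftrightarrow> x = y"
  by (metis psi_inv_psi)

lemma dist_psi: "dist (vicsek_psi i x) (vicsek_psi i y) = (1/3) * dist x y"
  by (simp add: psi_alt dist_norm scaleR_diff_right[symmetric])

lemma continuous_psi: "continuous_on A (vicsek_psi i)" unfolding psi_alt by (intro continuous_intros)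
lemma continuous_psi_inv: "continuous_on A (psi_inv i)" unfolding psi_inv_def by (intro continuous_intros)

lemma psi_q [simp]: "vicsek_psi i (vicsek_q i) = vicsek_q i" by (simp add: vicsek_psi_def)

lemma psi_5: "vicsek_psi 5 x = (1/3) *\<^sub>R x" by (simp add: psi_alt q_nth)

lemma q_opp: "vicsek_q (opp i) = - vicsek_q i"
  by (auto simp: opp_def vicsek_q_def vec_eq_iff forall_2)

lemma psi_opp: "vicsek_psi i (vicsek_q (opp i)) = (1/3) *\<^sub>R vicsek_q i"
  by (simp add: psi_alt q_opp vec_eq_iff)

lemma opp_le4 [simp]: "i \<in> {1..4} \<Longrightarrow> opp i \<in> {1..4}" by (erule le4_cases) (auto simp: opp_def)
lemma opp_opp: "i \<in> {1..4} \<Longrightarrow> opp (opp i) = i" by (erule le4_cases) (auto simp: opp_def)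
lemma opp_neq: "i \<in> {1..4} \<Longrightarrow> opp i \<noteq> i" by (erule le4_cases) (auto simp: opp_def)

lemma norm_q: "i \<in> {1..4} \<Longrightarrow> norm (vicsek_q i) = 1"
  by (erule le4_cases) (auto simp: norm_vec_def L2_set_def sum_2 q_nth hs_sq)

lemma q_sign: "i \<in> {1..4} \<Longrightarrow> \<exists>\<sigma>. \<bar>\<sigma>\<bar> = 1 \<and> vicsek_q i $ k = \<sigma> * hs"
proof -
  assume "i \<in> {1..4}"
  then have "vicsek_q i $ k = 1 * hs \<or> vicsek_q i $ k = (-1) * hs"
    using exhaust_2[of k] by (elim le4_cases) (auto simp: q_nth)
  moreover have "\<bar>1::real\<bar> = 1" "\<bar>-1::real\<bar> = 1" by auto
  ultimately show ?thesis by blast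
qed

text \<open>Two distinct corners of a square have opposite signs in some coordinate; that coordinate
  witnesses the separation estimates for corner cells and for arms.\<close>

lemma q_differ: 
  assumes "i \<in> {1..4}" "j \<in> {1..4}" "i \<noteq> j"
  obtains k \<sigma> where "\<bar>\<sigma>\<bar> = 1" "vicsek_q i $ k = \<sigma> * hs" "vicsek_q j $ k = - \<sigma> * hs"
proof -
  have "vicsek_q j $ 1 = - vicsek_q i $ 1 \<or> vicsek_q j $ 2 = - vicsek_q i $ 2"
    using assms by (elim le4_cases) (auto simp: q_nth)
  then obtain k where k: "vicsek_q j $ k = - vicsek_q i $ k" by blast
  obtain \<sigma> where "\<bar>\<sigma>\<bar> = 1" "vicsek_q i $ k = \<sigma> * hs" using q_sign[OF assms(1)] by blast
  then show ?thesis using that[of \<sigma> k] k by simp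
qed

section \<open>A coordinate box mapped into itself by the five maps, and the separation of its
  images\<close>

definition square :: "(real^2) set" where "square = {x. \<forall>k. \<bar>x $ k\<bar> \<le> hs}"

lemma q_abs: "i \<in> {1..5} \<Longrightarrow> \<bar>vicsek_q i $ k\<bar> \<le> hs"
proof (erule le5_cases)
  assume "i \<in> {1..4}"
  then obtain \<sigma> where "\<bar>\<sigma>\<bar> = 1" "vicsek_q i $ k = \<sigma> * hs" using q_sign[of i k] by blast
  then show "\<bar>vicsek_q i $ k\<bar> \<le> hs" using hs_pos by (simp add: abs_mult)
qed (use hs_pos in \<open>simp add: q_nth\<close>)

lemma psi_box:
  assumes "x \<in> square" "i \<in> {1..5}" shows "vicsek_psi i x \<in> square"
proof -
  have "\<bar>vicsek_psi i x $ k\<bar> \<le> hs" for k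
  proof -
    have "\<bar>vicsek_q i $ k\<bar> \<le> hs"
      using q_abs[OF assms(2)] .
    moreover have "\<bar>x $ k\<bar> \<le> hs" using assms by (auto simp: square_def)
    ultimately show ?thesis unfolding psi_alt by (simp add: abs_le_iff)
  qed
  then show ?thesis by (simp add: square_def)
qed

lemma psi_box_nth:
  assumes "x \<in> vicsek_psi i ` square" shows "\<bar>x $ k - (2/3) * vicsek_q i $ k\<bar> \<le> hs / 3"
proof -
  obtain z where z: "z \<in> square" "x = vicsek_psi i z" using assms by auto
  then have "\<bar>z $ k\<bar> \<le> hs" by (auto simp: square_def)
  then show ?thesis unfolding z(2) psi_alt by (simp add: abs_le_iff)
qed

text \<open>In every coordinate the two boxes lie on opposite sides of the junction, with the
  junction on the boundary of both. Hence the junction is no farther from either point than the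
  points are from each other.\<close>

lemma corner_center_nth:
  assumes "i \<in> {1..4}" "x \<in> vicsek_psi i ` square" "y \<in> vicsek_psi 5 ` square"
  shows "\<bar>x $ k - ((1/3) *\<^sub>R vicsek_q i) $ k\<bar> \<le> \<bar>x $ k - y $ k\<bar>"
    "\<bar>((1/3) *\<^sub>R vicsek_q i) $ k - y $ k\<bar> \<le> \<bar>x $ k - y $ k\<bar>"
proof -
  obtain \<sigma> where s: "\<bar>\<sigma>\<bar> = 1" "vicsek_q i $ k = \<sigma> * hs" using q_sign[OF assms(1)] by blast
  have "\<sigma> = 1 \<or> \<sigma> = -1" using s(1) by linarith
  then show "\<bar>x $ k - ((1/3) *\<^sub>R vicsek_q i) $ k\<bar> \<le> \<bar>x $ k - y $ k\<bar>"
    "\<bar>((1/3) *\<^sub>R vicsek_q i) $ k - y $ k\<bar> \<le> \<bar>x $ k - y $ k\<bar>"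
    using psi_box_nth[OF assms(2), of k] psi_box_nth[OF assms(3), of k] s(2)
    by (auto simp: q_nth abs_if split: if_splits)
qed

lemma corner_center_dist:
  assumes "i \<in> {1..4}" "x \<in> vicsek_psi i ` square" "y \<in> vicsek_psi 5 ` square"
  shows "dist x ((1/3) *\<^sub>R vicsek_q i) \<le> dist x y" "dist ((1/3) *\<^sub>R vicsek_q i) y \<le> dist x y"
  unfolding dist_norm using corner_center_nth[OF assms]
  by (auto intro!: norm_le_componentwise_cart simp del: vector_scaleR_component)

lemma corner_center_meet:
  assumes "i \<in> {1..4}" "x \<in> vicsek_psi i ` square" "x \<in> vicsek_psi 5 ` square"
  shows "x = (1/3) *\<^sub>R vicsek_q i"
  using corner_center_dist[OF assms] by simp

text \<open>In a coordinate of opposite signs one box lies beyond \<open>hs / 3\<close> and the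
  other beyond \<open>- hs / 3\<close>, which leaves a gap of
  \<open>2 * hs / 3 \<ge> 1/3\<close>.\<close>

lemma corners_apart:
  assumes ij: "i \<in> {1..4}" "j \<in> {1..4}" "i \<noteq> j" and "x \<in> vicsek_psi i ` square" "y \<in> vicsek_psi j ` square"
  shows "1/3 \<le> dist x y"
proof -
  obtain k \<sigma> where s: "\<bar>\<sigma>\<bar> = 1" "vicsek_q i $ k = \<sigma> * hs" "vicsek_q j $ k = - \<sigma> * hs" using q_differ[OF ij] by blast
  have "\<sigma> = 1 \<or> \<sigma> = -1" using s(1) by linarith
  then have "2 * hs / 3 \<le> \<bar>x $ k - y $ k\<bar>"
    using psi_box_nth[OF assms(4), of k] psi_box_nth[OF assms(5), of k] s
    by (auto simp: abs_if split: if_splits)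
  also have "\<dots> \<le> dist x y" using component_le_norm_cart[of "x - y" k] by (simp add: dist_norm)
  finally show ?thesis using hs_ge by linarith
qed

lemma q_box: "i \<in> {1..5} \<Longrightarrow> vicsek_q i \<in> square"
  using q_abs by (simp add: square_def)

lemma corner_apart_cell:
  assumes "a \<in> {1..4}" "i \<in> {1..5}" "i \<noteq> a" "x \<in> vicsek_psi i ` square"
  shows "1/3 \<le> dist x (vicsek_q a)"
  using assms(2)
proof (cases rule: le5_cases)
  case 1
  have "vicsek_q a \<in> vicsek_psi a ` square" using imageI[OF q_box[of a], of "vicsek_psi a"] assms(1) by simp
  then show ?thesis using corners_apart[OF 1 assms(1,3)] assms(4) by blast
next
  case 2
  obtain \<sigma> where s: "\<bar>\<sigma>\<bar> = 1" "vicsek_q a $ 1 = \<sigma> * hs" using q_sign[OF assms(1)] by blast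
  have "\<sigma> = 1 \<or> \<sigma> = -1" using s(1) by linarith
  then have "2 * hs / 3 \<le> \<bar>x $ 1 - vicsek_q a $ 1\<bar>"
    using psi_box_nth[OF assms(4), of 1] s 2
    by (auto simp: abs_if q_nth split: if_splits)
  also have "\<dots> \<le> dist x (vicsek_q a)" using component_le_norm_cart[of "x - vicsek_q a" 1] by (simp add: dist_norm)
  finally show ?thesis using hs_ge by linarith
qed

lemma seg_0: "closed_segment (vicsek_q 5) (vicsek_q i) = {t *\<^sub>R vicsek_q i | t. 0 \<le> t \<and> t \<le> 1}"
  by (auto simp: closed_segment_def q_nth)

lemma V_box: "vicsek_V n \<subseteq> square"
proof (induction n)
  case 0
  have "t *\<^sub>R vicsek_q i \<in> square" if "i \<in> {1..4}" "0 \<le> t" "t \<le> 1" for i t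
  proof -
    have "\<bar>t * vicsek_q i $ k\<bar> \<le> 1 * hs" for k
      unfolding abs_mult using that q_abs[of i k] by (intro mult_mono) auto
    then show ?thesis by (simp add: square_def)
  qed
  then show ?case by (auto simp: seg_0)
next
  case (Suc n) then show ?case using psi_box by (auto simp: subset_iff)
qed

lemma psi_V: "i \<in> {1..5} \<Longrightarrow> x \<in> vicsek_V n \<Longrightarrow> vicsek_psi i x \<in> vicsek_V (Suc n)" by auto

text \<open>An arm is cut into thirds: the inner third is an arm of the central cell, the other two
  form the diagonal of the cell at its end.\<close>

lemma V_mono_Suc: "vicsek_V n \<subseteq> vicsek_V (Suc n)"
proof (induction n)
  case 0
  have "t *\<^sub>R vicsek_q i \<in> vicsek_V (Suc 0)" if i: "i \<in> {1..4}" and t: "0 \<le> t" "t \<le> 1" for i t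
  proof -
    have seg: "u *\<^sub>R vicsek_q j \<in> vicsek_V 0" if "j \<in> {1..4}" "0 \<le> u" "u \<le> 1" for u j
      using that by (auto simp: seg_0)
    have i': "i \<in> {1..5}" using i by simp
    consider "t \<le> 1/3" | "1/3 \<le> t" "t \<le> 2/3" | "2/3 \<le> t" by linarith
    then show ?thesis
    proof cases
      case 1
      have "vicsek_psi 5 ((3*t) *\<^sub>R vicsek_q i) = t *\<^sub>R vicsek_q i" by (simp add: psi_5)
      moreover have "(3*t) *\<^sub>R vicsek_q i \<in> vicsek_V 0" using seg i t 1 by simp
      ultimately show ?thesis using psi_V[of 5] by (metis atLeastAtMost_iff one_le_numeral order_refl)
    next
      case 2
      \<comment> \<open>In the middle third the arm of cell \<open>i\<close> is the one that points
        back to the centre, hence the corner \<open>opp i\<close> and the reversed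
        parameter.\<close>
      have "vicsek_psi i ((2 - 3*t) *\<^sub>R vicsek_q (opp i)) = t *\<^sub>R vicsek_q i" by (simp add: psi_alt q_opp vec_eq_iff algebra_simps)
      moreover have "(2 - 3*t) *\<^sub>R vicsek_q (opp i) \<in> vicsek_V 0" by (rule seg[OF opp_le4[OF i]]) (use 2 in auto)
      ultimately show ?thesis using psi_V[of i] i' by metis
    next
      case 3
      have "vicsek_psi i ((3*t - 2) *\<^sub>R vicsek_q i) = t *\<^sub>R vicsek_q i" by (simp add: psi_alt vec_eq_iff algebra_simps)
      moreover have "(3*t - 2) *\<^sub>R vicsek_q i \<in> vicsek_V 0" using seg i t 3 by simp
      ultimately show ?thesis using psi_V[of i] i' by metis
    qed
  qed
  then show ?case unfolding vicsek_V.simps(1) seg_0 by blast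
next
  case (Suc n)
  then show ?case by (subst (1 2) vicsek_V.simps(2)) (intro UN_mono image_mono; simp)
qed

lemma V_mono: "n \<le> m \<Longrightarrow> vicsek_V n \<subseteq> vicsek_V m"
  using lift_Suc_mono_le[of vicsek_V] V_mono_Suc by blast

lemma q_in_V: "i \<in> {1..5} \<Longrightarrow> vicsek_q i \<in> vicsek_V n"
proof -
  assume "i \<in> {1..5}"
  then have "vicsek_q i \<in> vicsek_V 0"
  proof (rule le5_cases)
    assume "i \<in> {1..4}" then show ?thesis using ends_in_segment(2) by auto
  next
    assume "i = 5" then show ?thesis by (auto intro!: bexI[of _ 1])
  qed
  then show ?thesis using V_mono[of 0 n] by blast
qed

lemma junction_in:
  assumes "i \<in> {1..4}"
  shows "(1/3) *\<^sub>R vicsek_q i \<in> vicsek_psi i ` vicsek_V n" "(1/3) *\<^sub>R vicsek_q i \<in> vicsek_psi 5 ` vicsek_V n"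
proof -
  have "vicsek_q (opp i) \<in> vicsek_V n" "vicsek_q i \<in> vicsek_V n"
    using opp_le4[OF assms] assms by (auto intro!: q_in_V)
  then show "(1/3) *\<^sub>R vicsek_q i \<in> vicsek_psi i ` vicsek_V n" "(1/3) *\<^sub>R vicsek_q i \<in> vicsek_psi 5 ` vicsek_V n"
    using psi_opp[of i] psi_5[of "vicsek_q i"] by (metis imageI)+
qed

lemma psi_V_box: "vicsek_psi i ` vicsek_V n \<subseteq> vicsek_psi i ` square" using V_box by blast

lemma cell_V_inter_center:
  assumes "i \<in> {1..4}"
  shows "vicsek_psi i ` vicsek_V n \<inter> vicsek_psi 5 ` vicsek_V n = {(1/3) *\<^sub>R vicsek_q i}"
proof
  show "vicsek_psi i ` vicsek_V n \<inter> vicsek_psi 5 ` vicsek_V n \<subseteq> {(1/3) *\<^sub>R vicsek_q i}"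
  proof
    fix x assume "x \<in> vicsek_psi i ` vicsek_V n \<inter> vicsek_psi 5 ` vicsek_V n"
    then have "x \<in> vicsek_psi i ` square" "x \<in> vicsek_psi 5 ` square"
      by (metis IntD1 IntD2 psi_V_box subsetD)+
    then show "x \<in> {(1/3) *\<^sub>R vicsek_q i}" using corner_center_meet[OF assms] by simp
  qed
qed (use junction_in[OF assms, of n] in simp)

lemma cell_V_inter_corners:
  assumes "i \<in> {1..4}" "j \<in> {1..4}" "i \<noteq> j"
  shows "vicsek_psi i ` vicsek_V n \<inter> vicsek_psi j ` vicsek_V n = {}"
proof -
  have False if "x \<in> vicsek_psi i ` vicsek_V n" "x \<in> vicsek_psi j ` vicsek_V n" for x
    using corners_apart[OF assms, of x x] that psi_V_box[of i n] psi_V_box[of j n] by auto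
  then show ?thesis by blast
qed

text \<open>In a coordinate in which the corners have opposite signs the two contributions add up
  instead of cancelling; \<open>1/2 \<le> hs\<close> gives the factor \<open>2\<close>.\<close>

lemma arms_apart:
  assumes ij: "i \<in> {1..4}" "j \<in> {1..4}" "i \<noteq> j" and tu: "0 \<le> t" "0 \<le> u"
  shows "t + u \<le> 2 * dist (t *\<^sub>R vicsek_q i) (u *\<^sub>R vicsek_q j)"
proof -
  obtain k \<sigma> where s: "\<bar>\<sigma>\<bar> = 1" "vicsek_q i $ k = \<sigma> * hs" "vicsek_q j $ k = - \<sigma> * hs" using q_differ[OF ij] by blast
  have "(t *\<^sub>R vicsek_q i - u *\<^sub>R vicsek_q j) $ k = (t + u) * (\<sigma> * hs)" using s by (simp add: algebra_simps)
  then have "\<bar>(t *\<^sub>R vicsek_q i - u *\<^sub>R vicsek_q j) $ k\<bar> = (t + u) * hs"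
    using s(1) hs_pos tu by (simp add: abs_mult)
  then have "(t + u) * hs \<le> dist (t *\<^sub>R vicsek_q i) (u *\<^sub>R vicsek_q j)"
    using component_le_norm_cart[of "t *\<^sub>R vicsek_q i - u *\<^sub>R vicsek_q j" k] by (simp add: dist_norm)
  with mult_left_mono[OF hs_ge, of "t + u"] tu
  have "(t + u) * (1/2) \<le> dist (t *\<^sub>R vicsek_q i) (u *\<^sub>R vicsek_q j)" by linarith
  then show ?thesis by simp
qed

lemma seg_inter:
  assumes ij: "i \<in> {1..4}" "j \<in> {1..4}" "i \<noteq> j"
  shows "closed_segment (vicsek_q 5) (vicsek_q i) \<inter> closed_segment (vicsek_q 5) (vicsek_q j) = {0}"
proof
  show "closed_segment (vicsek_q 5) (vicsek_q i) \<inter> closed_segment (vicsek_q 5) (vicsek_q j) \<subseteq> {0}"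
  proof
    fix x assume "x \<in> closed_segment (vicsek_q 5) (vicsek_q i) \<inter> closed_segment (vicsek_q 5) (vicsek_q j)"
    then obtain t u where "x = t *\<^sub>R vicsek_q i" "x = u *\<^sub>R vicsek_q j" "0 \<le> t" "0 \<le> u"
      unfolding seg_0 by blast
    then have "t = 0" using arms_apart[OF ij, of t u] by auto
    with \<open>x = t *\<^sub>R vicsek_q i\<close> show "x \<in> {0}" by simp
  qed
qed (simp add: q_nth)

lemma geo_tree_V_0: "\<exists>D. geo_tree (vicsek_V 0) D"
proof -
  let ?s = "\<lambda>i. closed_segment (vicsek_q 5) (vicsek_q i)"
  have T: "geo_tree (?s i) dist" if "i \<in> {1..4}" for i
    by (rule geo_tree_segment) (use norm_q[OF that] in \<open>auto simp: q_nth\<close>)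
  note I = seg_inter
  obtain D2 where D2: "geo_tree (?s 1 \<union> ?s 2) D2"
    using geo_tree_glue[OF T[of 1] T[of 2] I[of 1 2]] by auto
  have "(?s 1 \<union> ?s 2) \<inter> ?s 3 = {0}" using I[of 1 3] I[of 2 3] by auto
  then obtain D3 where D3: "geo_tree (?s 1 \<union> ?s 2 \<union> ?s 3) D3"
    using geo_tree_glue[OF D2 T[of 3]] by auto
  have "(?s 1 \<union> ?s 2 \<union> ?s 3) \<inter> ?s 4 = {0}" using I[of 1 4] I[of 2 4] I[of 3 4] by auto
  then obtain D4 where D4: "geo_tree (?s 1 \<union> ?s 2 \<union> ?s 3 \<union> ?s 4) D4"
    using geo_tree_glue[OF D3 T[of 4]] by auto
  moreover have "{1..4} = {1, 2, 3, 4::nat}" by auto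
  then have "vicsek_V 0 = ?s 1 \<union> ?s 2 \<union> ?s 3 \<union> ?s 4" by auto
  ultimately show ?thesis by metis
qed

lemma geo_tree_psi: "geo_tree A D \<Longrightarrow> geo_tree (vicsek_psi i ` A) (\<lambda>x y. (1/3) * D (psi_inv i x) (psi_inv i y))"
  by (rule geo_tree_image) (auto simp: dist_psi)

text \<open>Gluing starts from the central cell. Then every corner cell meets the union built so far
  in exactly one point, its junction, because corner cells are pairwise disjoint.\<close>

lemma geo_tree_V: "\<exists>D. geo_tree (vicsek_V n) D"
proof (induction n)
  case 0 show ?case by (rule geo_tree_V_0)
next
  case (Suc n)
  then obtain D where D: "geo_tree (vicsek_V n) D" ..
  let ?s = "\<lambda>i. vicsek_psi i ` vicsek_V n"
  note T = geo_tree_psi[OF D]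
  note I = cell_V_inter_center[of _ n] and J = cell_V_inter_corners[of _ _ n]
  have "?s 5 \<inter> ?s 1 = {(1/3) *\<^sub>R vicsek_q 1}" using I[of 1] by auto
  then obtain D1 where D1: "geo_tree (?s 5 \<union> ?s 1) D1" using geo_tree_glue[OF T[of 5] T[of 1]] by auto
  have "(?s 5 \<union> ?s 1) \<inter> ?s 2 = {(1/3) *\<^sub>R vicsek_q 2}" using I[of 2] J[of 1 2] by auto
  then obtain D2 where D2: "geo_tree (?s 5 \<union> ?s 1 \<union> ?s 2) D2" using geo_tree_glue[OF D1 T[of 2]] by auto
  have "(?s 5 \<union> ?s 1 \<union> ?s 2) \<inter> ?s 3 = {(1/3) *\<^sub>R vicsek_q 3}" using I[of 3] J[of 1 3] J[of 2 3] by auto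
  then obtain D3 where D3: "geo_tree (?s 5 \<union> ?s 1 \<union> ?s 2 \<union> ?s 3) D3" using geo_tree_glue[OF D2 T[of 3]] by auto
  have "(?s 5 \<union> ?s 1 \<union> ?s 2 \<union> ?s 3) \<inter> ?s 4 = {(1/3) *\<^sub>R vicsek_q 4}" using I[of 4] J[of 1 4] J[of 2 4] J[of 3 4] by auto
  then obtain D4 where D4: "geo_tree (?s 5 \<union> ?s 1 \<union> ?s 2 \<union> ?s 3 \<union> ?s 4) D4" using geo_tree_glue[OF D3 T[of 4]] by auto
  have "{1..5} = {1, 2, 3, 4, 5::nat}" by auto
  then have "vicsek_V (Suc n) = ?s 5 \<union> ?s 1 \<union> ?s 2 \<union> ?s 3 \<union> ?s 4" by auto
  with D4 show ?case by metis
qed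

section \<open>The distance on the union of the trees and its comparison with the Euclidean
  distance\<close>

lemma skel_dist_eq:
  assumes D: "geo_tree (vicsek_V n) D" and xy: "x \<in> vicsek_V n" "y \<in> vicsek_V n"
  shows "vicsek_skel_dist x y = D x y"
proof (cases "x = y")
  case True then show ?thesis using geo_treeD(2)[OF D xy(1)] by (simp add: vicsek_skel_dist_def)
next
  case False
  obtain g where g: "arc g" "path_image g \<subseteq> vicsek_V n" "pathstart g = x" "pathfinish g = y"
    using geo_treeD(5)[OF D xy False] by blast
  have pos: "0 \<le> D x y" by (rule geo_tree_nonneg[OF D xy])
  have "(THE l. 0 \<le> l \<and> (\<exists>n g. arc g \<and> path_image g \<subseteq> vicsek_V n \<and> pathstart g = x \<and> pathfinish g = y \<and>
                     path_length g = ennreal l)) = D x y"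
  proof (rule the_equality)
    show "0 \<le> D x y \<and> (\<exists>n g. arc g \<and> path_image g \<subseteq> vicsek_V n \<and> pathstart g = x \<and> pathfinish g = y \<and>
                     path_length g = ennreal (D x y))"
      using g geo_treeD(7)[OF D g(1,2)] pos by blast
    fix l assume "0 \<le> l \<and> (\<exists>n g. arc g \<and> path_image g \<subseteq> vicsek_V n \<and> pathstart g = x \<and> pathfinish g = y \<and>
                     path_length g = ennreal l)"
    then obtain m h where l: "0 \<le> l" and h: "arc h" "path_image h \<subseteq> vicsek_V m" "pathstart h = x" "pathfinish h = y"
      "path_length h = ennreal l" by blast
    \<comment> \<open>The description in \<open>vicsek_skel_dist\<close> admits arcs of every
      generation; two of them are compared in the tree of the larger one.\<close>
    obtain E where E: "geo_tree (vicsek_V (max n m)) E" using geo_tree_V by blast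
    have "path_image h \<subseteq> vicsek_V (max n m)" using h(2) V_mono[of m "max n m"] by auto
    then have "ennreal l = ennreal (E x y)" using geo_treeD(7)[OF E h(1)] h by simp
    also have "E x y = D x y" using geo_tree_subset_eq[OF D E _ xy] V_mono[of n "max n m"] by simp
    finally show "l = D x y" using l pos by simp
  qed
  then show ?thesis using False by (simp add: vicsek_skel_dist_def)
qed

lemma geo_tree_cong:
  assumes D: "geo_tree A D" and eq: "\<And>x y. x \<in> A \<Longrightarrow> y \<in> A \<Longrightarrow> E x y = D x y"
  shows "geo_tree A E"
  unfolding geo_tree_def
proof (intro conjI ballI allI impI)
  fix g assume g: "arc g \<and> path_image g \<subseteq> A"
  then have "pathstart g \<in> A" "pathfinish g \<in> A" by (auto simp: subset_iff)
  then show "path_length g = ennreal (E (pathstart g) (pathfinish g))"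
    using geo_treeD(7)[OF D] g eq by simp
qed (use eq geo_treeD[OF D] in simp_all)

lemma geo_tree_skel: "geo_tree (vicsek_V n) vicsek_skel_dist"
proof -
  obtain D where D: "geo_tree (vicsek_V n) D" using geo_tree_V by blast
  show ?thesis by (rule geo_tree_cong[OF D]) (rule skel_dist_eq[OF D])
qed

lemma skel_commute: "x \<in> vicsek_V n \<Longrightarrow> y \<in> vicsek_V n \<Longrightarrow> vicsek_skel_dist x y = vicsek_skel_dist y x"
  by (rule geo_treeD(3)[OF geo_tree_skel])

lemma skel_triangle:
  "x \<in> vicsek_V n \<Longrightarrow> y \<in> vicsek_V n \<Longrightarrow> z \<in> vicsek_V n \<Longrightarrow>
    vicsek_skel_dist x z \<le> vicsek_skel_dist x y + vicsek_skel_dist y z"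
  by (rule geo_treeD(4)[OF geo_tree_skel])

lemma skel_psi:
  assumes "i \<in> {1..5}" "x \<in> vicsek_V n" "y \<in> vicsek_V n"
  shows "vicsek_skel_dist (vicsek_psi i x) (vicsek_psi i y) = (1/3) * vicsek_skel_dist x y"
proof -
  have "vicsek_psi i ` vicsek_V n \<subseteq> vicsek_V (Suc n)" using psi_V[OF assms(1)] by blast
  from geo_tree_subset_eq[OF geo_tree_psi[OF geo_tree_skel] geo_tree_skel this, of "vicsek_psi i x" "vicsek_psi i y"]
  show ?thesis using assms by simp
qed

lemma skel_corner_center:
  assumes "i \<in> {1..4}" "x \<in> vicsek_V n" "y \<in> vicsek_V n"
  shows "vicsek_skel_dist (vicsek_psi i x) (vicsek_psi 5 y) =
    vicsek_skel_dist (vicsek_psi i x) ((1/3) *\<^sub>R vicsek_q i) + vicsek_skel_dist ((1/3) *\<^sub>R vicsek_q i) (vicsek_psi 5 y)"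
proof (rule geo_tree_cut_point[OF geo_tree_skel[of "Suc n"] geo_tree_psi[OF geo_tree_skel] geo_tree_psi[OF geo_tree_skel] cell_V_inter_center[OF assms(1), of n]])
  show "vicsek_psi i ` vicsek_V n \<subseteq> vicsek_V (Suc n)" "vicsek_psi 5 ` vicsek_V n \<subseteq> vicsek_V (Suc n)"
    using psi_V[of i _ n] psi_V[of 5 _ n] assms(1) by auto
qed (use assms in auto)

text \<open>Two applications of the cut-point formula: cell \<open>i\<close> glued to the central
  cell is separated from cell \<open>j\<close> by the junction of \<open>j\<close>, and then cell
  \<open>i\<close> is separated from the central cell by its own junction.\<close>

lemma skel_corners:
  assumes ij: "i \<in> {1..4}" "j \<in> {1..4}" "i \<noteq> j" and xy: "x \<in> vicsek_V n" "y \<in> vicsek_V n"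
  shows "vicsek_skel_dist (vicsek_psi i x) (vicsek_psi j y) =
    vicsek_skel_dist (vicsek_psi i x) ((1/3) *\<^sub>R vicsek_q i)
    + vicsek_skel_dist ((1/3) *\<^sub>R vicsek_q i) ((1/3) *\<^sub>R vicsek_q j)
    + vicsek_skel_dist ((1/3) *\<^sub>R vicsek_q j) (vicsek_psi j y)"
proof -
  let ?s = "\<lambda>i. vicsek_psi i ` vicsek_V n"
  note T = geo_tree_psi[OF geo_tree_skel[of n]]
  have I: "?s i \<inter> ?s 5 = {(1/3) *\<^sub>R vicsek_q i}" by (rule cell_V_inter_center[OF ij(1)])
  have "?s j \<inter> ?s 5 = {(1/3) *\<^sub>R vicsek_q j}" by (rule cell_V_inter_center[OF ij(2)])
  then have J: "(?s i \<union> ?s 5) \<inter> ?s j = {(1/3) *\<^sub>R vicsek_q j}" using cell_V_inter_corners[OF ij, of n] by auto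
  have sub: "?s k \<subseteq> vicsek_V (Suc n)" if "k \<in> {1..5}" for k using psi_V[of k _ n] that by auto
  have "vicsek_skel_dist (vicsek_psi i x) (vicsek_psi j y) =
    vicsek_skel_dist (vicsek_psi i x) ((1/3) *\<^sub>R vicsek_q j) + vicsek_skel_dist ((1/3) *\<^sub>R vicsek_q j) (vicsek_psi j y)"
    by (rule geo_tree_cut_point[OF geo_tree_skel[of "Suc n"] geo_tree_glue[OF T T I] T J])
      (use sub[of i] sub[of j] sub[of 5] ij xy in auto)
  moreover have "vicsek_skel_dist (vicsek_psi i x) ((1/3) *\<^sub>R vicsek_q j) =
    vicsek_skel_dist (vicsek_psi i x) ((1/3) *\<^sub>R vicsek_q i) + vicsek_skel_dist ((1/3) *\<^sub>R vicsek_q i) ((1/3) *\<^sub>R vicsek_q j)"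
    using skel_corner_center[OF ij(1) xy(1) q_in_V[of j n]] ij by (simp add: psi_5)
  ultimately show ?thesis by simp
qed

lemma skel_arm:
  assumes "i \<in> {1..4}" "0 \<le> t" "t \<le> 1" "0 \<le> u" "u \<le> 1"
  shows "vicsek_skel_dist (t *\<^sub>R vicsek_q i) (u *\<^sub>R vicsek_q i) = \<bar>t - u\<bar>"
proof -
  have T: "geo_tree (closed_segment (vicsek_q 5) (vicsek_q i)) dist"
    by (rule geo_tree_segment) (use norm_q[OF assms(1)] in \<open>auto simp: q_nth\<close>)
  have "dist (t *\<^sub>R vicsek_q i) (u *\<^sub>R vicsek_q i) = vicsek_skel_dist (t *\<^sub>R vicsek_q i) (u *\<^sub>R vicsek_q i)"
    by (rule geo_tree_subset_eq[OF T geo_tree_skel[of 0]]) (use assms in \<open>auto simp: seg_0\<close>)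
  moreover have "dist (t *\<^sub>R vicsek_q i) (u *\<^sub>R vicsek_q i) = \<bar>t - u\<bar>"
    using norm_q[OF assms(1)] by (simp add: dist_norm scaleR_diff_left[symmetric])
  ultimately show ?thesis by simp
qed

lemma skel_arms:
  assumes ij: "i \<in> {1..4}" "j \<in> {1..4}" "i \<noteq> j" and tu: "0 \<le> t" "t \<le> 1" "0 \<le> u" "u \<le> 1"
  shows "vicsek_skel_dist (t *\<^sub>R vicsek_q i) (u *\<^sub>R vicsek_q j) = t + u" "t + u \<le> 2 * dist (t *\<^sub>R vicsek_q i) (u *\<^sub>R vicsek_q j)"
proof -
  let ?s = "\<lambda>i. closed_segment (vicsek_q 5) (vicsek_q i)"
  have T: "geo_tree (?s i) dist" if "i \<in> {1..4}" for i
    by (rule geo_tree_segment) (use norm_q[OF that] in \<open>auto simp: q_nth\<close>)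
  note I = seg_inter[OF ij]
  have "vicsek_skel_dist (t *\<^sub>R vicsek_q i) (u *\<^sub>R vicsek_q j) =
     vicsek_skel_dist (t *\<^sub>R vicsek_q i) 0 + vicsek_skel_dist 0 (u *\<^sub>R vicsek_q j)"
    by (rule geo_tree_cut_point[OF geo_tree_skel[of 0] T[OF ij(1)] T[OF ij(2)] I])
      (use ij tu in \<open>auto simp: seg_0\<close>)
  then show "vicsek_skel_dist (t *\<^sub>R vicsek_q i) (u *\<^sub>R vicsek_q j) = t + u"
    using skel_arm[OF ij(1), of t 0] skel_arm[OF ij(2), of 0 u] tu by simp
  show "t + u \<le> 2 * dist (t *\<^sub>R vicsek_q i) (u *\<^sub>R vicsek_q j)" using arms_apart[OF ij tu(1,3)] .
qed

lemma skel_corners_2: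
  assumes "i \<in> {1..4}" "j \<in> {1..4}" "i \<noteq> j"
  shows "vicsek_skel_dist ((1/3) *\<^sub>R vicsek_q i) ((1/3) *\<^sub>R vicsek_q j) = 2/3"
  using skel_arms(1)[OF assms, of "1/3" "1/3"] by simp

text \<open>A path crosses at most three cells of the first generation, and by scaling each
  contributes at most \<open>2/3\<close>. So the bound \<open>2\<close> reproduces itself.\<close>

lemma skel_le_2: "x \<in> vicsek_V n \<Longrightarrow> y \<in> vicsek_V n \<Longrightarrow> vicsek_skel_dist x y \<le> 2"
proof (induction n arbitrary: x y)
  case 0
  then obtain i j t u where "x = t *\<^sub>R vicsek_q i" "y = u *\<^sub>R vicsek_q j" "i \<in> {1..4}" "j \<in> {1..4}" "0 \<le> t" "t \<le> 1" "0 \<le> u" "u \<le> 1"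
    unfolding vicsek_V.simps seg_0 by blast
  then show ?case using skel_arms(1)[of i j t u] skel_arm[of i t u] by (cases "i = j") auto
next
  case (Suc n)
  obtain i x' where x: "i \<in> {1..5}" "x' \<in> vicsek_V n" "x = vicsek_psi i x'" using Suc.prems(1) by auto
  obtain j y' where y: "j \<in> {1..5}" "y' \<in> vicsek_V n" "y = vicsek_psi j y'" using Suc.prems(2) by auto
  have le: "vicsek_skel_dist (vicsek_psi k a) (vicsek_psi k b) \<le> 2/3" if "k \<in> {1..5}" "a \<in> vicsek_V n" "b \<in> vicsek_V n" for k a b
    using skel_psi[OF that] Suc.IH[OF that(2,3)] by simp
  have J: "vicsek_skel_dist (vicsek_psi k a) ((1/3) *\<^sub>R vicsek_q k) \<le> 2/3"
    "vicsek_skel_dist ((1/3) *\<^sub>R vicsek_q k) (vicsek_psi k a) \<le> 2/3"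
    "vicsek_skel_dist ((1/3) *\<^sub>R vicsek_q k) (vicsek_psi 5 a) \<le> 2/3"
    if "k \<in> {1..4}" "a \<in> vicsek_V n" for k a
    using le[of k a "vicsek_q (opp k)"] le[of k "vicsek_q (opp k)" a] le[of 5 "vicsek_q k" a] that q_in_V[of k n] q_in_V[of "opp k" n]
      opp_le4[OF that(1)] by (simp_all add: psi_opp psi_5)
  have mixed: "vicsek_skel_dist (vicsek_psi k a) (vicsek_psi 5 b) \<le> 2" if "k \<in> {1..4}" "a \<in> vicsek_V n" "b \<in> vicsek_V n" for k a b
    using skel_corner_center[OF that] J[OF that(1,2)] J[OF that(1,3)] by linarith
  consider "i = j" | "i \<in> {1..4}" "j = 5" | "i = 5" "j \<in> {1..4}" | "i \<in> {1..4}" "j \<in> {1..4}" "i \<noteq> j"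
    using x(1) y(1) by (elim le5_cases) auto
  then show ?case
  proof cases
    case 1 then show ?thesis using le[of i x' y'] x y by simp
  next
    case 2 then show ?thesis using mixed[of i x' y'] x y by simp
  next
    case 3 then show ?thesis using mixed[of j y' x'] x y skel_commute[OF Suc.prems] by simp
  next
    case 4
    then show ?thesis unfolding x(3) y(3)
      using skel_corners[OF 4 x(2) y(2)] skel_corners_2[OF 4] J[of i x'] J[of j y'] x(2) y(2) by linarith
  qed
qed

text \<open>Distances to a corner are compared first: in an induction for two arbitrary points the
  triangle through a junction would worsen the constant at every step.\<close>

lemma skel_corner_le:
  assumes a: "a \<in> {1..4}" shows "x \<in> vicsek_V n \<Longrightarrow> vicsek_skel_dist x (vicsek_q a) \<le> 6 * dist x (vicsek_q a)"
proof (induction n arbitrary: x)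
  case 0
  then obtain i t where x: "x = t *\<^sub>R vicsek_q i" "i \<in> {1..4}" "0 \<le> t" "t \<le> 1"
    unfolding vicsek_V.simps seg_0 by blast
  have "vicsek_skel_dist x (vicsek_q a) \<le> 2 * dist x (vicsek_q a)"
  proof (cases "i = a")
    case True
    then have "vicsek_skel_dist x (vicsek_q a) = \<bar>t - 1\<bar>" using x skel_arm[OF a, of t 1] by simp
    also have "\<dots> = dist x (vicsek_q a)"
      using True norm_q[OF a] norm_scaleR[of "t - 1" "vicsek_q a"] by (simp add: x dist_norm scaleR_diff_left)
    finally show ?thesis by simp
  next
    case False then show ?thesis using x skel_arms[OF x(2) a, of t 1] by simp
  qed
  then show ?case using zero_le_dist[of x "vicsek_q a"] by linarith
next
  case (Suc n)
  obtain i x' where x: "i \<in> {1..5}" "x' \<in> vicsek_V n" "x = vicsek_psi i x'" using Suc.prems(1) by auto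
  show ?case
  proof (cases "i = a")
    case True
    have "vicsek_skel_dist x (vicsek_q a) = (1/3) * vicsek_skel_dist x' (vicsek_q a)"
      using skel_psi[OF x(1,2) q_in_V[of a]] a x True by simp
    moreover have "dist x (vicsek_q a) = (1/3) * dist x' (vicsek_q a)"
      using dist_psi[of a x' "vicsek_q a"] x True by simp
    ultimately show ?thesis using Suc.IH[OF x(2)] by simp
  next
    case False
    \<comment> \<open>Outside the cell of the corner, a Euclidean distance of at least
      \<open>1/3\<close> faces a tree distance of at most \<open>2\<close>; this is the origin of
      the constant \<open>6\<close>.\<close>
    have "1/3 \<le> dist x (vicsek_q a)" using corner_apart_cell[OF a x(1) False] x V_box by blast
    moreover have "vicsek_skel_dist x (vicsek_q a) \<le> 2" using skel_le_2[OF Suc.prems q_in_V] a by simp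
    ultimately show ?thesis by linarith
  qed
qed

text \<open>Within one cell the constant is preserved by scaling. Across a junction both legs end at
  a corner of their cell, so each is at most \<open>6\<close> times its Euclidean length, which is
  at most \<open>dist x y\<close>; together this gives \<open>12\<close>. Two corner cells are
  \<open>1/3\<close> apart.\<close>

lemma skel_le: "x \<in> vicsek_V n \<Longrightarrow> y \<in> vicsek_V n \<Longrightarrow> vicsek_skel_dist x y \<le> 12 * dist x y"
proof (induction n arbitrary: x y)
  case 0
  then obtain i j t u where x: "x = t *\<^sub>R vicsek_q i" "y = u *\<^sub>R vicsek_q j" "i \<in> {1..4}" "j \<in> {1..4}" "0 \<le> t" "t \<le> 1" "0 \<le> u" "u \<le> 1"
    unfolding vicsek_V.simps seg_0 by blast
  have "vicsek_skel_dist x y \<le> 2 * dist x y"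
  proof (cases "i = j")
    case True
    then have "vicsek_skel_dist x y = \<bar>t - u\<bar>" using x skel_arm[of i t u] by simp
    also have "\<dots> = dist x y"
      using True norm_q[OF x(3)] norm_scaleR[of "t - u" "vicsek_q i"] by (simp add: x dist_norm scaleR_diff_left)
    finally show ?thesis by simp
  next
    case False then show ?thesis using x skel_arms[OF x(3,4), of t u] by simp
  qed
  then show ?case using zero_le_dist[of x y] by linarith
next
  case (Suc n)
  obtain i x' where x: "i \<in> {1..5}" "x' \<in> vicsek_V n" "x = vicsek_psi i x'" using Suc.prems(1) by auto
  obtain j y' where y: "j \<in> {1..5}" "y' \<in> vicsek_V n" "y = vicsek_psi j y'" using Suc.prems(2) by auto
  have J: "vicsek_skel_dist (vicsek_psi k a) (vicsek_psi k (vicsek_q c)) \<le> 6 * dist (vicsek_psi k a) (vicsek_psi k (vicsek_q c))"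
    if "k \<in> {1..5}" "a \<in> vicsek_V n" "c \<in> {1..4}" for k a c
    using skel_psi[OF that(1,2) q_in_V[of c]] that skel_corner_le[OF that(3,2)] by (simp add: dist_psi)
  have mixed: "vicsek_skel_dist (vicsek_psi k a) (vicsek_psi 5 b) \<le> 12 * dist (vicsek_psi k a) (vicsek_psi 5 b)"
    if k: "k \<in> {1..4}" and ab: "a \<in> vicsek_V n" "b \<in> vicsek_V n" for k a b
  proof -
    let ?v = "(1/3) *\<^sub>R vicsek_q k"
    have 1: "vicsek_skel_dist (vicsek_psi k a) ?v \<le> 6 * dist (vicsek_psi k a) ?v"
      using J[of k a "opp k"] opp_le4[OF k] k ab by (simp add: psi_opp)
    have "vicsek_skel_dist ?v (vicsek_psi 5 b) = vicsek_skel_dist (vicsek_psi 5 b) ?v"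
      using skel_commute[OF psi_V[of 5 "vicsek_q k" n] psi_V[of 5 b n]] q_in_V[of k n] k ab by (simp add: psi_5)
    then have 2: "vicsek_skel_dist ?v (vicsek_psi 5 b) \<le> 6 * dist ?v (vicsek_psi 5 b)"
      using J[of 5 b k] k ab by (simp add: psi_5 dist_commute)
    have "dist (vicsek_psi k a) ?v \<le> dist (vicsek_psi k a) (vicsek_psi 5 b)"
      "dist ?v (vicsek_psi 5 b) \<le> dist (vicsek_psi k a) (vicsek_psi 5 b)"
      using corner_center_dist[OF k, of "vicsek_psi k a" "vicsek_psi 5 b"] ab V_box by blast+
    then show ?thesis using skel_corner_center[OF k ab] 1 2 by linarith
  qed
  consider "i = j" | "i \<in> {1..4}" "j = 5" | "i = 5" "j \<in> {1..4}" | "i \<in> {1..4}" "j \<in> {1..4}" "i \<noteq> j"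
    using x(1) y(1) by (elim le5_cases) auto
  then show ?case
  proof cases
    case 1
    then show ?thesis using skel_psi[OF x(1,2) y(2)] Suc.IH[OF x(2) y(2)] x y by (simp add: dist_psi)
  next
    case 2 then show ?thesis using mixed[of i x' y'] x y by simp
  next
    case 3 then show ?thesis using mixed[of j y' x'] x y skel_commute[OF Suc.prems] by (simp add: dist_commute)
  next
    case 4
    have "1/3 \<le> dist x y" using corners_apart[OF 4, of x y] x y V_box by blast
    then show ?thesis using skel_le_2[OF Suc.prems] by linarith
  qed
qed

subsection \<open>The Vicsek set and its geodesic distance\<close>

definition skel :: "(real^2) set" where "skel = (\<Union>n. vicsek_V n)"

lemma skelE2:
  assumes "x \<in> skel" "y \<in> skel" obtains n where "x \<in> vicsek_V n" "y \<in> vicsek_V n"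
proof -
  obtain n m where "x \<in> vicsek_V n" "y \<in> vicsek_V m" using assms by (auto simp: skel_def)
  then show ?thesis using that[of "max n m"] V_mono[of n "max n m"] V_mono[of m "max n m"] by auto
qed

lemma skelE3:
  assumes "x \<in> skel" "y \<in> skel" "z \<in> skel" obtains n where "x \<in> vicsek_V n" "y \<in> vicsek_V n" "z \<in> vicsek_V n"
proof -
  obtain n where "x \<in> vicsek_V n" "y \<in> vicsek_V n" by (rule skelE2[OF assms(1,2)])
  moreover obtain m where "z \<in> vicsek_V m" using assms(3) by (auto simp: skel_def)
  ultimately show ?thesis using that[of "max n m"] V_mono[of n "max n m"] V_mono[of m "max n m"] by auto
qed

lemma skel_invariant: "skel = (\<Union>i\<in>{1..5}. vicsek_psi i ` skel)"
proof
  show "skel \<subseteq> (\<Union>i\<in>{1..5}. vicsek_psi i ` skel)"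
  proof
    fix x assume "x \<in> skel"
    then obtain n where "x \<in> vicsek_V n" by (auto simp: skel_def)
    then have "x \<in> vicsek_V (Suc n)" using V_mono_Suc by blast
    then show "x \<in> (\<Union>i\<in>{1..5}. vicsek_psi i ` skel)" by (auto simp: skel_def)
  qed
  show "(\<Union>i\<in>{1..5}. vicsek_psi i ` skel) \<subseteq> skel"
    using psi_V unfolding skel_def by blast
qed

lemma psi_skel: "i \<in> {1..5} \<Longrightarrow> x \<in> skel \<Longrightarrow> vicsek_psi i x \<in> skel"
  using skel_invariant by blast

lemma q_skel: "i \<in> {1..5} \<Longrightarrow> vicsek_q i \<in> skel" using q_in_V by (auto simp: skel_def)

section \<open>The Vicsek set as the closure of the union of the trees\<close>

lemma closed_psi_image: "closed A \<Longrightarrow> closed (vicsek_psi i ` A)"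
proof -
  assume A: "closed A"
  have "vicsek_psi i ` A = psi_inv i -` A" by (auto simp: image_iff) (metis psi_psi_inv)
  then show ?thesis using continuous_closed_vimage[of A "psi_inv i"] A continuous_psi_inv[of UNIV i]
    by (simp add: continuous_on_eq_continuous_within)
qed

lemma psi_closure: "vicsek_psi i ` closure A = closure (vicsek_psi i ` A)"
proof
  show "vicsek_psi i ` closure A \<subseteq> closure (vicsek_psi i ` A)"
    by (rule image_closure_subset[OF continuous_psi closed_closure closure_subset])
  show "closure (vicsek_psi i ` A) \<subseteq> vicsek_psi i ` closure A"
    by (intro closure_minimal image_mono closure_subset closed_psi_image closed_closure)
qed

text \<open>The point of \<open>K\<close> farthest from \<open>L\<close> is the image under some
  \<open>vicsek_psi i\<close> of another point of \<open>K\<close>, so its distance to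
  \<open>L\<close> is at most a third of the maximum. The maximum is therefore zero.\<close>

lemma vicsek_invariant_subset:
  assumes K: "compact K" "K \<noteq> {}" "K = (\<Union>i\<in>{1..5}. vicsek_psi i ` K)"
    and L: "compact L" "L \<noteq> {}" "L = (\<Union>i\<in>{1..5}. vicsek_psi i ` L)"
  shows "K \<subseteq> L"
proof -
  obtain x where x: "x \<in> K" "\<And>y. y \<in> K \<Longrightarrow> infdist y L \<le> infdist x L"
    using continuous_attains_sup[OF K(1,2), of "\<lambda>x. infdist x L"] continuous_on_infdist[OF continuous_on_id] by blast
  obtain i x' where i: "i \<in> {1..5}" "x' \<in> K" "x = vicsek_psi i x'" using x(1) K(3) by blast
  obtain y where y: "y \<in> L" "infdist x' L = dist x' y"
    using infdist_attains_inf[OF compact_imp_closed[OF L(1)] L(2)] by blast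
  have "vicsek_psi i y \<in> L" using L(3) i(1) y(1) by blast
  then have "infdist x L \<le> dist x (vicsek_psi i y)" by (rule infdist_le)
  also have "\<dots> = (1/3) * infdist x' L" using i y by (simp add: dist_psi)
  also have "\<dots> \<le> (1/3) * infdist x L" using x(2)[OF i(2)] by simp
  finally have "infdist x L \<le> 0" by simp
  then have "infdist y L = 0" if "y \<in> K" for y using x(2)[OF that] infdist_nonneg[of y L] by linarith
  then show ?thesis using in_closed_iff_infdist_zero[OF compact_imp_closed[OF L(1)] L(2)] by blast
qed

lemma compact_closure_skel: "compact (closure skel)"
proof -
  have "norm x \<le> hs + hs" if "x \<in> skel" for x
  proof -
    have "x \<in> square" using that V_box by (auto simp: skel_def)
    then have "\<bar>x $ 1\<bar> \<le> hs" "\<bar>x $ 2\<bar> \<le> hs" by (auto simp: square_def)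
    then show ?thesis using norm_le_l1_cart[of x] by (simp add: sum_2)
  qed
  then have "bounded skel" by (rule boundedI)
  then show ?thesis by (simp only: compact_closure)
qed

lemma closure_skel_invariant: "closure skel = (\<Union>i\<in>{1..5}. vicsek_psi i ` closure skel)"
proof -
  have "closure skel = closure (\<Union>((\<lambda>i. vicsek_psi i ` skel) ` {1..5}))" using skel_invariant by simp
  also have "\<dots> = (\<Union>i\<in>{1..5}. closure (vicsek_psi i ` skel))"
  proof
    show "closure (\<Union>((\<lambda>i. vicsek_psi i ` skel) ` {1..5})) \<subseteq> (\<Union>i\<in>{1..5}. closure (vicsek_psi i ` skel))"
      by (intro closure_minimal UN_mono closure_subset order_refl closed_UN) simp_all
    show "(\<Union>i\<in>{1..5}. closure (vicsek_psi i ` skel)) \<subseteq> closure (\<Union>((\<lambda>i. vicsek_psi i ` skel) ` {1..5}))"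
      by (intro UN_least closure_mono) blast
  qed
  also have "\<dots> = (\<Union>i\<in>{1..5}. vicsek_psi i ` closure skel)" by (simp only: psi_closure)
  finally show ?thesis .
qed

lemma vicsek_K_eq: "vicsek_K = closure skel"
  unfolding vicsek_K_def
proof (rule the_equality)
  note inv = closure_skel_invariant
  have ne: "closure skel \<noteq> {}" using q_skel[of 1] by auto
  show "closure skel \<noteq> {} \<and> compact (closure skel) \<and> closure skel = (\<Union>i\<in>{1..5}. vicsek_psi i ` closure skel)"
    using inv ne compact_closure_skel by blast
  fix K assume "K \<noteq> {} \<and> compact K \<and> K = (\<Union>i\<in>{1..5}. vicsek_psi i ` K)"
  then have K: "K \<noteq> {}" "compact K" "K = (\<Union>i\<in>{1..5}. vicsek_psi i ` K)" by blast+
  show "K = closure skel"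
    using vicsek_invariant_subset[OF K(2,1,3) compact_closure_skel ne inv]
      vicsek_invariant_subset[OF compact_closure_skel ne inv K(2,1,3)] by (rule antisym)
qed

lemma vicsek_K_invariant: "vicsek_K = (\<Union>i\<in>{1..5}. vicsek_psi i ` vicsek_K)"
  unfolding vicsek_K_eq by (rule closure_skel_invariant)

lemma compact_K: "compact vicsek_K" unfolding vicsek_K_eq by (rule compact_closure_skel)
lemma closed_K: "closed vicsek_K" by (simp add: vicsek_K_eq)
lemma skel_K: "x \<in> skel \<Longrightarrow> x \<in> vicsek_K" using closure_subset by (auto simp: vicsek_K_eq)
lemma q_K: "i \<in> {1..5} \<Longrightarrow> vicsek_q i \<in> vicsek_K" by (intro skel_K q_skel)
lemma psi_K: "i \<in> {1..5} \<Longrightarrow> x \<in> vicsek_K \<Longrightarrow> vicsek_psi i x \<in> vicsek_K" using vicsek_K_invariant by blast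
lemma K_cases: assumes "x \<in> vicsek_K" obtains i y where "i \<in> {1..5}" "y \<in> vicsek_K" "x = vicsek_psi i y"
  using assms vicsek_K_invariant by blast

text \<open>Without this the filter in the definition of \<open>vicsek_dist\<close> could be trivial
  at points of the trees, and the limit would be unspecified. A nontrivial arc is connected and so
  has no isolated point.\<close>

lemma skel_islimpt: assumes x: "x \<in> skel" shows "x islimpt skel"
proof -
  obtain n where n: "x \<in> vicsek_V n" using x by (auto simp: skel_def)
  define y where "y = (if x = 0 then vicsek_q 1 else 0)"
  have y: "y \<in> vicsek_V n" "x \<noteq> y" using q_in_V[of 1 n] q_in_V[of 5 n] norm_q[of 1] by (auto simp: y_def q_nth)
  obtain g where g: "arc g" "path_image g \<subseteq> vicsek_V n" "pathstart g = x" "pathfinish g = y"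
    using geo_treeD(5)[OF geo_tree_skel n y] by blast
  have "x \<in> path_image g" "y \<in> path_image g" using g pathstart_in_path_image pathfinish_in_path_image by blast+
  then have "x islimpt path_image g"
    using y(2) by (intro connected_imp_perfect[OF connected_path_image[OF arc_imp_path[OF g(1)]]]) (assumption, metis singletonD)
  then show ?thesis by (rule islimpt_subset) (use g(2) in \<open>auto simp: skel_def\<close>)
qed

text \<open>The tree distance is Lipschitz with constant \<open>12\<close> in each variable, hence
  with \<open>24\<close> for the product metric, and a Lipschitz function extends to the closure.
  The limit in \<open>vicsek_dist\<close> is identified with this extension.\<close>

lemma vicsek_dist_extends:
  "24-lipschitz_on (vicsek_K \<times> vicsek_K) (\<lambda>(x, y). vicsek_dist x y)"
  "x \<in> skel \<Longrightarrow> y \<in> skel \<Longrightarrow> vicsek_dist x y = vicsek_skel_dist x y"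
proof -
  let ?f = "\<lambda>(x, y). vicsek_skel_dist x y"
  have 1: "\<bar>vicsek_skel_dist x y - vicsek_skel_dist x' y'\<bar> \<le> 12 * dist x x' + 12 * dist y y'"
    if "x \<in> skel" "y \<in> skel" "x' \<in> skel" "y' \<in> skel" for x y x' y'
  proof -
    note mem = that
    obtain n where n: "x \<in> vicsek_V n" "y \<in> vicsek_V n" "x' \<in> vicsek_V n" by (rule skelE3[OF mem(1-3)])
    obtain k where k: "y' \<in> vicsek_V k" using mem(4) by (auto simp: skel_def)
    define m where "m = max n k"
    have m: "n \<le> m" "y' \<in> vicsek_V m" using k V_mono[of k m] by (auto simp: m_def)
    have V: "x \<in> vicsek_V m" "y \<in> vicsek_V m" "x' \<in> vicsek_V m" "y' \<in> vicsek_V m" using n m V_mono[OF m(1)] by auto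
    show ?thesis
      using skel_triangle[OF V(1,3,2)] skel_triangle[OF V(3,4,2)] skel_triangle[OF V(3,1,4)] skel_triangle[OF V(1,2,4)]
        skel_commute[OF V(3,1)] skel_commute[OF V(4,2)] skel_le[OF V(1,3)] skel_le[OF V(2,4)] by linarith
  qed
  have "24-lipschitz_on (skel \<times> skel) ?f"
  proof (rule lipschitz_onI)
    fix a b assume "a \<in> skel \<times> skel" "b \<in> skel \<times> skel"
    then show "dist (?f a) (?f b) \<le> 24 * dist a b"
      using 1[of "fst a" "snd a" "fst b" "snd b"] dist_fst_le[of a b] dist_snd_le[of a b]
      by (auto simp: dist_real_def)
  qed simp
  then obtain g where g: "\<And>z. z \<in> skel \<times> skel \<Longrightarrow> g z = ?f z" "24-lipschitz_on (closure (skel \<times> skel)) g"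
    using lipschitz_extend_closure by metis
  have K2: "closure (skel \<times> skel) = vicsek_K \<times> vicsek_K" by (simp add: closure_Times vicsek_K_eq)
  have lim: "vicsek_dist x y = g (x, y)" if xy: "x \<in> vicsek_K" "y \<in> vicsek_K" for x y
  proof -
    have "continuous_on (vicsek_K \<times> vicsek_K) g" using g(2) K2 lipschitz_on_continuous_on by metis
    then have "(g \<longlongrightarrow> g (x, y)) (at (x, y) within vicsek_K \<times> vicsek_K)" using xy by (simp add: continuous_on_def)
    then have "(g \<longlongrightarrow> g (x, y)) (at (x, y) within skel \<times> skel)"
      by (rule tendsto_within_subset) (use skel_K in auto)
    then have t: "(?f \<longlongrightarrow> g (x, y)) (at (x, y) within skel \<times> skel)"
      by (rule Lim_transform_eventually) (use g(1) in \<open>auto simp: eventually_at_filter\<close>)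
    have "(x, y) islimpt skel \<times> skel"
    proof (cases "(x, y) \<in> skel \<times> skel")
      case False
      have "(x, y) \<in> closure (skel \<times> skel)" using xy K2 by simp
      then show ?thesis using False unfolding closure_def by blast
    next
      case True
      show ?thesis unfolding islimpt_approachable
      proof (intro allI impI)
        fix e :: real assume "0 < e"
        then obtain x' where "x' \<in> skel" "x' \<noteq> x" "dist x' x < e"
          using skel_islimpt[of x] True by (auto simp: islimpt_approachable)
        then show "\<exists>z\<in>skel \<times> skel. z \<noteq> (x, y) \<and> dist z (x, y) < e"
          using True by (intro bexI[of _ "(x', y)"]) (auto simp: dist_Pair_Pair)
      qed
    qed
    then have "\<not> trivial_limit (at (x, y) within skel \<times> skel)" by (simp add: trivial_limit_within)
    from tendsto_Lim[OF this t] show ?thesis by (simp add: vicsek_dist_def skel_def)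
  qed
  show "24-lipschitz_on (vicsek_K \<times> vicsek_K) (\<lambda>(x, y). vicsek_dist x y)"
    using g(2) unfolding K2 by (rule lipschitz_on_transform) (use lim in auto)
  show "x \<in> skel \<Longrightarrow> y \<in> skel \<Longrightarrow> vicsek_dist x y = vicsek_skel_dist x y"
    using lim[of x y] g(1)[of "(x, y)"] skel_K by auto
qed

lemma continuous_vicsek_dist: "continuous_on (vicsek_K \<times> vicsek_K) (\<lambda>(x, y). vicsek_dist x y)"
  using vicsek_dist_extends(1) by (rule lipschitz_on_continuous_on)

lemma K_sequence: assumes "x \<in> vicsek_K" obtains X where "\<And>k::nat. X k \<in> skel" "X \<longlonglongrightarrow> x"
  using assms closure_sequential[of x skel] by (auto simp: vicsek_K_eq)

text \<open>The device by which symmetry, the triangle inequality, scaling and the cut-point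
  formulas pass from the trees to their closure.\<close>

lemma vicsek_dist_tendsto:
  assumes "\<And>k::nat. X k \<in> vicsek_K" "X \<longlonglongrightarrow> x" "x \<in> vicsek_K" "\<And>k. Y k \<in> vicsek_K" "Y \<longlonglongrightarrow> y" "y \<in> vicsek_K"
  shows "(\<lambda>k. vicsek_dist (X k) (Y k)) \<longlonglongrightarrow> vicsek_dist x y"
proof -
  have "((\<lambda>k. (\<lambda>(x, y). vicsek_dist x y) (X k, Y k)) \<longlonglongrightarrow> (\<lambda>(x, y). vicsek_dist x y) (x, y))"
    by (rule continuous_on_tendsto_compose[OF continuous_vicsek_dist]) (use assms in \<open>auto intro!: tendsto_Pair\<close>)
  then show ?thesis by simp
qed

lemma psi_tendsto: "X \<longlonglongrightarrow> x \<Longrightarrow> (\<lambda>k. vicsek_psi i (X k)) \<longlonglongrightarrow> vicsek_psi i x"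
  unfolding psi_alt by (intro tendsto_intros)

lemma vicsek_dist_commute:
  assumes "x \<in> vicsek_K" "y \<in> vicsek_K" shows "vicsek_dist x y = vicsek_dist y x"
proof -
  obtain X Y where X: "\<And>k. X k \<in> skel" "X \<longlonglongrightarrow> x" and Y: "\<And>k. Y k \<in> skel" "Y \<longlonglongrightarrow> y"
    using K_sequence assms by metis
  have e: "vicsek_dist (X k) (Y k) = vicsek_dist (Y k) (X k)" for k
    using skelE2[OF X(1)[of k] Y(1)[of k]] skel_commute vicsek_dist_extends(2) X(1) Y(1) by metis
  show ?thesis
    using vicsek_dist_tendsto[OF skel_K[OF X(1)] X(2) assms(1) skel_K[OF Y(1)] Y(2) assms(2)]
      vicsek_dist_tendsto[OF skel_K[OF Y(1)] Y(2) assms(2) skel_K[OF X(1)] X(2) assms(1)] 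
    unfolding e by (rule LIMSEQ_unique)
qed

lemma vicsek_dist_triangle:
  assumes "x \<in> vicsek_K" "y \<in> vicsek_K" "z \<in> vicsek_K" shows "vicsek_dist x z \<le> vicsek_dist x y + vicsek_dist y z"
proof -
  obtain X Y Z where X: "\<And>k. X k \<in> skel" "X \<longlonglongrightarrow> x" and Y: "\<And>k. Y k \<in> skel" "Y \<longlonglongrightarrow> y" and Z: "\<And>k. Z k \<in> skel" "Z \<longlonglongrightarrow> z"
    using K_sequence assms by metis
  have e: "vicsek_dist (X k) (Z k) \<le> vicsek_dist (X k) (Y k) + vicsek_dist (Y k) (Z k)" for k
    using skelE3[OF X(1)[of k] Y(1)[of k] Z(1)[of k]] skel_triangle vicsek_dist_extends(2) X(1) Y(1) Z(1) by metis
  have X': "\<And>k. X k \<in> vicsek_K" and Y': "\<And>k. Y k \<in> vicsek_K" and Z': "\<And>k. Z k \<in> vicsek_K" using skel_K X Y Z by auto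
  show ?thesis
    by (rule LIMSEQ_le[OF vicsek_dist_tendsto[OF X' X(2) assms(1) Z' Z(2) assms(3)]
        tendsto_add[OF vicsek_dist_tendsto[OF X' X(2) assms(1) Y' Y(2) assms(2)] vicsek_dist_tendsto[OF Y' Y(2) assms(2) Z' Z(2) assms(3)]]])
      (use e in auto)
qed

lemma vicsek_dist_bounds:
  assumes "x \<in> vicsek_K" "y \<in> vicsek_K" shows "dist x y \<le> vicsek_dist x y" "vicsek_dist x y \<le> 2"
proof -
  obtain X Y where X: "\<And>k. X k \<in> skel" "X \<longlonglongrightarrow> x" and Y: "\<And>k. Y k \<in> skel" "Y \<longlonglongrightarrow> y"
    using K_sequence assms by metis
  have e: "dist (X k) (Y k) \<le> vicsek_dist (X k) (Y k)" "vicsek_dist (X k) (Y k) \<le> 2" for k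
    using skelE2[OF X(1)[of k] Y(1)[of k]] geo_treeD(6)[OF geo_tree_skel] skel_le_2 vicsek_dist_extends(2) X(1) Y(1) by metis+
  note l = vicsek_dist_tendsto[OF skel_K[OF X(1)] X(2) assms(1) skel_K[OF Y(1)] Y(2) assms(2)]
  show "dist x y \<le> vicsek_dist x y" by (rule LIMSEQ_le[OF tendsto_dist[OF X(2) Y(2)] l]) (use e in auto)
  show "vicsek_dist x y \<le> 2" by (rule LIMSEQ_le_const2[OF l]) (use e in auto)
qed

lemma vicsek_dist_nonneg: "x \<in> vicsek_K \<Longrightarrow> y \<in> vicsek_K \<Longrightarrow> 0 \<le> vicsek_dist x y"
  using vicsek_dist_bounds(1)[of x y] zero_le_dist[of x y] by linarith

lemma vicsek_dist_self: assumes "x \<in> vicsek_K" shows "vicsek_dist x x = 0"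
proof -
  obtain X where X: "\<And>k. X k \<in> skel" "X \<longlonglongrightarrow> x" using K_sequence assms by metis
  have e: "vicsek_dist (X k) (X k) = 0" for k
    using X(1)[of k] vicsek_dist_extends(2) by (simp add: vicsek_skel_dist_def)
  show ?thesis
    using vicsek_dist_tendsto[OF skel_K[OF X(1)] X(2) assms(1) skel_K[OF X(1)] X(2) assms(1)] 
    unfolding e by (simp add: LIMSEQ_const_iff)
qed

lemma vicsek_dist_psi:
  assumes i: "i \<in> {1..5}" and "x \<in> vicsek_K" "y \<in> vicsek_K"
  shows "vicsek_dist (vicsek_psi i x) (vicsek_psi i y) = (1/3) * vicsek_dist x y"
proof -
  obtain X Y where X: "\<And>k. X k \<in> skel" "X \<longlonglongrightarrow> x" and Y: "\<And>k. Y k \<in> skel" "Y \<longlonglongrightarrow> y"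
    using K_sequence assms by metis
  have e: "vicsek_dist (vicsek_psi i (X k)) (vicsek_psi i (Y k)) = (1/3) * vicsek_dist (X k) (Y k)" for k
    using skelE2[OF X(1)[of k] Y(1)[of k]] skel_psi[OF i] vicsek_dist_extends(2) X(1) Y(1) psi_skel[OF i] by metis
  note l = vicsek_dist_tendsto[OF skel_K[OF X(1)] X(2) assms(2) skel_K[OF Y(1)] Y(2) assms(3)]
  have l2: "(\<lambda>k. vicsek_dist (vicsek_psi i (X k)) (vicsek_psi i (Y k))) \<longlonglongrightarrow> vicsek_dist (vicsek_psi i x) (vicsek_psi i y)"
    by (intro vicsek_dist_tendsto psi_tendsto psi_K[OF i] X Y assms skel_K)
  show ?thesis using l2 tendsto_mult[OF tendsto_const[of "1/3"] l] unfolding e by (rule LIMSEQ_unique)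
qed

lemma vicsek_dist_corner_center:
  assumes i: "i \<in> {1..4}" and "x \<in> vicsek_K" "y \<in> vicsek_K"
  shows "vicsek_dist (vicsek_psi i x) (vicsek_psi 5 y) =
    vicsek_dist (vicsek_psi i x) ((1/3) *\<^sub>R vicsek_q i) + vicsek_dist ((1/3) *\<^sub>R vicsek_q i) (vicsek_psi 5 y)"
proof -
  obtain X Y where X: "\<And>k. X k \<in> skel" "X \<longlonglongrightarrow> x" and Y: "\<And>k. Y k \<in> skel" "Y \<longlonglongrightarrow> y"
    using K_sequence assms by metis
  have i5: "i \<in> {1..5}" "5 \<in> {1..5::nat}" using i by auto
  let ?v = "(1/3) *\<^sub>R vicsek_q i"
  have v: "?v \<in> skel" using psi_skel[OF i5(2) q_skel[OF i5(1)]] by (simp add: psi_5)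
  note vK = skel_K[OF v]
  have e: "vicsek_dist (vicsek_psi i (X k)) (vicsek_psi 5 (Y k)) =
    vicsek_dist (vicsek_psi i (X k)) ?v + vicsek_dist ?v (vicsek_psi 5 (Y k))" for k
    using skelE2[OF X(1)[of k] Y(1)[of k]] skel_corner_center[OF i] vicsek_dist_extends(2) X(1) Y(1) psi_skel[OF i5(1)] psi_skel[OF i5(2)] v by metis
  have l1: "(\<lambda>k. vicsek_dist (vicsek_psi i (X k)) (vicsek_psi 5 (Y k))) \<longlonglongrightarrow> vicsek_dist (vicsek_psi i x) (vicsek_psi 5 y)"
    by (intro vicsek_dist_tendsto psi_tendsto psi_K i5 X Y assms skel_K)
  have l2: "(\<lambda>k. vicsek_dist (vicsek_psi i (X k)) ?v) \<longlonglongrightarrow> vicsek_dist (vicsek_psi i x) ?v"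
    by (intro vicsek_dist_tendsto psi_tendsto psi_K i5 X assms vK tendsto_const skel_K)
  have l3: "(\<lambda>k. vicsek_dist ?v (vicsek_psi 5 (Y k))) \<longlonglongrightarrow> vicsek_dist ?v (vicsek_psi 5 y)"
    by (intro vicsek_dist_tendsto psi_tendsto psi_K i5 Y assms vK tendsto_const skel_K)
  show ?thesis using l1 tendsto_add[OF l2 l3] unfolding e by (rule LIMSEQ_unique)
qed

lemma vicsek_dist_corners:
  assumes ij: "i \<in> {1..4}" "j \<in> {1..4}" "i \<noteq> j" and "x \<in> vicsek_K" "y \<in> vicsek_K"
  shows "vicsek_dist (vicsek_psi i x) (vicsek_psi j y) =
    vicsek_dist (vicsek_psi i x) ((1/3) *\<^sub>R vicsek_q i) + 2/3 + vicsek_dist ((1/3) *\<^sub>R vicsek_q j) (vicsek_psi j y)"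
proof -
  obtain X Y where X: "\<And>k. X k \<in> skel" "X \<longlonglongrightarrow> x" and Y: "\<And>k. Y k \<in> skel" "Y \<longlonglongrightarrow> y"
    using K_sequence assms by metis
  have i5: "i \<in> {1..5}" "j \<in> {1..5}" "5 \<in> {1..5::nat}" using ij by auto
  let ?v = "(1/3) *\<^sub>R vicsek_q i" and ?w = "(1/3) *\<^sub>R vicsek_q j"
  have v: "?v \<in> skel" "?w \<in> skel" using psi_skel[OF i5(3) q_skel[OF i5(1)]] psi_skel[OF i5(3) q_skel[OF i5(2)]] by (auto simp: psi_5)
  note vK = skel_K[OF v(1)] skel_K[OF v(2)]
  have e: "vicsek_dist (vicsek_psi i (X k)) (vicsek_psi j (Y k)) =
    vicsek_dist (vicsek_psi i (X k)) ?v + 2/3 + vicsek_dist ?w (vicsek_psi j (Y k))" for k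
  proof -
    obtain n where n: "X k \<in> vicsek_V n" "Y k \<in> vicsek_V n" using skelE2[OF X(1)[of k] Y(1)[of k]] by blast
    show ?thesis
      using skel_corners[OF ij n] skel_corners_2[OF ij] psi_skel[OF i5(1) X(1)[of k]] psi_skel[OF i5(2) Y(1)[of k]] v
      by (simp add: vicsek_dist_extends(2))
  qed
  have l1: "(\<lambda>k. vicsek_dist (vicsek_psi i (X k)) (vicsek_psi j (Y k))) \<longlonglongrightarrow> vicsek_dist (vicsek_psi i x) (vicsek_psi j y)"
    by (intro vicsek_dist_tendsto psi_tendsto psi_K i5 X Y assms skel_K)
  have l2: "(\<lambda>k. vicsek_dist (vicsek_psi i (X k)) ?v) \<longlonglongrightarrow> vicsek_dist (vicsek_psi i x) ?v"
    by (intro vicsek_dist_tendsto psi_tendsto psi_K i5 X assms vK tendsto_const skel_K)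
  have l3: "(\<lambda>k. vicsek_dist ?w (vicsek_psi j (Y k))) \<longlonglongrightarrow> vicsek_dist ?w (vicsek_psi j y)"
    by (intro vicsek_dist_tendsto psi_tendsto psi_K i5 Y assms vK tendsto_const skel_K)
  show ?thesis using l1 tendsto_add[OF tendsto_add[OF l2 tendsto_const] l3] unfolding e by (rule LIMSEQ_unique)
qed

subsection \<open>Cells\<close>

definition psi_word :: "nat list \<Rightarrow> real^2 \<Rightarrow> real^2" where
  "psi_word w = foldr (\<lambda>i h. vicsek_psi i \<circ> h) w id"

lemma psi_word_simps [simp]: "psi_word [] x = x" "psi_word (i # w) x = vicsek_psi i (psi_word w x)" "psi_word (w @ u) x = psi_word w (psi_word u x)"
proof -
  show "psi_word (w @ u) x = psi_word w (psi_word u x)" by (induction w) (auto simp: psi_word_def)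
qed (auto simp: psi_word_def)

lemma cell_eq: "vicsek_cell w = psi_word w ` vicsek_K" by (simp add: vicsek_cell_def psi_word_def)

lemma cell_simps: "vicsek_cell [] = vicsek_K" "vicsek_cell (i # w) = vicsek_psi i ` vicsek_cell w"
  "vicsek_cell (w @ u) = psi_word w ` vicsek_cell u"
  by (auto simp: cell_eq image_image)

definition words :: "nat \<Rightarrow> nat list set" where "words n = {w. set w \<subseteq> {1..5} \<and> length w = n}"

lemma words_0 [simp]: "words 0 = {[]}" by (auto simp: words_def)
lemma words_Suc: "words (Suc n) = (\<Union>i\<in>{1..5}. (#) i ` words n)"
  by (auto simp: words_def length_Suc_conv image_iff)
lemma finite_words [simp]: "finite (words n)"
  using finite_lists_length_eq[of "{1..5::nat}" n] by (simp add: words_def)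
lemma card_words: "card (words n) = 5 ^ n"
  using card_lists_length_eq[of "{1..5::nat}" n] by (simp add: words_def)
lemma words_append: "w \<in> words n \<Longrightarrow> u \<in> words m \<Longrightarrow> w @ u \<in> words (n + m)" by (auto simp: words_def)
lemma words_add: "words (n + m) = (\<lambda>(w, u). w @ u) ` (words n \<times> words m)"
proof
  show "words (n + m) \<subseteq> (\<lambda>(w, u). w @ u) ` (words n \<times> words m)"
  proof
    fix x assume x: "x \<in> words (n + m)"
    have "take n x \<in> words n" "drop n x \<in> words m"
      using x set_take_subset[of n x] set_drop_subset[of n x] by (auto simp: words_def)
    then show "x \<in> (\<lambda>(w, u). w @ u) ` (words n \<times> words m)"
      by (intro image_eqI[of _ _ "(take n x, drop n x)"]) auto
  qed
qed (auto simp: words_append)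
lemma words_length: "w \<in> words n \<Longrightarrow> length w = n" by (simp add: words_def)
lemma words_Cons: "i # w \<in> words (Suc n) \<longleftrightarrow> i \<in> {1..5} \<and> w \<in> words n" by (auto simp: words_def)
lemma replicate_words: "i \<in> {1..5} \<Longrightarrow> replicate n i \<in> words n" by (auto simp: words_def)

lemma psi_word_K: "w \<in> words n \<Longrightarrow> x \<in> vicsek_K \<Longrightarrow> psi_word w x \<in> vicsek_K"
  by (induction w arbitrary: n) (auto simp: words_def intro!: psi_K)

lemma cell_K: "w \<in> words n \<Longrightarrow> vicsek_cell w \<subseteq> vicsek_K" using psi_word_K by (auto simp: cell_eq)

lemma psi_word_inj [simp]: "psi_word w x = psi_word w y \<longleftrightarrow> x = y" by (induction w) auto

lemma continuous_psi_word: "continuous_on A (psi_word w)"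
proof (induction w)
  case Nil then show ?case by (simp add: continuous_on_id)
next
  case (Cons i w)
  have "continuous_on A (vicsek_psi i \<circ> psi_word w)" by (rule continuous_on_compose[OF Cons continuous_psi])
  then show ?case by (simp add: o_def)
qed

lemma compact_cell: "compact (vicsek_cell w)"
  unfolding cell_eq by (rule compact_continuous_image[OF continuous_psi_word compact_K])

lemma psi_word_dist: "w \<in> words n \<Longrightarrow> x \<in> vicsek_K \<Longrightarrow> y \<in> vicsek_K \<Longrightarrow> vicsek_dist (psi_word w x) (psi_word w y) = vicsek_dist x y / 3 ^ n"
proof (induction w arbitrary: n)
  case (Cons i w)
  then obtain m where m: "n = Suc m" "w \<in> words m" "i \<in> {1..5}" by (auto simp: words_def)
  then show ?case using Cons vicsek_dist_psi[OF m(3) psi_word_K[OF m(2)] psi_word_K[OF m(2)], of x y] by simp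
qed (simp add: words_def)

lemma cell_dist_le:
  assumes "w \<in> words n" "x \<in> vicsek_cell w" "y \<in> vicsek_cell w" shows "vicsek_dist x y \<le> 2 / 3 ^ n"
  using assms psi_word_dist[OF assms(1)] vicsek_dist_bounds(2) by (auto simp: cell_eq divide_right_mono)

lemma K_cells: "vicsek_K = (\<Union>w\<in>words n. vicsek_cell w)"
proof (induction n)
  case 0 then show ?case by (simp add: cell_simps)
next
  case (Suc n)
  have "vicsek_K = (\<Union>i\<in>{1..5}. vicsek_psi i ` (\<Union>w\<in>words n. vicsek_cell w))"
    using vicsek_K_invariant Suc by simp
  also have "\<dots> = (\<Union>w\<in>words (Suc n). vicsek_cell w)"
    by (auto simp: words_Suc cell_simps)
  finally show ?case .
qed

lemma cell_exists: assumes "x \<in> vicsek_K" obtains w where "w \<in> words n" "x \<in> vicsek_cell w"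
  using assms K_cells[of n] by auto

text \<open>A path from another corner cell crosses the central cell between two junctions, and a
  path from the central cell crosses cell \<open>a\<close> from its junction to its outer corner.
  Either piece has length \<open>2/3\<close>.\<close>

lemma corner_dist_cell:
  assumes a: "a \<in> {1..4}" and i: "i \<in> {1..5}" "i \<noteq> a" and x: "x \<in> vicsek_K"
  shows "2/3 \<le> vicsek_dist (vicsek_psi i x) (vicsek_q a)"
  using i(1)
proof (cases rule: le5_cases)
  case 1
  have a5: "a \<in> {1..5}" "opp i \<in> {1..5}" "opp a \<in> {1..5}" using a opp_le4[OF 1] opp_le4[OF a] by auto
  have J: "(1/3) *\<^sub>R vicsek_q k \<in> vicsek_K" if "k \<in> {1..5}" for k using psi_K[OF _ q_K[OF that], of 5] by (simp add: psi_5)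
  show ?thesis
    using vicsek_dist_corners[OF 1 a i(2) x q_K[OF a5(1)]] vicsek_dist_nonneg[OF psi_K[OF i(1) x] J[OF i(1)]]
      vicsek_dist_nonneg[OF J[OF a5(1)] q_K[OF a5(1)]] by simp
next
  case 2
  have a5: "a \<in> {1..5}" "opp a \<in> {1..5}" using a opp_le4[OF a] by auto
  have J: "(1/3) *\<^sub>R vicsek_q k \<in> vicsek_K" if "k \<in> {1..5}" for k using psi_K[OF _ q_K[OF that], of 5] by (simp add: psi_5)
  have pK: "vicsek_psi 5 x \<in> vicsek_K" using psi_K x by simp
  have "vicsek_q a \<in> skel" "(1/3) *\<^sub>R vicsek_q a \<in> skel"
    using q_skel[OF a5(1)] psi_skel[OF _ q_skel[OF a5(1)], of 5] by (auto simp: psi_5)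
  then have "vicsek_dist (vicsek_q a) ((1/3) *\<^sub>R vicsek_q a) = 2/3"
    using skel_arm[OF a, of 1 "1/3"] by (simp add: vicsek_dist_extends(2))
  then have "2/3 \<le> vicsek_dist (vicsek_q a) (vicsek_psi 5 x)"
    using vicsek_dist_corner_center[OF a q_K[OF a5(1)] x] vicsek_dist_nonneg[OF J[OF a5(1)] pK] by simp
  then show ?thesis using 2 vicsek_dist_commute[OF q_K[OF a5(1)] pK] by simp
qed

lemma corner_in_cell_psi:
  assumes a: "a \<in> {1..4}" and i: "i \<in> {1..5}" and x: "x \<in> vicsek_K" "vicsek_psi i x = vicsek_q a"
  shows "i = a" "x = vicsek_q a"
proof -
  have aK: "vicsek_q a \<in> vicsek_K" using q_K a by simp
  show "i = a"
  proof (rule ccontr)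
    assume "i \<noteq> a"
    then have "2/3 \<le> vicsek_dist (vicsek_q a) (vicsek_q a)" using corner_dist_cell[OF a i _ x(1)] x(2) by simp
    then show False using vicsek_dist_self[OF aK] by simp
  qed
  then have "vicsek_psi i x = vicsek_psi i (vicsek_q a)" using x(2) by simp
  then show "x = vicsek_q a" by simp
qed

text \<open>The corner is the fixed point of \<open>vicsek_psi a\<close> and lies in no other cell
  of the first generation, which determines every letter of the word.\<close>

lemma corner_in_cell: "a \<in> {1..4} \<Longrightarrow> w \<in> words n \<Longrightarrow> vicsek_q a \<in> vicsek_cell w \<Longrightarrow> w = replicate n a"
proof (induction n arbitrary: w)
  case (Suc n)
  then obtain i u where w: "w = i # u" "i \<in> {1..5}" "u \<in> words n" by (auto simp: words_Suc)
  then obtain x where x: "x \<in> vicsek_cell u" "vicsek_psi i x = vicsek_q a" using Suc.prems by (auto simp: cell_simps)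
  have "x \<in> vicsek_K" using x(1) cell_K[OF w(3)] by auto
  from corner_in_cell_psi[OF Suc.prems(1) w(2) this x(2)] show ?case using Suc.IH[OF Suc.prems(1) w(3)] x w by simp
qed simp

lemma corner_far:
  "a \<in> {1..4} \<Longrightarrow> w \<in> words n \<Longrightarrow> vicsek_q a \<notin> vicsek_cell w \<Longrightarrow> x \<in> vicsek_cell w \<Longrightarrow> 2 / 3 ^ n \<le> vicsek_dist x (vicsek_q a)"
proof (induction n arbitrary: w x)
  case 0 then show ?case using q_K[of a] by (auto simp: cell_simps)
next
  case (Suc n)
  then obtain i u where w: "w = i # u" "i \<in> {1..5}" "u \<in> words n" by (auto simp: words_Suc)
  then obtain x' where x: "x' \<in> vicsek_cell u" "x = vicsek_psi i x'" using Suc.prems by (auto simp: cell_simps)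
  have xK: "x' \<in> vicsek_K" using x(1) cell_K[OF w(3)] by auto
  show ?case
  proof (cases "i = a")
    case True
    have "vicsek_q a \<notin> vicsek_cell u"
    proof
      assume "vicsek_q a \<in> vicsek_cell u"
      then have "vicsek_psi i (vicsek_q a) \<in> vicsek_cell w" by (auto simp: w cell_simps)
      then show False using Suc.prems True by simp
    qed
    then have "2 / 3 ^ n \<le> vicsek_dist x' (vicsek_q a)" using Suc.IH[OF Suc.prems(1) w(3) _ x(1)] by simp
    moreover have "vicsek_dist x (vicsek_q a) = (1/3) * vicsek_dist x' (vicsek_q a)"
      using vicsek_dist_psi[OF w(2) xK q_K[OF w(2)]] x True by simp
    ultimately show ?thesis by simp
  next
    case False
    have "2 / 3 ^ Suc n \<le> (2/3 :: real)" by (simp add: field_simps)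
    moreover have "2/3 \<le> vicsek_dist x (vicsek_q a)" using corner_dist_cell[OF Suc.prems(1) w(2) False xK] x by simp
    ultimately show ?thesis by linarith
  qed
qed

lemma junction_K: "k \<in> {1..5} \<Longrightarrow> (1/3) *\<^sub>R vicsek_q k \<in> vicsek_K"
  using psi_K[OF _ q_K, of 5 k] by (simp add: psi_5)

text \<open>A common first letter is removed by scaling. Between a corner cell and the central cell
  the path runs through the junction; the subcells being disjoint, at least one of them misses it,
  and \<open>corner_far\<close> bounds the leg on that side. Two corner cells are \<open>2/3\<close>
  apart.\<close>

lemma disjoint_cells_far:
  "w \<in> words n \<Longrightarrow> w' \<in> words n \<Longrightarrow> vicsek_cell w \<inter> vicsek_cell w' = {} \<Longrightarrow> x \<in> vicsek_cell w \<Longrightarrow> y \<in> vicsek_cell w' \<Longrightarrow>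
   2 / 3 ^ n \<le> vicsek_dist x y"
proof (induction n arbitrary: w w' x y)
  case 0 then show ?case by auto
next
  case (Suc n)
  obtain i u where w: "w = i # u" "i \<in> {1..5}" "u \<in> words n" using Suc.prems(1) by (auto simp: words_Suc)
  obtain j u' where w': "w' = j # u'" "j \<in> {1..5}" "u' \<in> words n" using Suc.prems(2) by (auto simp: words_Suc)
  obtain x' where x: "x' \<in> vicsek_cell u" "x = vicsek_psi i x'" using Suc.prems(4) by (auto simp: cell_simps w)
  obtain y' where y: "y' \<in> vicsek_cell u'" "y = vicsek_psi j y'" using Suc.prems(5) by (auto simp: cell_simps w')
  have xK: "x' \<in> vicsek_K" "x \<in> vicsek_K" using x cell_K[OF w(3)] psi_K[OF w(2)] by auto
  have yK: "y' \<in> vicsek_K" "y \<in> vicsek_K" using y cell_K[OF w'(3)] psi_K[OF w'(2)] by auto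
  have mixed: "2 / 3 ^ Suc n \<le> vicsek_dist (vicsek_psi k a) (vicsek_psi 5 b)"
    if k: "k \<in> {1..4}" and v: "v \<in> words n" "v' \<in> words n" and disj: "vicsek_cell (k # v) \<inter> vicsek_cell (5 # v') = {}"
      and ab: "a \<in> vicsek_cell v" "b \<in> vicsek_cell v'" for k v v' a b
  proof -
    have k5: "k \<in> {1..5}" "opp k \<in> {1..4}" "opp k \<in> {1..5}" using k opp_le4[OF k] by auto
    have aK: "a \<in> vicsek_K" "b \<in> vicsek_K" using ab cell_K v by auto
    let ?v = "(1/3) *\<^sub>R vicsek_q k"
    have d: "0 \<le> vicsek_dist (vicsek_psi k a) ?v" "0 \<le> vicsek_dist ?v (vicsek_psi 5 b)"
      using vicsek_dist_nonneg junction_K[OF k5(1)] psi_K k5 aK by auto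
    have "?v \<notin> vicsek_cell (k # v) \<or> ?v \<notin> vicsek_cell (5 # v')" using disj by auto
    then show ?thesis
    proof
      assume "?v \<notin> vicsek_cell (k # v)"
      then have "vicsek_q (opp k) \<notin> vicsek_cell v" using psi_opp[of k] by (metis cell_simps(2) imageI)
      then have "2 / 3 ^ n \<le> vicsek_dist a (vicsek_q (opp k))" by (rule corner_far[OF k5(2) v(1) _ ab(1)])
      moreover have "vicsek_dist (vicsek_psi k a) ?v = (1/3) * vicsek_dist a (vicsek_q (opp k))"
        using vicsek_dist_psi[OF k5(1) aK(1) q_K[OF k5(3)]] by (simp add: psi_opp)
      ultimately show ?thesis using vicsek_dist_corner_center[OF k aK] d by simp
    next
      assume "?v \<notin> vicsek_cell (5 # v')"
      then have "vicsek_q k \<notin> vicsek_cell v'" using psi_5[of "vicsek_q k"] by (metis cell_simps(2) imageI)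
      then have "2 / 3 ^ n \<le> vicsek_dist b (vicsek_q k)" by (rule corner_far[OF k v(2) _ ab(2)])
      moreover have "vicsek_dist (vicsek_psi 5 b) ?v = (1/3) * vicsek_dist b (vicsek_q k)"
        using vicsek_dist_psi[OF _ aK(2) q_K[OF k5(1)], of 5] by (simp add: psi_5)
      moreover have "vicsek_dist (vicsek_psi 5 b) ?v = vicsek_dist ?v (vicsek_psi 5 b)"
        using vicsek_dist_commute[OF psi_K[OF _ aK(2)] junction_K[OF k5(1)], of 5] by simp
      ultimately show ?thesis using vicsek_dist_corner_center[OF k aK] d by simp
    qed
  qed
  consider "i = j" | "i \<in> {1..4}" "j = 5" | "i = 5" "j \<in> {1..4}" | "i \<in> {1..4}" "j \<in> {1..4}" "i \<noteq> j"
    using w(2) w'(2) by (elim le5_cases) auto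
  then show ?case
  proof cases
    case 1
    have "vicsek_cell u \<inter> vicsek_cell u' = {}" using Suc.prems(3) 1 by (auto simp: w w' cell_simps)
    then have "2 / 3 ^ n \<le> vicsek_dist x' y'" using Suc.IH[OF w(3) w'(3)] x y by simp
    then show ?thesis using vicsek_dist_psi[OF w(2) xK(1) yK(1)] x y 1 by simp
  next
    case 2 then show ?thesis using mixed[OF 2(1) w(3) w'(3) _ x(1) y(1)] Suc.prems(3) w w' x y by simp
  next
    case 3
    then show ?thesis using mixed[OF 3(2) w'(3) w(3) _ y(1) x(1)] Suc.prems(3) w w' x y vicsek_dist_commute[OF xK(2) yK(2)]
      by (simp add: Int_commute)
  next
    case 4
    have "2 / 3 ^ Suc n \<le> (2/3 :: real)" by (simp add: field_simps)
    moreover have "vicsek_dist x y \<ge> 2/3"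
      using vicsek_dist_corners[OF 4 xK(1) yK(1)] x y
        vicsek_dist_nonneg[OF xK(2) junction_K[OF w(2)]] vicsek_dist_nonneg[OF junction_K[OF w'(2)] yK(2)] by simp
    ultimately show ?thesis by linarith
  qed
qed

text \<open>If the two points coincide, the cut-point formula has zero on the left, so the common
  point is the junction. For two corner cells the distance is at least \<open>2/3\<close>.\<close>

lemma first_cells_meet:
  assumes ij: "i \<in> {1..5}" "j \<in> {1..5}" "i \<noteq> j" and xy: "x \<in> vicsek_K" "y \<in> vicsek_K" "vicsek_psi i x = vicsek_psi j y"
  shows "(i \<in> {1..4} \<and> j = 5 \<and> x = vicsek_q (opp i) \<and> y = vicsek_q i) \<or> (j \<in> {1..4} \<and> i = 5 \<and> y = vicsek_q (opp j) \<and> x = vicsek_q j)"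
proof -
  have mixed: "a = vicsek_q (opp k) \<and> b = vicsek_q k"
    if k: "k \<in> {1..4}" and ab: "a \<in> vicsek_K" "b \<in> vicsek_K" "vicsek_psi k a = vicsek_psi 5 b" for k a b
  proof -
    have k5: "k \<in> {1..5}" using k by auto
    let ?v = "(1/3) *\<^sub>R vicsek_q k"
    have p: "vicsek_psi k a \<in> vicsek_K" using psi_K[OF k5 ab(1)] .
    have "vicsek_dist (vicsek_psi k a) ?v = 0"
      using vicsek_dist_corner_center[OF k ab(1,2)] ab(3)[symmetric] vicsek_dist_self[OF p]
        vicsek_dist_nonneg[OF p junction_K[OF k5]] vicsek_dist_nonneg[OF junction_K[OF k5] p] by simp
    then have "vicsek_psi k a = ?v" using vicsek_dist_bounds(1)[OF p junction_K[OF k5]] by simp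
    then have "vicsek_psi k a = vicsek_psi k (vicsek_q (opp k))" "vicsek_psi 5 b = vicsek_psi 5 (vicsek_q k)"
      using ab(3) by (simp_all add: psi_opp psi_5)
    then show ?thesis by (simp only: psi_eq_iff)
  qed
  consider "i \<in> {1..4}" "j = 5" | "i = 5" "j \<in> {1..4}" | "i \<in> {1..4}" "j \<in> {1..4}"
    using ij by (elim le5_cases) auto
  then show ?thesis
  proof cases
    case 1 then show ?thesis using mixed[of i x y] xy by simp
  next
    case 2 then show ?thesis using mixed[of j y x] xy by simp
  next
    case 3
    have p: "vicsek_psi i x \<in> vicsek_K" using psi_K ij xy by auto
    have "2/3 \<le> vicsek_dist (vicsek_psi i x) (vicsek_psi j y)"
      using vicsek_dist_corners[OF 3 ij(3) xy(1,2)] vicsek_dist_nonneg[OF p junction_K[OF ij(1)]]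
        vicsek_dist_nonneg[OF junction_K[OF ij(2)] p] xy(3) by simp
    then show ?thesis using vicsek_dist_self[OF p] xy(3) by simp
  qed
qed

text \<open>Where the words first differ the common point is a junction, which is a corner of the
  cell reached so far. By \<open>corner_in_cell\<close> the rest of the word repeats one letter, so
  the point stays a corner of every smaller cell.\<close>

lemma cells_meet_in_corner:
  "w \<in> words n \<Longrightarrow> w' \<in> words n \<Longrightarrow> w \<noteq> w' \<Longrightarrow> z \<in> vicsek_cell w \<Longrightarrow> z \<in> vicsek_cell w' \<Longrightarrow> \<exists>a\<in>{1..4}. z = psi_word w (vicsek_q a)"
proof (induction n arbitrary: w w' z)
  case (Suc n)
  obtain i u where w: "w = i # u" "i \<in> {1..5}" "u \<in> words n" using Suc.prems(1) by (auto simp: words_Suc)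
  obtain j u' where w': "w' = j # u'" "j \<in> {1..5}" "u' \<in> words n" using Suc.prems(2) by (auto simp: words_Suc)
  obtain x where x: "x \<in> vicsek_cell u" "z = vicsek_psi i x" using Suc.prems(4) by (auto simp: cell_simps w)
  obtain y where y: "y \<in> vicsek_cell u'" "z = vicsek_psi j y" using Suc.prems(5) by (auto simp: cell_simps w')
  have K: "x \<in> vicsek_K" "y \<in> vicsek_K" using x y cell_K w(3) w'(3) by auto
  show ?case
  proof (cases "i = j")
    case True
    then have "x = y" using x y by simp
    then show ?thesis using Suc.IH[OF w(3) w'(3) _ x(1)] y(1) Suc.prems(3) True x(2) w w' by auto
  next
    case False
    have "\<exists>a\<in>{1..4}. x = vicsek_q a"
      using first_cells_meet[OF w(2) w'(2) False K] x y opp_le4[of i] by auto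
    then obtain a where a: "a \<in> {1..4}" "x = vicsek_q a" by blast
    have "u = replicate n a" using corner_in_cell[OF a(1) w(3)] x a by simp
    moreover have "psi_word (replicate m a) (vicsek_q a) = vicsek_q a" for m by (induction m) auto
    ultimately show ?thesis using a x w by (intro bexI[of _ a]) auto
  qed
qed simp

text \<open>At a junction of the first generation there are two possible first letters, each with
  only one continuation. At any other point the first letter is determined and the induction
  hypothesis applies inside that cell.\<close>

lemma at_most_two_cells: "z \<in> vicsek_K \<Longrightarrow> \<exists>a b. \<forall>w\<in>words n. z \<in> vicsek_cell w \<longrightarrow> w = a \<or> w = b"
proof (induction n arbitrary: z)
  case (Suc n)
  show ?case
  proof (cases "\<exists>i\<in>{1..5}. \<exists>j\<in>{1..5}. i \<noteq> j \<and> (\<exists>x\<in>vicsek_K. \<exists>y\<in>vicsek_K. z = vicsek_psi i x \<and> z = vicsek_psi j y)")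
    case True
    then obtain k where k: "k \<in> {1..4}" "z = vicsek_psi k (vicsek_q (opp k))" "z = vicsek_psi 5 (vicsek_q k)"
    proof -
      obtain i j x y where "i \<in> {1..5}" "j \<in> {1..5}" "i \<noteq> j" "x \<in> vicsek_K" "y \<in> vicsek_K" "z = vicsek_psi i x" "z = vicsek_psi j y"
        using True by blast
      then show ?thesis using first_cells_meet[of i j x y] that[of i] that[of j] by auto
    qed
    have k5: "k \<in> {1..5}" "opp k \<in> {1..5}" using k(1) opp_le4[OF k(1)] by auto
    have "w = k # replicate n (opp k) \<or> w = 5 # replicate n k" if w: "w \<in> words (Suc n)" "z \<in> vicsek_cell w" for w
    proof -
      obtain i u where iu: "w = i # u" "i \<in> {1..5}" "u \<in> words n" using w(1) by (auto simp: words_Suc)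
      then obtain x where x: "x \<in> vicsek_cell u" "z = vicsek_psi i x" using w(2) by (auto simp: cell_simps)
      have xK: "x \<in> vicsek_K" using x cell_K iu by auto
      have "i = k \<or> i = 5"
        using first_cells_meet[OF iu(2) k5(1) _ xK q_K[OF k5(2)]] x(2) k(1,2) by auto
      then show ?thesis
      proof
        assume i: "i = k"
        then have "x = vicsek_q (opp k)" using x(2) k(2) by simp
        then show ?thesis using corner_in_cell[OF opp_le4[OF k(1)] iu(3)] x i iu by simp
      next
        assume i: "i = 5"
        then have "x = vicsek_q k" using x(2) k(3) by simp
        then show ?thesis using corner_in_cell[OF k(1) iu(3)] x i iu by simp
      qed
    qed
    then show ?thesis by blast
  next
    case False
    obtain i y where i: "i \<in> {1..5}" "y \<in> vicsek_K" "z = vicsek_psi i y" using K_cases[OF Suc.prems] by blast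
    obtain a b where ab: "\<And>w. w \<in> words n \<Longrightarrow> y \<in> vicsek_cell w \<Longrightarrow> w = a \<or> w = b" using Suc.IH[OF i(2)] by blast
    have "w = i # a \<or> w = i # b" if w: "w \<in> words (Suc n)" "z \<in> vicsek_cell w" for w
    proof -
      obtain j u where ju: "w = j # u" "j \<in> {1..5}" "u \<in> words n" using w(1) by (auto simp: words_Suc)
      then obtain x where x: "x \<in> vicsek_cell u" "z = vicsek_psi j x" using w(2) by (auto simp: cell_simps)
      have xK: "x \<in> vicsek_K" using x cell_K ju by auto
      then have "j = i" using False i ju x(2) by blast
      then show ?thesis using ab[OF ju(3)] x i ju by auto
    qed
    then show ?thesis by blast
  qed
qed auto

lemma card_cells_at_point: 
  assumes "z \<in> vicsek_K" shows "card {w \<in> words n. z \<in> vicsek_cell w} \<le> 2"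
proof -
  obtain a b where "\<forall>w\<in>words n. z \<in> vicsek_cell w \<longrightarrow> w = a \<or> w = b" using at_most_two_cells[OF assms] by blast
  then have "card {w \<in> words n. z \<in> vicsek_cell w} \<le> card {a, b}" by (intro card_mono) auto
  also have "\<dots> \<le> 2" by (simp add: card_insert_if)
  finally show ?thesis .
qed

definition nbrs :: "nat \<Rightarrow> nat list \<Rightarrow> nat list set" where
  "nbrs n w = {w' \<in> words n. vicsek_cell w \<inter> vicsek_cell w' \<noteq> {}}"

lemma finite_nbrs [simp]: "finite (nbrs n w)" by (simp add: nbrs_def)

lemma nbrs_sym: "w \<in> words n \<Longrightarrow> w' \<in> nbrs n w \<Longrightarrow> w \<in> nbrs n w'" by (auto simp: nbrs_def)

lemma nbrs_self: "w \<in> words n \<Longrightarrow> w \<in> nbrs n w" using q_K[of 5] by (auto simp: nbrs_def cell_eq)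

text \<open>Intersecting cells share a corner: four corners, at most two cells at each. The cell
  itself is counted at its first corner.\<close>

lemma card_nbrs:
  assumes w: "w \<in> words n" shows "card (nbrs n w) \<le> 8"
proof -
  let ?N = "\<lambda>a. {w' \<in> words n. psi_word w (vicsek_q a) \<in> vicsek_cell w'}"
  have "nbrs n w \<subseteq> (\<Union>a\<in>{1..4}. ?N a)"
  proof
    fix w' assume w': "w' \<in> nbrs n w"
    show "w' \<in> (\<Union>a\<in>{1..4}. ?N a)"
    proof (cases "w' = w")
      case True then show ?thesis using w q_K[of 1] by (auto simp: cell_eq intro!: bexI[of _ 1])
    next
      case False
      obtain z where z: "z \<in> vicsek_cell w" "z \<in> vicsek_cell w'" "w' \<in> words n" using w' by (auto simp: nbrs_def)
      then show ?thesis using cells_meet_in_corner[OF w z(3) _ z(1,2)] False by auto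
    qed
  qed
  then have "card (nbrs n w) \<le> card (\<Union>a\<in>{1..4}. ?N a)" by (intro card_mono) auto
  also have "\<dots> \<le> (\<Sum>a\<in>{1..4}. card (?N a))" by (rule card_UN_le) simp
  also have "\<dots> \<le> (\<Sum>a\<in>{1..4::nat}. 2)"
    using psi_word_K[OF w q_K] by (intro sum_mono card_cells_at_point) auto
  finally show ?thesis by simp
qed

subsection \<open>The self-similar measure\<close>

lemma psi_other: "i \<notin> {1..4} \<Longrightarrow> vicsek_psi i = vicsek_psi 5"
  by (auto simp: vicsek_psi_def vicsek_q_def fun_eq_iff)

lemma psi_K': "x \<in> vicsek_K \<Longrightarrow> vicsek_psi i x \<in> vicsek_K"
  using psi_K[of i x] psi_K[of 5 x] psi_other[of i] by (cases "i \<in> {1..4}") auto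

lemma norm_q_le: "norm (vicsek_q i) \<le> 1"
  using norm_q[of i] by (cases "i \<in> {1..4}") (auto simp: vicsek_q_def)

text \<open>Letters outside \<open>{1..4}\<close> all act as \<open>vicsek_psi 5\<close>, so every sequence of letters codes a point of
  \<open>vicsek_K\<close>.\<close>

definition coding :: "nat stream \<Rightarrow> real^2" where
  "coding s = (\<Sum>n. (1/3) ^ n *\<^sub>R ((2/3) *\<^sub>R vicsek_q (s !! n)))"

lemma coding_term_le: "norm ((1/3) ^ n *\<^sub>R ((2/3) *\<^sub>R vicsek_q i)) \<le> (1/3::real) ^ n"
proof -
  have "(1/3::real) ^ n * ((2/3) * norm (vicsek_q i)) \<le> (1/3) ^ n * 1"
    using norm_q_le[of i] by (intro mult_left_mono) auto
  then show ?thesis by simp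
qed

lemma coding_summable_norm: "summable (\<lambda>n. norm ((1/3) ^ n *\<^sub>R ((2/3) *\<^sub>R vicsek_q (s !! n))))"
  by (rule summable_comparison_test'[of "\<lambda>n. (1/3::real) ^ n" 0])
     (use coding_term_le in \<open>auto simp: summable_geometric\<close>)

lemma coding_summable: "summable (\<lambda>n. (1/3) ^ n *\<^sub>R ((2/3) *\<^sub>R vicsek_q (s !! n)))"
  by (rule summable_norm_cancel[OF coding_summable_norm])

lemma coding_Cons: "coding (i ## s) = vicsek_psi i (coding s)"
proof -
  have "coding (i ## s) = (2/3) *\<^sub>R vicsek_q i + (\<Sum>n. (1/3) ^ Suc n *\<^sub>R ((2/3) *\<^sub>R vicsek_q (s !! n)))"
    unfolding coding_def using suminf_split_head[OF coding_summable[of "i ## s"]] by (simp add: algebra_simps)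
  also have "(\<Sum>n. (1/3) ^ Suc n *\<^sub>R ((2/3) *\<^sub>R vicsek_q (s !! n))) = (1/3) *\<^sub>R coding s"
    unfolding coding_def by (subst suminf_scaleR_right[OF coding_summable]) simp
  finally show ?thesis by (simp add: psi_alt)
qed

lemma norm_coding: "norm (coding s) \<le> 3/2"
proof -
  have "norm (coding s) \<le> (\<Sum>n. norm ((1/3) ^ n *\<^sub>R ((2/3) *\<^sub>R vicsek_q (s !! n))))"
    unfolding coding_def by (rule summable_norm[OF coding_summable_norm])
  also have "\<dots> \<le> (\<Sum>n. (1/3::real) ^ n)"
    by (intro suminf_le coding_term_le coding_summable_norm summable_geometric) simp
  also have "\<dots> = 3/2" by (simp add: suminf_geometric)
  finally show ?thesis .
qed

lemma infdist_psi_K: "infdist (vicsek_psi i x) vicsek_K \<le> (1/3) * infdist x vicsek_K"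
proof -
  obtain y where y: "y \<in> vicsek_K" "infdist x vicsek_K = dist x y"
    using infdist_attains_inf[OF closed_K, of x] q_K[of 1] by auto
  have "infdist (vicsek_psi i x) vicsek_K \<le> dist (vicsek_psi i x) (vicsek_psi i y)"
    by (rule infdist_le[OF psi_K'[OF y(1)]])
  then show ?thesis by (simp add: dist_psi y)
qed

text \<open>Removing \<open>n\<close> letters shows that the point is within
  \<open>(3/2) * (1/3) ^ n\<close> of the set, for every \<open>n\<close>; the set is
  closed.\<close>

lemma coding_K: "coding s \<in> vicsek_K"
proof -
  have 0: "0 \<in> vicsek_K" using q_K[of 5] by (simp add: q_nth)
  have le: "infdist (coding s) vicsek_K \<le> (3/2) * (1/3) ^ n" for n s
  proof (induction n arbitrary: s)
    case 0
    have "infdist (coding s) vicsek_K \<le> dist (coding s) 0" by (rule infdist_le) (use q_K[of 5] in \<open>simp add: q_nth\<close>)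
    then show ?case using norm_coding[of s] by simp
  next
    case (Suc n)
    have "infdist (coding s) vicsek_K \<le> (1/3) * infdist (coding (stl s)) vicsek_K"
      using infdist_psi_K[of "shd s" "coding (stl s)"] coding_Cons[of "shd s" "stl s"] by simp
    then show ?case using Suc.IH[of "stl s"] by simp
  qed
  have "(\<lambda>n. (3/2) * (1/3::real) ^ n) \<longlonglongrightarrow> 0" by (auto intro!: tendsto_mult_right_zero LIMSEQ_power_zero)
  then have "infdist (coding s) vicsek_K \<le> 0" by (rule LIMSEQ_le_const) (use le in auto)
  then have "infdist (coding s) vicsek_K = 0" using infdist_nonneg[of "coding s" vicsek_K] by linarith
  then show ?thesis using in_closed_iff_infdist_zero[OF closed_K] 0 by auto
qed

definition letter_measure :: "nat measure" where "letter_measure = measure_pmf (pmf_of_set {1..5})"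

text \<open>The law of the point coded by independent uniform letters. It lives on the whole plane,
  so that preimages under \<open>vicsek_psi\<close> stay in the same measurable space, and is
  restricted to \<open>vicsek_K\<close> afterwards.\<close>

definition coded_measure :: "(real^2) measure" where
  "coded_measure = distr (stream_space letter_measure) borel coding"

lemma prob_letter: "prob_space letter_measure"
  unfolding letter_measure_def by (rule prob_space_measure_pmf)

lemma coding_measurable [measurable]: "coding \<in> borel_measurable (stream_space letter_measure)"
proof -
  have [measurable]: "(\<lambda>i. vicsek_q i) \<in> borel_measurable letter_measure"
    unfolding letter_measure_def by simp
  show ?thesis unfolding coding_def[abs_def] by measurable
qed

lemma prob_coded: "prob_space coded_measure"
proof -
  interpret prob_space letter_measure by (rule prob_letter)
  interpret S: prob_space "stream_space letter_measure" by (rule prob_space_stream_space)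
  show ?thesis unfolding coded_measure_def by (rule S.prob_space_distr) measurable
qed

lemma sets_coded [simp, measurable_cong]: "sets coded_measure = sets borel" by (simp add: coded_measure_def)
lemma space_coded [simp]: "space coded_measure = UNIV" by (simp add: coded_measure_def)

lemma psi_measurable [measurable]: "vicsek_psi i \<in> borel_measurable borel"
  by (rule borel_measurable_continuous_onI[OF continuous_psi])

text \<open>Conditioning on the first letter: the remaining letters have the same law as the whole
  sequence.\<close>

lemma coded_self_similar:
  assumes A[measurable]: "A \<in> sets borel"
  shows "emeasure coded_measure A = (\<Sum>i\<in>{1..5}. emeasure coded_measure (vicsek_psi i -` A)) / 5"
proof -
  interpret prob_space letter_measure by (rule prob_letter)
  let ?S = "stream_space letter_measure"
  have "emeasure coded_measure A = emeasure ?S (coding -` A \<inter> space ?S)"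
    unfolding coded_measure_def by (rule emeasure_distr) measurable
  also have "\<dots> = (\<integral>\<^sup>+t. emeasure ?S {x \<in> space ?S. t ## x \<in> coding -` A \<inter> space ?S} \<partial>letter_measure)"
    by (rule emeasure_stream_space) measurable
  also have "\<dots> = (\<integral>\<^sup>+t. emeasure coded_measure (vicsek_psi t -` A) \<partial>letter_measure)"
  proof (rule nn_integral_cong)
    fix t
    have U: "space ?S = UNIV" by (simp add: space_stream_space letter_measure_def)
    have m: "vicsek_psi t -` A \<in> sets borel" using measurable_sets[OF psi_measurable A] by simp
    show "emeasure ?S {x \<in> space ?S. t ## x \<in> coding -` A \<inter> space ?S} = emeasure coded_measure (vicsek_psi t -` A)"
      unfolding coded_measure_def emeasure_distr[OF coding_measurable m]
      by (rule arg_cong[of _ _ "emeasure ?S"]) (auto simp: coding_Cons U)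
  qed
  also have "\<dots> = (\<Sum>i\<in>{1..5}. emeasure coded_measure (vicsek_psi i -` A)) / 5"
    unfolding letter_measure_def by (subst nn_integral_pmf_of_set) auto
  finally show ?thesis .
qed

lemma coded_outside: assumes "A \<in> sets borel" "A \<inter> vicsek_K = {}" shows "emeasure coded_measure A = 0"
proof -
  have "coding -` A \<inter> space (stream_space letter_measure) = {}" using coding_K assms(2) by auto
  then show ?thesis unfolding coded_measure_def using emeasure_distr[OF coding_measurable assms(1)] by simp
qed

lemma coded_K: "emeasure coded_measure vicsek_K = 1"
proof -
  interpret prob_space coded_measure by (rule prob_coded)
  have "emeasure coded_measure (- vicsek_K) = 0"
    by (rule coded_outside) (use closed_K in auto)
  then have "emeasure coded_measure (space coded_measure) = emeasure coded_measure vicsek_K + emeasure coded_measure (- vicsek_K)"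
    using closed_K by (subst plus_emeasure) (auto simp: Compl_partition)
  then show ?thesis using emeasure_space_1 \<open>emeasure coded_measure (- vicsek_K) = 0\<close> by simp
qed

text \<open>Only \<open>vicsek_psi a\<close> maps a point of the set to this corner, namely the
  corner itself, so self-similarity says that its finite mass equals a fifth of itself.\<close>

lemma coded_corner: assumes a: "a \<in> {1..4}" shows "emeasure coded_measure {vicsek_q a} = 0"
proof -
  interpret prob_space coded_measure by (rule prob_coded)
  have pre: "vicsek_psi i -` {vicsek_q a} = {psi_inv i (vicsek_q a)}" for i by (auto simp: vimage_def) (metis psi_inv_psi)
  have z: "emeasure coded_measure (vicsek_psi i -` {vicsek_q a}) = (if i = a then emeasure coded_measure {vicsek_q a} else 0)"
    if "i \<in> {1..5}" for i
  proof (cases "i = a")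
    case True
    have "psi_inv a (vicsek_q a) = vicsek_q a" by (metis psi_inv_psi psi_q)
    then show ?thesis using True pre by simp
  next
    case False
    have "psi_inv i (vicsek_q a) \<notin> vicsek_K" using corner_in_cell_psi(1)[OF a that, of "psi_inv i (vicsek_q a)"] False by auto
    then show ?thesis unfolding pre using False by (auto intro!: coded_outside)
  qed
  have "emeasure coded_measure {vicsek_q a} = (\<Sum>i\<in>{1..5}. (if i = a then emeasure coded_measure {vicsek_q a} else 0)) / 5"
    by (subst coded_self_similar) (use z in \<open>auto simp: pre\<close>)
  also have "\<dots> = emeasure coded_measure {vicsek_q a} / 5" using a by (simp add: sum.delta)
  finally have "emeasure coded_measure {vicsek_q a} = emeasure coded_measure {vicsek_q a} / 5" .
  then have "ennreal (measure coded_measure {vicsek_q a}) = ennreal (measure coded_measure {vicsek_q a} / 5)"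
    using divide_ennreal[of "measure coded_measure {vicsek_q a}" 5] by (simp add: emeasure_eq_measure)
  then have "measure coded_measure {vicsek_q a} = measure coded_measure {vicsek_q a} / 5"
    by (subst (asm) ennreal_inj) auto
  then show ?thesis by (simp add: emeasure_eq_measure)
qed

lemma closed_cell: "closed (vicsek_cell w)" by (rule compact_imp_closed[OF compact_cell])

lemma coded_cell: "w \<in> words n \<Longrightarrow> emeasure coded_measure (vicsek_cell w) = ennreal ((1/5) ^ n)"
proof (induction n arbitrary: w)
  case 0 then show ?case by (simp add: cell_simps coded_K)
next
  case (Suc n)
  obtain j u where w: "w = j # u" "j \<in> {1..5}" "u \<in> words n" using Suc.prems by (auto simp: words_Suc)
  have m: "vicsek_cell w \<in> sets borel" using closed_cell by auto
  have z: "emeasure coded_measure (vicsek_psi i -` vicsek_cell w) = (if i = j then ennreal ((1/5) ^ n) else 0)"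
    if i: "i \<in> {1..5}" for i
  proof (cases "i = j")
    case True
    have "vicsek_psi i -` vicsek_cell w = vicsek_cell u" using True w by (auto simp: cell_simps)
    then show ?thesis using True Suc.IH[OF w(3)] by simp
  next
    case False
    \<comment> \<open>The preimage under a map with a different letter meets \<open>vicsek_K\<close>
      only in corners, by \<open>first_cells_meet\<close>, and corners are null.\<close>
    let ?Q = "vicsek_q ` {1..4}"
    have pm: "vicsek_psi i -` vicsek_cell w \<in> sets borel" using measurable_sets[OF psi_measurable m] by simp
    have Qm: "?Q \<in> sets borel" by (intro borel_closed finite_imp_closed) auto
    have Q0: "emeasure coded_measure ?Q = 0"
    proof -
      have "emeasure coded_measure (\<Union>a\<in>{1..4}. {vicsek_q a}) \<le> (\<Sum>a\<in>{1..4}. emeasure coded_measure {vicsek_q a})"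
        by (rule emeasure_subadditive_finite) auto
      also have "\<dots> = 0" using coded_corner by (intro sum.neutral) blast
      finally show ?thesis by (simp add: UNION_singleton_eq_range)
    qed
    have "x \<in> ?Q \<union> - vicsek_K" if "x \<in> vicsek_psi i -` vicsek_cell w" for x
    proof -
      obtain y where y: "y \<in> vicsek_cell u" "vicsek_psi i x = vicsek_psi j y" using \<open>x \<in> _\<close> by (auto simp: w cell_simps)
      have yK: "y \<in> vicsek_K" using y cell_K[OF w(3)] by auto
      show ?thesis using first_cells_meet[OF i w(2) False _ yK y(2)] opp_le4[of i] by auto
    qed
    then have "emeasure coded_measure (vicsek_psi i -` vicsek_cell w) \<le> emeasure coded_measure (?Q \<union> - vicsek_K)"
      using Qm closed_K by (intro emeasure_mono) auto
    also have "\<dots> \<le> emeasure coded_measure ?Q + emeasure coded_measure (- vicsek_K)"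
      using Qm closed_K by (intro emeasure_subadditive) auto
    also have "\<dots> = 0" using Q0 coded_outside[of "- vicsek_K"] closed_K by auto
    finally show ?thesis using False by simp
  qed
  have "emeasure coded_measure (vicsek_cell w) = (\<Sum>i\<in>{1..5}. (if i = j then ennreal ((1/5) ^ n) else 0)) / 5"
    by (subst coded_self_similar[OF m]) (use z in simp)
  also have "\<dots> = ennreal ((1/5) ^ n) / 5" using w(2) by (simp add: sum.delta)
  also have "\<dots> = ennreal ((1/5) ^ Suc n)"
    using divide_ennreal[of "(1/5) ^ n" 5] by (simp add: ennreal_numeral)
  finally show ?case .
qed

section \<open>Existence and uniqueness of the measure with the prescribed masses of cells\<close>

definition is_vicsek_measure :: "(real^2) measure \<Rightarrow> bool" where
  "is_vicsek_measure M \<longleftrightarrow> prob_space M \<and> space M = vicsek_K \<and> sets M = sets (restrict_space borel vicsek_K) \<and>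
     (\<forall>w. set w \<subseteq> {1..5} \<longrightarrow> emeasure M (vicsek_cell w) = ennreal ((1/5) ^ length w))"

lemma vicsek_measure_exists: "is_vicsek_measure (restrict_space coded_measure vicsek_K)"
  unfolding is_vicsek_measure_def
proof (intro conjI allI impI)
  have [simp]: "vicsek_K \<in> sets borel" using closed_K by auto
  show "space (restrict_space coded_measure vicsek_K) = vicsek_K" by (simp add: space_restrict_space)
  show "sets (restrict_space coded_measure vicsek_K) = sets (restrict_space borel vicsek_K)"
    by (rule sets_restrict_space_cong) simp
  show "prob_space (restrict_space coded_measure vicsek_K)"
    by (rule prob_spaceI) (simp add: space_restrict_space emeasure_restrict_space coded_K)
  fix w :: "nat list" assume "set w \<subseteq> {1..5}"
  then have w: "w \<in> words (length w)" by (simp add: words_def)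
  show "emeasure (restrict_space coded_measure vicsek_K) (vicsek_cell w) = ennreal ((1/5) ^ length w)"
    using coded_cell[OF w] cell_K[OF w] by (subst emeasure_restrict_space) auto
qed

text \<open>The finite sets are included to make the family stable under intersection: cells of equal length
  overlap in finitely many corners.\<close>

definition cell_family :: "(real^2) set set" where
  "cell_family = vicsek_cell ` {w. set w \<subseteq> {1..5}} \<union> {F. finite F \<and> F \<subseteq> vicsek_K}"

lemma vicsek_measure_point:
  assumes M: "is_vicsek_measure M" and z: "z \<in> vicsek_K"
  shows "emeasure M {z} = 0"
proof -
  interpret prob_space M using M by (simp add: is_vicsek_measure_def)
  have le: "emeasure M {z} \<le> ennreal ((1/5) ^ n)" for n
  proof -
    obtain w where w: "w \<in> words n" "z \<in> vicsek_cell w" using cell_exists[OF z] by blast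
    have "vicsek_cell w \<in> sets M"
      using M closed_cell[of w] cell_K[OF w(1)] by (auto simp: is_vicsek_measure_def sets_restrict_space)
    then have "emeasure M {z} \<le> emeasure M (vicsek_cell w)" using w by (intro emeasure_mono) auto
    also have "\<dots> = ennreal ((1/5) ^ n)" using M w by (simp add: is_vicsek_measure_def words_def)
    finally show ?thesis .
  qed
  have "measure M {z} \<le> (1/5) ^ n" for n using le[of n] by (simp add: emeasure_eq_measure)
  moreover have "(\<lambda>n. (1/5::real) ^ n) \<longlonglongrightarrow> 0" by (rule LIMSEQ_power_zero) simp
  ultimately have "measure M {z} \<le> 0" by (intro LIMSEQ_le_const[of "\<lambda>n. (1/5::real) ^ n"]) auto
  then show ?thesis using measure_nonneg[of M "{z}"] by (simp add: emeasure_eq_measure)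
qed

text \<open>The prefix of \<open>w'\<close> of length \<open>n\<close> is either \<open>w\<close>,
  which gives inclusion, or a different word of the same length, and then the cells share corners at
  most.\<close>

lemma cell_prefix_or_finite:
  assumes w: "w \<in> words n" "w' \<in> words m" "n \<le> m"
  shows "vicsek_cell w' \<subseteq> vicsek_cell w \<or> finite (vicsek_cell w \<inter> vicsek_cell w')"
proof -
  have "w' \<in> words (n + (m - n))" using w by simp
  then obtain v u where vu: "v \<in> words n" "u \<in> words (m - n)" "w' = v @ u" unfolding words_add by auto
  have sub: "vicsek_cell w' \<subseteq> vicsek_cell v" using cell_K[OF vu(2)] by (auto simp: vu cell_simps) (auto simp: cell_eq)
  show ?thesis
  proof (cases "v = w")
    case True then show ?thesis using sub by simp
  next
    case False
    then have "vicsek_cell w \<inter> vicsek_cell w' \<subseteq> (\<lambda>a. psi_word w (vicsek_q a)) ` {1..4}"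
      using cells_meet_in_corner[OF w(1) vu(1)] sub by blast
    then show ?thesis using finite_subset by blast
  qed
qed

lemma Int_stable_cell_family: "Int_stable cell_family"
proof (rule Int_stableI)
  fix A B assume AB: "A \<in> cell_family" "B \<in> cell_family"
  have cc: "vicsek_cell w \<inter> vicsek_cell w' \<in> cell_family" if "w \<in> words n" "w' \<in> words m" "n \<le> m" for w w' n m
    using cell_prefix_or_finite[OF that] that cell_K
    by (auto simp: cell_family_def words_def Int_absorb1)
  have sub: "A \<subseteq> vicsek_K" "B \<subseteq> vicsek_K" using AB cell_K by (auto simp: cell_family_def words_def)
  show "A \<inter> B \<in> cell_family"
  proof (cases "finite A \<or> finite B")
    case True then show ?thesis using sub by (auto simp: cell_family_def)
  next
    case False
    then obtain w w' where w: "A = vicsek_cell w" "B = vicsek_cell w'" "w \<in> words (length w)" "w' \<in> words (length w')"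
      using AB by (auto simp: cell_family_def words_def)
    show ?thesis
      using cc[OF w(3,4)] cc[OF w(4,3)] unfolding w(1,2) by (cases "length w \<le> length w'") (auto simp: Int_commute)
  qed
qed

lemma cell_family_generates: "sets (restrict_space borel vicsek_K) = sigma_sets vicsek_K cell_family"
proof
  have sub: "cell_family \<subseteq> Pow vicsek_K" using cell_K by (auto simp: cell_family_def words_def)
  show "sigma_sets vicsek_K cell_family \<subseteq> sets (restrict_space borel vicsek_K)"
  proof -
    have "A \<in> sets (restrict_space borel vicsek_K)" if "A \<in> cell_family" for A
    proof -
      have "closed A" using that closed_cell by (auto simp: cell_family_def finite_imp_closed)
      then show ?thesis using sub that by (auto simp: sets_restrict_space intro!: image_eqI[of _ _ A])
    qed
    then have "sigma_sets (space (restrict_space borel vicsek_K)) cell_family \<subseteq> sets (restrict_space borel vicsek_K)"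
      by (intro sets.sigma_sets_subset) auto
    then show ?thesis by (simp add: space_restrict_space)
  qed
  show "sets (restrict_space borel vicsek_K) \<subseteq> sigma_sets vicsek_K cell_family"
  proof -
    let ?M = "sigma vicsek_K cell_family"
    have sM: "sets ?M = sigma_sets vicsek_K cell_family" "space ?M = vicsek_K" using sub by auto
    have "(\<lambda>x. x) \<in> borel_measurable ?M"
    proof (rule borel_measurableI)
      fix U :: "(real^2) set" assume U: "open U"
      \<comment> \<open>Cells shrink to points, so a relatively open set is the union of the cells
        it contains. There are only countably many words.\<close>
      have "U \<inter> vicsek_K = (\<Union>w\<in>{w. set w \<subseteq> {1..5} \<and> vicsek_cell w \<subseteq> U}. vicsek_cell w)"
      proof
        show "U \<inter> vicsek_K \<subseteq> (\<Union>w\<in>{w. set w \<subseteq> {1..5} \<and> vicsek_cell w \<subseteq> U}. vicsek_cell w)"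
        proof
          fix x assume x: "x \<in> U \<inter> vicsek_K"
          then obtain e where e: "0 < e" "ball x e \<subseteq> U" using U open_contains_ball by (metis IntD1)
          obtain n where n: "(1/3::real) ^ n < e / 2" using real_arch_pow_inv[of "e/2" "1/3"] e by auto
          obtain w where w: "w \<in> words n" "x \<in> vicsek_cell w" using cell_exists x by blast
          have "vicsek_cell w \<subseteq> ball x e"
          proof
            fix y assume y: "y \<in> vicsek_cell w"
            have "dist x y \<le> 2 / 3 ^ n"
              using vicsek_dist_bounds(1)[of x y] cell_dist_le[OF w(1,2) y] cell_K[OF w(1)] w(2) y by fastforce
            also have "\<dots> < e" using n by (simp add: power_one_over divide_simps)
            finally show "y \<in> ball x e" by simp
          qed
          then show "x \<in> (\<Union>w\<in>{w. set w \<subseteq> {1..5} \<and> vicsek_cell w \<subseteq> U}. vicsek_cell w)"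
            using e w by (auto simp: words_def)
        qed
      qed (use cell_K in \<open>auto simp: words_def\<close>)
      moreover have "vicsek_cell w \<in> sets ?M" if "set w \<subseteq> {1..5}" for w
        unfolding sM using that by (intro sigma_sets.Basic) (auto simp: cell_family_def)
      then have "(\<Union>w\<in>{w. set w \<subseteq> {1..5} \<and> vicsek_cell w \<subseteq> U}. vicsek_cell w) \<in> sets ?M"
        by (intro sets.countable_UN') auto
      ultimately show "(\<lambda>x. x) -` U \<inter> space ?M \<in> sets ?M" unfolding sM by (simp add: vimage_def)
    qed
    then have "A \<inter> vicsek_K \<in> sets ?M" if "A \<in> sets borel" for A
      using measurable_sets[of "\<lambda>x. x" ?M borel A] that unfolding sM by (simp add: vimage_def)
    then show ?thesis unfolding sM by (auto simp: sets_restrict_space Int_commute)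
  qed
qed

lemma vicsek_measure_unique:
  assumes M: "is_vicsek_measure M" and N: "is_vicsek_measure N"
  shows "M = N"
proof (rule measure_eqI_generator_eq[OF Int_stable_cell_family, of vicsek_K])
  show "cell_family \<subseteq> Pow vicsek_K" using cell_K by (auto simp: cell_family_def words_def)
  show "sets M = sigma_sets vicsek_K cell_family" "sets N = sigma_sets vicsek_K cell_family"
    using M N cell_family_generates by (auto simp: is_vicsek_measure_def)
  have K: "vicsek_K = vicsek_cell []" by (simp add: cell_simps)
  show "range (\<lambda>_::nat. vicsek_K) \<subseteq> cell_family" by (subst K) (auto simp: cell_family_def)
  show "(\<Union>i::nat. vicsek_K) = vicsek_K" by simp
  interpret prob_space M using M by (simp add: is_vicsek_measure_def)
  show "emeasure M vicsek_K \<noteq> \<infinity>" for i :: nat by simp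
  fix X assume "X \<in> cell_family"
  then consider w where "set w \<subseteq> {1..5}" "X = vicsek_cell w" | "finite X" "X \<subseteq> vicsek_K" by (auto simp: cell_family_def)
  then show "emeasure M X = emeasure N X"
  proof cases
    case 1 then show ?thesis using M N by (simp add: is_vicsek_measure_def)
  next
    case 2
    have "emeasure L X = 0" if L: "is_vicsek_measure L" for L
    proof -
      have s: "{x} \<in> sets L" if "x \<in> X" for x
        using L that 2 by (auto simp: is_vicsek_measure_def sets_restrict_space intro!: image_eqI[of _ _ "{x}"])
      have "emeasure L X \<le> (\<Sum>x\<in>X. emeasure L {x})"
        using emeasure_subadditive_finite[OF 2(1), of "\<lambda>x. {x}" L] s by auto
      also have "\<dots> = 0" using vicsek_measure_point[OF L] 2 by (auto intro!: sum.neutral)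
      finally show ?thesis by simp
    qed
    then show ?thesis using M N by simp
  qed
qed

lemma is_vicsek_measure_mu: "is_vicsek_measure vicsek_mu"
proof -
  have "vicsek_mu = (THE M. is_vicsek_measure M)" by (simp add: vicsek_mu_def is_vicsek_measure_def)
  then show ?thesis using theI[of is_vicsek_measure, OF vicsek_measure_exists] vicsek_measure_unique vicsek_measure_exists by metis
qed

lemma prob_space_mu: "prob_space vicsek_mu" and space_mu [simp]: "space vicsek_mu = vicsek_K"
  and sets_mu: "sets vicsek_mu = sets (restrict_space borel vicsek_K)"
  using is_vicsek_measure_mu by (auto simp: is_vicsek_measure_def)

lemma emeasure_cell: "w \<in> words n \<Longrightarrow> emeasure vicsek_mu (vicsek_cell w) = ennreal ((1/5) ^ n)"
  using is_vicsek_measure_mu by (auto simp: is_vicsek_measure_def words_def)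

lemma closed_sets_mu: "closed A \<Longrightarrow> A \<subseteq> vicsek_K \<Longrightarrow> A \<in> sets vicsek_mu"
  by (auto simp: sets_mu sets_restrict_space intro!: image_eqI[of _ _ A])

lemma cell_sets [measurable]: "w \<in> words n \<Longrightarrow> vicsek_cell w \<in> sets vicsek_mu"
  by (rule closed_sets_mu[OF closed_cell cell_K])

lemma closed_vicsek_ball:
  assumes "x \<in> vicsek_K" shows "closed (vicsek_ball x r)"
proof -
  have "continuous_on vicsek_K (\<lambda>y. (\<lambda>(x, y). vicsek_dist x y) (x, y))"
    by (rule continuous_on_compose2[OF continuous_vicsek_dist]) (use assms in \<open>auto intro!: continuous_intros\<close>)
  then have "closed {y \<in> vicsek_K. (\<lambda>y. vicsek_dist x y) y \<le> r}"
    using continuous_closed_preimage[OF _ closed_K closed_atMost, of "\<lambda>y. vicsek_dist x y" r]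
    by (simp add: vimage_def Int_def)
  then show ?thesis by (simp add: vicsek_ball_def)
qed

lemma vicsek_ball_sets: "x \<in> vicsek_K \<Longrightarrow> vicsek_ball x r \<in> sets vicsek_mu"
  by (rule closed_sets_mu[OF closed_vicsek_ball]) (auto simp: vicsek_ball_def)

subsection \<open>Energies of pairs of cells\<close>

interpretation mu: prob_space vicsek_mu by (rule prob_space_mu)

interpretation mu_pair: pair_prob_space vicsek_mu vicsek_mu by unfold_locales

text \<open>Convexity of the power, applied to \<open>a + b\<close> as the mean of
  \<open>a / (1 - l)\<close> and \<open>b / l\<close> with weights \<open>1 - l\<close> and
  \<open>l\<close>. The free weights let a chain of length \<open>s\<close> be joined to one of
  length \<open>t\<close> without loss.\<close>

lemma powr_add_weighted:
  fixes a b s t p :: real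
  assumes p: "1 \<le> p" and st: "0 < s" "0 < t" and ab: "0 \<le> a" "0 \<le> b"
  shows "(a + b) powr p \<le> ((s + t) / s) powr (p - 1) * a powr p + ((s + t) / t) powr (p - 1) * b powr p"
proof (cases "a = 0 \<or> b = 0")
  case True
  have "1 \<le> ((s + t) / s) powr (p - 1)" "1 \<le> ((s + t) / t) powr (p - 1)"
    using p st by (auto intro!: ge_one_powr_ge_zero simp: field_simps)
  then show ?thesis using True mult_right_mono[of 1 _ "a powr p"] mult_right_mono[of 1 _ "b powr p"] by auto
next
  case False
  then have ab: "0 < a" "0 < b" using ab by auto
  \<comment> \<open>The share of the second chain in the total length.\<close>
  define l where "l = t / (s + t)"
  have l: "0 < l" "l < 1" "1 - l = s / (s + t)" using st by (auto simp: l_def field_simps)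
  have "((1 - l) *\<^sub>R (a / (1 - l)) + l *\<^sub>R (b / l)) powr p \<le> (1 - l) * (a / (1 - l)) powr p + l * (b / l) powr p"
    by (rule convex_onD[OF powr_convex[OF p]]) (use l(1,2) ab in auto)
  moreover have "(1 - l) *\<^sub>R (a / (1 - l)) + l *\<^sub>R (b / l) = a + b" using l(1,2) by simp
  moreover have q: "c * (x / c) powr p = (1 / c) powr (p - 1) * x powr p" if "0 < c" "0 < x" for c x :: real
  proof -
    have "(x / c) powr p = x powr p * (1 / c) powr p" using that by (simp add: powr_mult[symmetric])
    moreover have "(1 / c) powr p = (1 / c) powr (p - 1) * (1 / c)"
      using that powr_add[of "1 / c" "p - 1" 1] by (simp add: powr_one)
    ultimately show ?thesis using that by simp
  qed
  moreover have "1 / (1 - l) = (s + t) / s" "1 / l = (s + t) / t" using l st by (auto simp: l_def)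
  ultimately show ?thesis using q[of "1 - l" a] q[of l b] l ab by simp
qed

lemma powr_add_le:
  fixes a b p :: real
  assumes p: "1 \<le> p" and ab: "0 \<le> a" "0 \<le> b"
  shows "(a + b) powr p \<le> 2 powr p * (a powr p + b powr p)"
proof -
  have "(a + b) powr p \<le> 2 powr (p - 1) * (a powr p + b powr p)"
    using powr_add_weighted[OF p, of 1 1 a b] ab by (simp add: distrib_left)
  also have "\<dots> \<le> 2 powr p * (a powr p + b powr p)" by (intro mult_right_mono powr_mono) auto
  finally show ?thesis .
qed

definition pair_energy :: "real \<Rightarrow> (real^2 \<Rightarrow> real) \<Rightarrow> (real^2) set \<Rightarrow> (real^2) set \<Rightarrow> ennreal" where
  "pair_energy p f A B = (\<integral>\<^sup>+x\<in>A. (\<integral>\<^sup>+y\<in>B. ennreal (\<bar>f y - f x\<bar> powr p) \<partial>vicsek_mu) \<partial>vicsek_mu)"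

lemma pair_energy_commute:
  assumes [measurable]: "f \<in> borel_measurable vicsek_mu" "A \<in> sets vicsek_mu" "B \<in> sets vicsek_mu"
  shows "pair_energy p f A B = pair_energy p f B A"
proof -
  have "pair_energy p f A B = (\<integral>\<^sup>+x. \<integral>\<^sup>+y. ennreal (\<bar>f y - f x\<bar> powr p) * indicator B y * indicator A x \<partial>vicsek_mu \<partial>vicsek_mu)"
    unfolding pair_energy_def by (intro nn_integral_cong nn_integral_multc[symmetric]) measurable
  also have "\<dots> = (\<integral>\<^sup>+y. \<integral>\<^sup>+x. ennreal (\<bar>f y - f x\<bar> powr p) * indicator B y * indicator A x \<partial>vicsek_mu \<partial>vicsek_mu)"
    by (rule mu_pair.Fubini'[symmetric]) measurable
  also have "\<dots> = (\<integral>\<^sup>+y. \<integral>\<^sup>+x. ennreal (\<bar>f x - f y\<bar> powr p) * indicator A x * indicator B y \<partial>vicsek_mu \<partial>vicsek_mu)"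
    by (intro nn_integral_cong) (simp add: abs_minus_commute ac_simps)
  also have "\<dots> = pair_energy p f B A"
    unfolding pair_energy_def by (intro nn_integral_cong nn_integral_multc) measurable
  finally show ?thesis .
qed

text \<open>A third point is inserted and integrated over \<open>B\<close>. As the three sets have
  equal mass, each integral acquires the same factor \<open>m\<close>, which cancels.\<close>

lemma pair_energy_triangle:
  assumes f[measurable]: "f \<in> borel_measurable vicsek_mu"
    and A[measurable]: "A \<in> sets vicsek_mu" and B[measurable]: "B \<in> sets vicsek_mu" and C[measurable]: "C \<in> sets vicsek_mu"
    and m: "emeasure vicsek_mu A = ennreal m" "emeasure vicsek_mu B = ennreal m" "emeasure vicsek_mu C = ennreal m" "0 < m"
    and c: "\<And>a b::real. 0 \<le> a \<Longrightarrow> 0 \<le> b \<Longrightarrow> (a + b) powr p \<le> c1 * a powr p + c2 * b powr p" "0 \<le> c1" "0 \<le> c2"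
    and p: "0 \<le> p"
  shows "pair_energy p f A C \<le> ennreal c1 * pair_energy p f A B + ennreal c2 * pair_energy p f B C"
proof -
  let ?e = "\<lambda>x y. ennreal (\<bar>f y - f x\<bar> powr p)"
  define G where "G x = (\<integral>\<^sup>+y\<in>B. ?e x y \<partial>vicsek_mu)" for x
  have G[measurable]: "G \<in> borel_measurable vicsek_mu" unfolding G_def by measurable
  have tri: "?e x z \<le> ennreal c1 * ?e x y + ennreal c2 * ?e z y" for x y z
  proof -
    have "\<bar>f z - f x\<bar> powr p \<le> (\<bar>f y - f x\<bar> + \<bar>f y - f z\<bar>) powr p" using p by (intro powr_mono2) auto
    also have "\<dots> \<le> c1 * \<bar>f y - f x\<bar> powr p + c2 * \<bar>f y - f z\<bar> powr p" by (rule c(1)) auto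
    finally show ?thesis using c by (simp add: ennreal_mult'[symmetric] ennreal_plus[symmetric] del: ennreal_plus)
  qed
  have pt: "ennreal m * ?e x z \<le> ennreal c1 * G x + ennreal c2 * G z" for x z
  proof -
    have "ennreal m * ?e x z = (\<integral>\<^sup>+y\<in>B. ?e x z \<partial>vicsek_mu)"
      by (subst nn_integral_cmult_indicator) (auto simp: m mult.commute)
    also have "\<dots> \<le> (\<integral>\<^sup>+y. ennreal c1 * (?e x y * indicator B y) + ennreal c2 * (?e z y * indicator B y) \<partial>vicsek_mu)"
      using tri[where x=x and z=z] by (intro nn_integral_mono) (simp split: split_indicator)
    also have "\<dots> = ennreal c1 * G x + ennreal c2 * G z"
      unfolding G_def by (subst nn_integral_add) (auto simp: nn_integral_cmult)
    finally show ?thesis .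
  qed
  have "ennreal m * pair_energy p f A C = (\<integral>\<^sup>+x. ennreal m * ((\<integral>\<^sup>+z\<in>C. ?e x z \<partial>vicsek_mu) * indicator A x) \<partial>vicsek_mu)"
    unfolding pair_energy_def by (rule nn_integral_cmult[symmetric]) measurable
  also have "\<dots> = (\<integral>\<^sup>+x. (\<integral>\<^sup>+z. ennreal m * (?e x z * indicator C z) \<partial>vicsek_mu) * indicator A x \<partial>vicsek_mu)"
    by (intro nn_integral_cong) (subst nn_integral_cmult, auto simp: mult.assoc)
  also have "\<dots> \<le> (\<integral>\<^sup>+x. (\<integral>\<^sup>+z. (ennreal c1 * G x) * indicator C z + ennreal c2 * (G z * indicator C z) \<partial>vicsek_mu) * indicator A x \<partial>vicsek_mu)"
    using pt by (intro nn_integral_mono mult_right_mono) (auto split: split_indicator)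
  also have "\<dots> = (\<integral>\<^sup>+x. (ennreal c1 * G x * ennreal m + ennreal c2 * (\<integral>\<^sup>+z\<in>C. G z \<partial>vicsek_mu)) * indicator A x \<partial>vicsek_mu)"
    by (intro nn_integral_cong arg_cong2[of _ _ _ _ "(*)"] refl)
      (subst nn_integral_add, auto simp: nn_integral_cmult_indicator nn_integral_cmult m)
  also have "\<dots> = (\<integral>\<^sup>+x. (ennreal c1 * ennreal m) * (G x * indicator A x) + ennreal c2 * (\<integral>\<^sup>+z\<in>C. G z \<partial>vicsek_mu) * indicator A x \<partial>vicsek_mu)"
    by (intro nn_integral_cong) (auto simp: algebra_simps)
  also have "\<dots> = (ennreal c1 * ennreal m) * (\<integral>\<^sup>+x\<in>A. G x \<partial>vicsek_mu) + ennreal c2 * (\<integral>\<^sup>+z\<in>C. G z \<partial>vicsek_mu) * ennreal m"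
    by (subst nn_integral_add) (auto simp: nn_integral_cmult_indicator nn_integral_cmult m)
  also have "(\<integral>\<^sup>+x\<in>A. G x \<partial>vicsek_mu) = pair_energy p f A B" by (simp add: pair_energy_def G_def)
  also have "(\<integral>\<^sup>+z\<in>C. G z \<partial>vicsek_mu) = pair_energy p f B C"
    using pair_energy_commute[OF f C B, of p] by (simp add: pair_energy_def G_def)
  finally have "ennreal m * pair_energy p f A C \<le> ennreal m * (ennreal c1 * pair_energy p f A B + ennreal c2 * pair_energy p f B C)"
    by (simp add: algebra_simps)
  then show ?thesis using m(4) by (simp add: ennreal_mult_le_mult_iff)
qed

lemma pair_energy_cover:
  assumes [measurable]: "f \<in> borel_measurable vicsek_mu"
    and I: "finite I" "finite J" "A \<subseteq> (\<Union>i\<in>I. P i)" "B \<subseteq> (\<Union>j\<in>J. Q j)"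
    and m: "\<And>i. i \<in> I \<Longrightarrow> P i \<in> sets vicsek_mu" "\<And>j. j \<in> J \<Longrightarrow> Q j \<in> sets vicsek_mu"
  shows "pair_energy p f A B \<le> (\<Sum>i\<in>I. \<Sum>j\<in>J. pair_energy p f (P i) (Q j))"
proof -
  let ?e = "\<lambda>x y. ennreal (\<bar>f y - f x\<bar> powr p)"
  have ind: "indicator A x \<le> (\<Sum>i\<in>I. indicator (P i) x :: ennreal)"
    if fin: "finite I" and sub: "A \<subseteq> (\<Union>i\<in>I. P i)" for x and I :: "'c set" and A :: "(real^2) set" and P
  proof (cases "x \<in> A")
    case True
    then obtain i where i: "i \<in> I" "x \<in> P i" using subsetD[OF sub] by blast
    have "indicator (P i) x \<le> (\<Sum>i\<in>I. indicator (P i) x :: ennreal)" using i fin by (intro member_le_sum) auto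
    then show ?thesis using True i by simp
  qed simp
  have "pair_energy p f A B \<le> (\<integral>\<^sup>+x. (\<integral>\<^sup>+y. ?e x y * (\<Sum>j\<in>J. indicator (Q j) y) \<partial>vicsek_mu) * (\<Sum>i\<in>I. indicator (P i) x) \<partial>vicsek_mu)"
    unfolding pair_energy_def by (intro nn_integral_mono mult_mono ind I) auto
  also have "\<dots> = (\<integral>\<^sup>+x. (\<Sum>i\<in>I. \<Sum>j\<in>J. (\<integral>\<^sup>+y\<in>Q j. ?e x y \<partial>vicsek_mu) * indicator (P i) x) \<partial>vicsek_mu)"
  proof (rule nn_integral_cong)
    fix x
    have "(\<integral>\<^sup>+y. ?e x y * (\<Sum>j\<in>J. indicator (Q j) y) \<partial>vicsek_mu) = (\<Sum>j\<in>J. (\<integral>\<^sup>+y\<in>Q j. ?e x y \<partial>vicsek_mu))"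
      unfolding sum_distrib_left by (rule nn_integral_sum) (use m in measurable)
    then show "(\<integral>\<^sup>+y. ?e x y * (\<Sum>j\<in>J. indicator (Q j) y) \<partial>vicsek_mu) * (\<Sum>i\<in>I. indicator (P i) x) =
      (\<Sum>i\<in>I. \<Sum>j\<in>J. (\<integral>\<^sup>+y\<in>Q j. ?e x y \<partial>vicsek_mu) * indicator (P i) x)"
      by (simp add: sum_product sum.swap[of _ I J])
  qed
  also have "\<dots> = (\<Sum>i\<in>I. \<Sum>j\<in>J. pair_energy p f (P i) (Q j))"
    unfolding pair_energy_def by (subst nn_integral_sum, use m in measurable) (intro sum.cong refl nn_integral_sum, use m in measurable)
  finally show ?thesis .
qed

text \<open>The prefactor replaces the reciprocal of the measure of a ball in
  \<open>vicsek_E\<close>: balls of radius about \<open>3 ^ (- n)\<close> have mass about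
  \<open>5 ^ (- n)\<close>.\<close>

definition cell_energy :: "real \<Rightarrow> (real^2 \<Rightarrow> real) \<Rightarrow> nat \<Rightarrow> ennreal" where
  "cell_energy p f n = 5 ^ n * (\<Sum>w\<in>words n. \<Sum>w'\<in>nbrs n w. pair_energy p f (vicsek_cell w) (vicsek_cell w'))"

text \<open>The weight under which the sum over pairs of cells becomes a single double integral. It
  is at least \<open>1\<close> near the diagonal, at most \<open>4\<close>, and zero far away, and
  this is all that the comparison with balls uses.\<close>

definition multiplicity_pair :: "nat \<Rightarrow> real^2 \<Rightarrow> real^2 \<Rightarrow> ennreal" where
  "multiplicity_pair n x y = (\<Sum>w\<in>words n. \<Sum>w'\<in>nbrs n w. indicator (vicsek_cell w) x * indicator (vicsek_cell w') y)"

lemma nbrs_words: "w' \<in> nbrs n w \<Longrightarrow> w' \<in> words n" by (simp add: nbrs_def)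

lemma cell_energy_eq:
  assumes [measurable]: "f \<in> borel_measurable vicsek_mu"
  shows "cell_energy p f n =
    (\<integral>\<^sup>+x. (\<integral>\<^sup>+y. 5 ^ n * multiplicity_pair n x y * ennreal (\<bar>f y - f x\<bar> powr p) \<partial>vicsek_mu) \<partial>vicsek_mu)"
proof -
  let ?e = "\<lambda>x y. ennreal (\<bar>f y - f x\<bar> powr p)"
  note [measurable] = cell_sets cell_sets[OF nbrs_words]
  have "cell_energy p f n = 5 ^ n * (\<Sum>w\<in>words n. \<integral>\<^sup>+x. (\<Sum>w'\<in>nbrs n w. (\<integral>\<^sup>+y\<in>vicsek_cell w'. ?e x y \<partial>vicsek_mu) * indicator (vicsek_cell w) x) \<partial>vicsek_mu)"
    unfolding cell_energy_def pair_energy_def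
    by (intro arg_cong2[of _ _ _ _ "(*)"] refl sum.cong nn_integral_sum[symmetric]) measurable
  also have "\<dots> = 5 ^ n * (\<integral>\<^sup>+x. (\<Sum>w\<in>words n. \<Sum>w'\<in>nbrs n w. (\<integral>\<^sup>+y\<in>vicsek_cell w'. ?e x y \<partial>vicsek_mu) * indicator (vicsek_cell w) x) \<partial>vicsek_mu)"
    by (intro arg_cong2[of _ _ _ _ "(*)"] refl nn_integral_sum[symmetric]) measurable
  also have "\<dots> = (\<integral>\<^sup>+x. 5 ^ n * (\<Sum>w\<in>words n. \<Sum>w'\<in>nbrs n w. (\<integral>\<^sup>+y\<in>vicsek_cell w'. ?e x y \<partial>vicsek_mu) * indicator (vicsek_cell w) x) \<partial>vicsek_mu)"
    by (rule nn_integral_cmult[symmetric]) measurable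
  also have "\<dots> = (\<integral>\<^sup>+x. (\<integral>\<^sup>+y. 5 ^ n * multiplicity_pair n x y * ?e x y \<partial>vicsek_mu) \<partial>vicsek_mu)"
  proof (rule nn_integral_cong)
    fix x
    have "(\<integral>\<^sup>+y. 5 ^ n * multiplicity_pair n x y * ?e x y \<partial>vicsek_mu)
       = (\<integral>\<^sup>+y. 5 ^ n * (\<Sum>w\<in>words n. \<Sum>w'\<in>nbrs n w. (?e x y * indicator (vicsek_cell w') y) * indicator (vicsek_cell w) x) \<partial>vicsek_mu)"
      unfolding multiplicity_pair_def mult.assoc sum_distrib_right
      by (intro nn_integral_cong arg_cong[of _ _ "(*) (5 ^ n)"] sum.cong refl) (simp only: ac_simps)
    also have "\<dots> = 5 ^ n * (\<Sum>w\<in>words n. \<Sum>w'\<in>nbrs n w. (\<integral>\<^sup>+y\<in>vicsek_cell w'. ?e x y \<partial>vicsek_mu) * indicator (vicsek_cell w) x)"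
    proof -
      let ?t = "\<lambda>w w' y. (?e x y * indicator (vicsek_cell w') y) * indicator (vicsek_cell w) x"
      have "(\<integral>\<^sup>+y. 5 ^ n * (\<Sum>w\<in>words n. \<Sum>w'\<in>nbrs n w. ?t w w' y) \<partial>vicsek_mu)
        = 5 ^ n * (\<integral>\<^sup>+y. (\<Sum>w\<in>words n. \<Sum>w'\<in>nbrs n w. ?t w w' y) \<partial>vicsek_mu)"
        by (rule nn_integral_cmult) measurable
      also have "(\<integral>\<^sup>+y. (\<Sum>w\<in>words n. \<Sum>w'\<in>nbrs n w. ?t w w' y) \<partial>vicsek_mu)
        = (\<Sum>w\<in>words n. \<integral>\<^sup>+y. (\<Sum>w'\<in>nbrs n w. ?t w w' y) \<partial>vicsek_mu)"
        by (rule nn_integral_sum) measurable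
      also have "\<dots> = (\<Sum>w\<in>words n. \<Sum>w'\<in>nbrs n w. (\<integral>\<^sup>+y. ?t w w' y \<partial>vicsek_mu))"
        by (intro sum.cong refl nn_integral_sum) measurable
      also have "\<dots> = (\<Sum>w\<in>words n. \<Sum>w'\<in>nbrs n w. (\<integral>\<^sup>+y\<in>vicsek_cell w'. ?e x y \<partial>vicsek_mu) * indicator (vicsek_cell w) x)"
        by (intro sum.cong refl nn_integral_multc) measurable
      finally show ?thesis .
    qed
    finally show "5 ^ n * (\<Sum>w\<in>words n. \<Sum>w'\<in>nbrs n w. (\<integral>\<^sup>+y\<in>vicsek_cell w'. ?e x y \<partial>vicsek_mu) * indicator (vicsek_cell w) x) =
      (\<integral>\<^sup>+y. 5 ^ n * multiplicity_pair n x y * ?e x y \<partial>vicsek_mu)" ..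
  qed
  finally show ?thesis .
qed

section \<open>Comparison of the cell energies with the integrals over balls\<close>

lemma sum_indicator_cells:
  "(\<Sum>w\<in>words n. indicator (vicsek_cell w) x :: ennreal) = of_nat (card {w \<in> words n. x \<in> vicsek_cell w})"
  by (simp add: indicator_def sum.If_cases Int_def)

lemma sum_indicator_cells_le: "x \<in> vicsek_K \<Longrightarrow> (\<Sum>w\<in>words n. indicator (vicsek_cell w) x :: ennreal) \<le> 2"
  unfolding sum_indicator_cells using card_cells_at_point[of x n] by (metis of_nat_le_iff of_nat_numeral)

lemma multiplicity_pair_le:
  assumes "x \<in> vicsek_K" "y \<in> vicsek_K"
  shows "multiplicity_pair n x y \<le> 4"
proof -
  have "multiplicity_pair n x y \<le> (\<Sum>w\<in>words n. \<Sum>w'\<in>words n. indicator (vicsek_cell w) x * indicator (vicsek_cell w') y)"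
    unfolding multiplicity_pair_def by (intro sum_mono sum_mono2) (auto simp: nbrs_def)
  also have "\<dots> = (\<Sum>w\<in>words n. indicator (vicsek_cell w) x) * (\<Sum>w'\<in>words n. indicator (vicsek_cell w') y)"
    by (simp add: sum_product)
  also have "\<dots> \<le> 2 * 2" using assms by (intro mult_mono sum_indicator_cells_le) auto
  finally show ?thesis by simp
qed

text \<open>Points in two intersecting cells are joined through a common point of the cells, each of
  which has diameter at most \<open>2 / 3 ^ n\<close>.\<close>

lemma multiplicity_pair_zero:
  assumes "x \<in> vicsek_K" "y \<in> vicsek_K" "4 / 3 ^ n < vicsek_dist x y"
  shows "multiplicity_pair n x y = 0"
proof -
  have "indicator (vicsek_cell w) x * indicator (vicsek_cell w') y = (0::ennreal)"
    if w: "w \<in> words n" "w' \<in> nbrs n w" for w w'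
  proof (rule ccontr)
    assume "indicator (vicsek_cell w) x * indicator (vicsek_cell w') y \<noteq> (0::ennreal)"
    then have xy: "x \<in> vicsek_cell w" "y \<in> vicsek_cell w'" by (auto simp: indicator_def split: if_splits)
    obtain z where z: "z \<in> vicsek_cell w" "z \<in> vicsek_cell w'" using w(2) by (auto simp: nbrs_def)
    have "vicsek_dist x y \<le> vicsek_dist x z + vicsek_dist z y"
      using vicsek_dist_triangle assms z cell_K w by blast
    also have "\<dots> \<le> 2 / 3 ^ n + 2 / 3 ^ n"
      by (intro add_mono cell_dist_le[OF w(1) xy(1) z(1)] cell_dist_le[OF nbrs_words[OF w(2)] z(2) xy(2)])
    finally show False using assms(3) by simp
  qed
  then show ?thesis unfolding multiplicity_pair_def by (intro sum.neutral ballI)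
qed

lemma multiplicity_pair_ge:
  assumes "x \<in> vicsek_K" "y \<in> vicsek_K" "n = 0 \<or> vicsek_dist x y < 2 / 3 ^ n"
  shows "1 \<le> multiplicity_pair n x y"
proof -
  obtain w w' where w: "w \<in> words n" "x \<in> vicsek_cell w" "w' \<in> words n" "y \<in> vicsek_cell w'"
    using cell_exists[OF assms(1)] cell_exists[OF assms(2)] by metis
  have "vicsek_cell w \<inter> vicsek_cell w' \<noteq> {}"
  proof (cases "n = 0")
    case True then show ?thesis using w assms by auto
  next
    case False then show ?thesis using disjoint_cells_far[OF w(1,3) _ w(2,4)] assms(3) by fastforce
  qed
  then have n: "w' \<in> nbrs n w" using w by (auto simp: nbrs_def)
  have "1 = indicator (vicsek_cell w) x * (indicator (vicsek_cell w') y :: ennreal)" using w by simp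
  also have "\<dots> \<le> (\<Sum>w'\<in>nbrs n w. indicator (vicsek_cell w) x * indicator (vicsek_cell w') y)"
    using n by (intro member_le_sum) auto
  also have "\<dots> \<le> multiplicity_pair n x y" unfolding multiplicity_pair_def using w(1)
    by (intro member_le_sum[of w "words n"]) auto
  finally show ?thesis .
qed

lemma emeasure_ball_ge:
  assumes "x \<in> vicsek_K" "2 / 3 ^ n \<le> r"
  shows "ennreal ((1/5) ^ n) \<le> emeasure vicsek_mu (vicsek_ball x r)"
proof -
  obtain w where w: "w \<in> words n" "x \<in> vicsek_cell w" using cell_exists[OF assms(1)] by metis
  have "vicsek_cell w \<subseteq> vicsek_ball x r"
    using cell_dist_le[OF w] cell_K[OF w(1)] assms(2) by (fastforce simp: vicsek_ball_def)
  then have "emeasure vicsek_mu (vicsek_cell w) \<le> emeasure vicsek_mu (vicsek_ball x r)"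
    by (intro emeasure_mono vicsek_ball_sets assms)
  then show ?thesis using emeasure_cell[OF w(1)] by simp
qed

text \<open>Two generations up the radius is below the separation of disjoint cells, so the ball is
  covered by at most \<open>8\<close> cells of mass \<open>25 * (1/5) ^ n\<close>; this gives
  \<open>200\<close>. For \<open>n < 2\<close> the bound exceeds \<open>1\<close>.\<close>

lemma emeasure_ball_le:
  assumes x: "x \<in> vicsek_K"
  shows "emeasure vicsek_mu (vicsek_ball x (4 / 3 ^ n)) \<le> ennreal (200 * (1/5) ^ n)"
proof (cases "n < 2")
  case True
  then have "n = 0 \<or> n = 1" by auto
  then have "1 \<le> 200 * (1/5::real) ^ n" by auto
  then have "ennreal 1 \<le> ennreal (200 * (1/5) ^ n)" by (rule ennreal_leI)
  moreover have "emeasure vicsek_mu (vicsek_ball x (4 / 3 ^ n)) \<le> ennreal 1" using mu.emeasure_le_1 by simp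
  ultimately show ?thesis by (rule order_trans[rotated])
next
  case False
  then obtain m where m: "n = m + 2" using add.commute le_Suc_ex by (metis not_less)
  obtain w where w: "w \<in> words m" "x \<in> vicsek_cell w" using cell_exists[OF x] by metis
  have sub: "vicsek_ball x (4 / 3 ^ n) \<subseteq> (\<Union>w'\<in>nbrs m w. vicsek_cell w')"
  proof
    fix y assume y: "y \<in> vicsek_ball x (4 / 3 ^ n)"
    then have yK: "y \<in> vicsek_K" and d: "vicsek_dist x y \<le> 4 / 3 ^ n" by (auto simp: vicsek_ball_def)
    have "4 / 3 ^ n < 2 / (3::real) ^ m" by (simp add: m field_simps power_add)
    with d have d: "vicsek_dist x y < 2 / 3 ^ m" by linarith
    obtain w' where w': "w' \<in> words m" "y \<in> vicsek_cell w'" using cell_exists[OF yK] by metis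
    have "vicsek_cell w \<inter> vicsek_cell w' \<noteq> {}" using disjoint_cells_far[OF w(1) w'(1) _ w(2) w'(2)] d by fastforce
    then show "y \<in> (\<Union>w'\<in>nbrs m w. vicsek_cell w')" using w' by (auto simp: nbrs_def)
  qed
  have s: "vicsek_cell w' \<in> sets vicsek_mu" if "w' \<in> nbrs m w" for w' using cell_sets nbrs_words that by blast
  have "emeasure vicsek_mu (vicsek_ball x (4 / 3 ^ n)) \<le> emeasure vicsek_mu (\<Union>w'\<in>nbrs m w. vicsek_cell w')"
    by (rule emeasure_mono[OF sub]) (use s in auto)
  also have "\<dots> \<le> (\<Sum>w'\<in>nbrs m w. emeasure vicsek_mu (vicsek_cell w'))"
    by (rule emeasure_subadditive_finite) (use s in auto)
  also have "\<dots> = (\<Sum>w'\<in>nbrs m w. ennreal ((1/5) ^ m))" using emeasure_cell nbrs_words by (intro sum.cong) auto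
  also have "\<dots> = ennreal (real (card (nbrs m w)) * (1/5) ^ m)" by (simp add: ennreal_mult ennreal_of_nat_eq_real_of_nat)
  also have "\<dots> \<le> ennreal (8 * (1/5) ^ m)"
    using card_nbrs[OF w(1)] by (intro ennreal_leI mult_right_mono) auto
  also have "8 * (1/5) ^ m = 200 * (1/5::real) ^ n" by (simp add: m power_add)
  finally show ?thesis .
qed

text \<open>The constant \<open>800\<close> is the multiplicity bound \<open>4\<close> times the
  mass bound \<open>200\<close>; the radius \<open>4 / 3 ^ n\<close> is the reach of two
  intersecting cells.\<close>

lemma cell_energy_le_E:
  assumes f: "f \<in> borel_measurable vicsek_mu"
  shows "cell_energy p f n \<le> 800 * vicsek_E p f (4 / 3 ^ n)"
proof -
  let ?e = "\<lambda>x y. ennreal (\<bar>f y - f x\<bar> powr p)" and ?B = "\<lambda>x. vicsek_ball x (4 / 3 ^ n)"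
  have pt: "5 ^ n * multiplicity_pair n x y * ?e x y \<le> 800 * (?e x y / emeasure vicsek_mu (?B x) * indicator (?B x) y)"
    if x: "x \<in> vicsek_K" and y: "y \<in> vicsek_K" for x y
  proof (cases "y \<in> ?B x")
    case False
    then show ?thesis using multiplicity_pair_zero[OF x y] y by (simp add: vicsek_ball_def)
  next
    case True
    define b where "b = measure vicsek_mu (?B x)"
    have eb: "emeasure vicsek_mu (?B x) = ennreal b" by (simp add: b_def mu.emeasure_eq_measure)
    have b: "b \<le> 200 * (1/5) ^ n" using emeasure_ball_le[OF x, of n] eb by simp
    have "ennreal ((1/5) ^ n) \<le> ennreal b" using emeasure_ball_ge[OF x, of n "4 / 3 ^ n"] eb by (simp add: divide_right_mono)
    moreover have "0 < (1/5::real) ^ n" by simp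
    ultimately have b0: "0 < b" by (metis ennreal_le_iff2 less_le_trans not_le)
    have "5 ^ n * multiplicity_pair n x y * ?e x y \<le> 5 ^ n * 4 * ?e x y"
      by (intro mult_mono multiplicity_pair_le x y) auto
    also have "\<dots> = ennreal (5 ^ n * 4 * \<bar>f y - f x\<bar> powr p)" by (simp add: ennreal_mult ennreal_power[symmetric])
    also have "\<dots> \<le> ennreal (800 * (\<bar>f y - f x\<bar> powr p / b))"
    proof (rule ennreal_leI)
      have "5 ^ n * b \<le> 200" using b by (simp add: power_one_over field_simps)
      then have "5 ^ n * 4 \<le> 800 / b" using b0 by (simp add: field_simps)
      then have "5 ^ n * 4 * \<bar>f y - f x\<bar> powr p \<le> 800 / b * \<bar>f y - f x\<bar> powr p" by (intro mult_right_mono) auto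
      then show "5 ^ n * 4 * \<bar>f y - f x\<bar> powr p \<le> 800 * (\<bar>f y - f x\<bar> powr p / b)" by simp
    qed
    also have "\<dots> = 800 * (?e x y / emeasure vicsek_mu (?B x) * indicator (?B x) y)"
    proof -
      have "ennreal (800 * X) = 800 * ennreal X" for X by (simp add: ennreal_mult')
      then show ?thesis using b0 True by (simp only: eb divide_ennreal indicator_simps mult_1_right powr_ge_zero)
    qed
    finally show ?thesis .
  qed
  note [measurable] = f cell_sets cell_sets[OF nbrs_words]
  let ?J = "\<lambda>x. \<integral>\<^sup>+y. 5 ^ n * multiplicity_pair n x y * ?e x y \<partial>vicsek_mu"
  \<comment> \<open>The constant is moved to the side of the cell energy, whose integrand is known
    to be measurable. Taking it out of \<open>vicsek_E\<close> would require measurability of the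
    mean over a ball as a function of its centre.\<close>
  have c: "800 * ennreal (1/800) = 1" by (simp add: ennreal_mult'[symmetric] flip: ennreal_numeral)
  have "ennreal (1/800) * cell_energy p f n = (\<integral>\<^sup>+x. ennreal (1/800) * ?J x \<partial>vicsek_mu)"
    unfolding cell_energy_eq[OF f] multiplicity_pair_def by (rule nn_integral_cmult[symmetric]) measurable
  also have "\<dots> \<le> vicsek_E p f (4 / 3 ^ n)"
    unfolding vicsek_E_def
  proof (rule nn_integral_mono)
    fix x assume "x \<in> space vicsek_mu"
    then have x: "x \<in> vicsek_K" by simp
    have [measurable]: "?B x \<in> sets vicsek_mu" by (rule vicsek_ball_sets[OF x])
    have "?J x \<le> (\<integral>\<^sup>+y. 800 * (?e x y / emeasure vicsek_mu (?B x) * indicator (?B x) y) \<partial>vicsek_mu)"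
      by (rule nn_integral_mono) (use pt x in simp)
    also have "\<dots> = 800 * (\<integral>\<^sup>+y\<in>?B x. ?e x y / emeasure vicsek_mu (?B x) \<partial>vicsek_mu)"
      by (rule nn_integral_cmult) measurable
    finally have "ennreal (1/800) * ?J x \<le> ennreal (1/800) * (800 * (\<integral>\<^sup>+y\<in>?B x. ?e x y / emeasure vicsek_mu (?B x) \<partial>vicsek_mu))"
      by (rule mult_left_mono) simp
    also have "\<dots> = (800 * ennreal (1/800)) * (\<integral>\<^sup>+y\<in>?B x. ?e x y / emeasure vicsek_mu (?B x) \<partial>vicsek_mu)"
      by (simp only: ac_simps)
    finally show "ennreal (1/800) * ?J x \<le> (\<integral>\<^sup>+y\<in>?B x. ?e x y / emeasure vicsek_mu (?B x) \<partial>vicsek_mu)"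
      by (simp only: c mult_1_left)
  qed
  finally have "800 * (ennreal (1/800) * cell_energy p f n) \<le> 800 * vicsek_E p f (4 / 3 ^ n)"
    by (rule mult_left_mono) simp
  then show ?thesis by (simp only: mult.assoc[symmetric] c mult_1_left)
qed

text \<open>For large \<open>r\<close> the index is \<open>n = 0\<close>, when any two points lie in a common cell.\<close>

lemma E_le_cell_energy:
  assumes f: "f \<in> borel_measurable vicsek_mu" and r: "0 < r"
  obtains n where "2 / 3 ^ Suc n \<le> r" "vicsek_E p f r \<le> 5 * cell_energy p f n"
proof -
  \<comment> \<open>Balls contain a cell of generation \<open>Suc n\<close>, which bounds their mass
    from below, while for \<open>n > 0\<close> their radius is below the separation of generation
    \<open>n\<close>. The gap of one generation is the factor \<open>5\<close>.\<close>
  define n where "n = (LEAST n. 2 / 3 ^ Suc n \<le> r)"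
  obtain k where "(1/3::real) ^ k < r" using real_arch_pow_inv[OF r, of "1/3"] by auto
  then have "2 / 3 ^ Suc k \<le> r" by (simp add: power_one_over field_simps)
  then have n: "2 / 3 ^ Suc n \<le> r" unfolding n_def by (rule LeastI)
  have n0: "n = 0 \<or> r < 2 / 3 ^ n"
  proof (cases n)
    case (Suc m)
    then have "m < n" by simp
    then have "\<not> 2 / 3 ^ Suc m \<le> r" unfolding n_def by (rule not_less_Least)
    then show ?thesis using Suc by simp
  qed simp
  let ?e = "\<lambda>x y. ennreal (\<bar>f y - f x\<bar> powr p)" and ?B = "\<lambda>x. vicsek_ball x r"
  have pt: "?e x y / emeasure vicsek_mu (?B x) * indicator (?B x) y \<le> 5 * (5 ^ n * multiplicity_pair n x y * ?e x y)"
    if x: "x \<in> vicsek_K" and y: "y \<in> vicsek_K" for x y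
  proof (cases "y \<in> ?B x")
    case False then show ?thesis by simp
  next
    case True
    then have "n = 0 \<or> vicsek_dist x y < 2 / 3 ^ n" using n0 by (auto simp: vicsek_ball_def)
    then have m: "1 \<le> multiplicity_pair n x y" using multiplicity_pair_ge[OF x y] by blast
    define b where "b = measure vicsek_mu (?B x)"
    have eb: "emeasure vicsek_mu (?B x) = ennreal b" by (simp add: b_def mu.emeasure_eq_measure)
    have "ennreal ((1/5) ^ Suc n) \<le> ennreal b" using emeasure_ball_ge[OF x n] eb by simp
    then have b: "(1/5) ^ Suc n \<le> b" by (subst (asm) ennreal_le_iff) (auto simp: b_def)
    moreover have p5: "0 < (1/5::real) ^ Suc n" by simp
    ultimately have b0: "0 < b" by linarith
    have "?e x y / emeasure vicsek_mu (?B x) * indicator (?B x) y = ennreal (\<bar>f y - f x\<bar> powr p / b)"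
      using b0 True by (simp add: eb divide_ennreal)
    also have "\<dots> \<le> ennreal (5 * 5 ^ n * \<bar>f y - f x\<bar> powr p)"
    proof (rule ennreal_leI)
      have "1 / b \<le> 5 * 5 ^ n" using b b0 by (simp add: power_one_over field_simps)
      then have "1 / b * \<bar>f y - f x\<bar> powr p \<le> 5 * 5 ^ n * \<bar>f y - f x\<bar> powr p" by (intro mult_right_mono) auto
      then show "\<bar>f y - f x\<bar> powr p / b \<le> 5 * 5 ^ n * \<bar>f y - f x\<bar> powr p" by simp
    qed
    also have "\<dots> = 5 * (5 ^ n * 1 * ?e x y)" by (simp add: ennreal_mult ennreal_power[symmetric] mult.assoc)
    also have "\<dots> \<le> 5 * (5 ^ n * multiplicity_pair n x y * ?e x y)" using m by (intro mult_mono) auto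
    finally show ?thesis .
  qed
  have "vicsek_E p f r \<le> (\<integral>\<^sup>+x. 5 * (\<integral>\<^sup>+y. 5 ^ n * multiplicity_pair n x y * ?e x y \<partial>vicsek_mu) \<partial>vicsek_mu)"
    unfolding vicsek_E_def
  proof (rule nn_integral_mono)
    fix x assume "x \<in> space vicsek_mu"
    then have x: "x \<in> vicsek_K" by simp
    note [measurable] = f cell_sets cell_sets[OF nbrs_words]
    have "(\<integral>\<^sup>+y\<in>?B x. ?e x y / emeasure vicsek_mu (?B x) \<partial>vicsek_mu) \<le> (\<integral>\<^sup>+y. 5 * (5 ^ n * multiplicity_pair n x y * ?e x y) \<partial>vicsek_mu)"
      by (rule nn_integral_mono) (use pt x in simp)
    also have "\<dots> = 5 * (\<integral>\<^sup>+y. 5 ^ n * multiplicity_pair n x y * ?e x y \<partial>vicsek_mu)"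
      unfolding multiplicity_pair_def by (rule nn_integral_cmult) measurable
    finally show "(\<integral>\<^sup>+y\<in>?B x. ?e x y / emeasure vicsek_mu (?B x) \<partial>vicsek_mu) \<le>
      5 * (\<integral>\<^sup>+y. 5 ^ n * multiplicity_pair n x y * ?e x y \<partial>vicsek_mu)" .
  qed
  also have "\<dots> = 5 * cell_energy p f n"
    unfolding cell_energy_eq[OF f] multiplicity_pair_def
    by (rule nn_integral_cmult) (use f cell_sets cell_sets[OF nbrs_words] in measurable)
  finally show ?thesis using that n by blast
qed

subsection \<open>Monotonicity of the cell energies\<close>

definition chain_sum :: "nat \<Rightarrow> (nat list \<Rightarrow> nat list \<Rightarrow> ennreal) \<Rightarrow> ennreal" where
  "chain_sum k G = (\<Sum>v\<in>words k. \<Sum>v'\<in>nbrs k v. G v v')"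

text \<open>A bound \<open>l powr (p - 1) * S\<close>, with \<open>l\<close> the length of a chain of cells and \<open>S\<close> the energy of its steps, is
  additive in \<open>l\<close> and \<open>S\<close> under concatenation of chains; the weights are those of Hoelder's inequality.\<close>

definition weighted_triangle :: "real \<Rightarrow> nat \<Rightarrow> (nat list \<Rightarrow> nat list \<Rightarrow> ennreal) \<Rightarrow> bool" where
  "weighted_triangle p k G \<longleftrightarrow> (\<forall>u\<in>words k. \<forall>v\<in>words k. \<forall>w\<in>words k. \<forall>s>0. \<forall>t>0.
     G u w \<le> ennreal (((s + t) / s) powr (p - 1)) * G u v + ennreal (((s + t) / t) powr (p - 1)) * G v w)"

text \<open>With the weights \<open>s = l1\<close> and \<open>t = l2\<close> the ratios cancel the
  powers of the lengths accumulated so far, and only the total length remains.\<close>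

lemma weighted_triangle_chain:
  assumes G: "weighted_triangle p k G" and uvw: "u \<in> words k" "v \<in> words k" "w \<in> words k"
    and l: "0 < l1" "0 < l2"
    and 1: "G u v \<le> ennreal (l1 powr (p - 1)) * S1" and 2: "G v w \<le> ennreal (l2 powr (p - 1)) * S2"
  shows "G u w \<le> ennreal ((l1 + l2) powr (p - 1)) * (S1 + S2)"
proof -
  have e: "ennreal (((l1 + l2) / l) powr (p - 1)) * (ennreal (l powr (p - 1)) * S) = ennreal ((l1 + l2) powr (p - 1)) * S"
    if "0 < l" for l S
  proof -
    have "((l1 + l2) / l) powr (p - 1) * l powr (p - 1) = (l1 + l2) powr (p - 1)"
      using that l by (simp add: powr_mult[symmetric])
    then show ?thesis by (simp add: mult.assoc[symmetric] ennreal_mult[symmetric])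
  qed
  have "G u w \<le> ennreal (((l1 + l2) / l1) powr (p - 1)) * G u v + ennreal (((l1 + l2) / l2) powr (p - 1)) * G v w"
    using G uvw l by (auto simp: weighted_triangle_def)
  also have "\<dots> \<le> ennreal (((l1 + l2) / l1) powr (p - 1)) * (ennreal (l1 powr (p - 1)) * S1)
      + ennreal (((l1 + l2) / l2) powr (p - 1)) * (ennreal (l2 powr (p - 1)) * S2)"
    by (intro add_mono mult_left_mono 1 2) auto
  also have "\<dots> = ennreal ((l1 + l2) powr (p - 1)) * (S1 + S2)"
    by (simp only: e[OF l(1)] e[OF l(2)] distrib_left)
  finally show ?thesis .
qed

lemma replicate_cell: "a \<in> {1..5} \<Longrightarrow> vicsek_q a \<in> vicsek_cell (replicate n a)"
proof (induction n)
  case 0 then show ?case by (simp add: cell_simps q_K)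
next
  case (Suc n)
  then have "vicsek_psi a (vicsek_q a) \<in> vicsek_cell (replicate (Suc n) a)" by (simp add: cell_simps del: psi_q)
  then show ?case by simp
qed

lemma nbrs_append:
  assumes "w \<in> words n" "v' \<in> nbrs k v" shows "w @ v' \<in> nbrs (n + k) (w @ v)"
  using assms words_append[OF assms(1) nbrs_words[OF assms(2)]] by (auto simp: nbrs_def cell_simps)

lemma nbrs_Cons: "i \<in> {1..5} \<Longrightarrow> v' \<in> nbrs k v \<Longrightarrow> i # v' \<in> nbrs (Suc k) (i # v)"
  using nbrs_append[of "[i]" 1 v' k v] by (simp add: words_def)

text \<open>The pairs inside one first-generation cell and the crossings of the four junctions, in
  both directions, are distinct terms of the sum on the right. At junction \<open>a\<close> the
  crossing joins the subcells at the two corners that meet there.\<close>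

lemma chain_sum_Suc_ge:
  "(\<Sum>i\<in>{1..5}. chain_sum k (\<lambda>v v'. G (i # v) (i # v')))
   + (\<Sum>a\<in>{1..4}. G (a # replicate k (opp a)) (5 # replicate k a))
   + (\<Sum>a\<in>{1..4}. G (5 # replicate k a) (a # replicate k (opp a))) \<le> chain_sum (Suc k) G"
proof -
  define g where "g = (\<lambda>(v, v'). G v v')"
  define P where "P = (SIGMA v:words (Suc k). nbrs (Suc k) v)"
  define I1 where "I1 = (SIGMA i:{1..5::nat}. SIGMA v:words k. nbrs k v)"
  define f1 where "f1 = (\<lambda>(i::nat, v, v'). (i # v, i # v'))"
  define f2 where "f2 = (\<lambda>a. (a # replicate k (opp a), 5 # replicate k a))"
  define f3 where "f3 = (\<lambda>a. (5 # replicate k a, a # replicate k (opp a)))"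
  have c: "chain_sum (Suc k) G = sum g P" unfolding chain_sum_def P_def g_def by (simp add: sum.Sigma)
  have finP: "finite P" "finite I1" unfolding P_def I1_def by auto
  have 1: "(\<Sum>i\<in>{1..5}. chain_sum k (\<lambda>v v'. G (i # v) (i # v'))) = sum g (f1 ` I1)"
  proof -
    have "inj_on f1 I1" by (auto simp: inj_on_def f1_def)
    then have "sum g (f1 ` I1) = sum (g \<circ> f1) I1" by (rule sum.reindex)
    also have "\<dots> = (\<Sum>i\<in>{1..5}. chain_sum k (\<lambda>v v'. G (i # v) (i # v')))"
      unfolding I1_def chain_sum_def f1_def g_def
      by (simp add: sum.Sigma o_def case_prod_unfold)
    finally show ?thesis ..
  qed
  have 2: "(\<Sum>a\<in>{1..4}. G (a # replicate k (opp a)) (5 # replicate k a)) = sum g (f2 ` {1..4})"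
    by (subst sum.reindex) (auto simp: inj_on_def f2_def g_def)
  have 3: "(\<Sum>a\<in>{1..4}. G (5 # replicate k a) (a # replicate k (opp a))) = sum g (f3 ` {1..4})"
    by (subst sum.reindex) (auto simp: inj_on_def f3_def g_def)
  have d: "f1 ` I1 \<inter> f2 ` {1..4} = {}" "(f1 ` I1 \<union> f2 ` {1..4}) \<inter> f3 ` {1..4} = {}"
    by (auto simp: f1_def f2_def f3_def)
  have adj: "5 # replicate k a \<in> nbrs (Suc k) (a # replicate k (opp a))" if a: "a \<in> {1..4}" for a
  proof -
    have a5: "a \<in> {1..5}" "opp a \<in> {1..5}" using a opp_le4[OF a] by auto
    have "(1/3) *\<^sub>R vicsek_q a \<in> vicsek_cell (a # replicate k (opp a))"
      "(1/3) *\<^sub>R vicsek_q a \<in> vicsek_cell (5 # replicate k a)"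
      using imageI[OF replicate_cell[OF a5(2), of k], of "vicsek_psi a"] imageI[OF replicate_cell[OF a5(1), of k], of "vicsek_psi 5"]
      by (simp_all add: cell_simps psi_opp psi_5)
    then show ?thesis using a5 by (auto simp: nbrs_def words_Cons replicate_words)
  qed
  have "f1 ` I1 \<union> f2 ` {1..4} \<union> f3 ` {1..4} \<subseteq> P"
  proof -
    have "f1 ` I1 \<subseteq> P" unfolding f1_def I1_def P_def by (auto simp: words_Cons intro!: nbrs_Cons)
    moreover have "f2 ` {1..4} \<subseteq> P" "f3 ` {1..4} \<subseteq> P"
    proof -
      have w: "a # replicate k (opp a) \<in> words (Suc k)" "5 # replicate k a \<in> words (Suc k)" if "a \<in> {1..4}" for a
        using that opp_le4[OF that] by (auto simp: words_Cons intro!: replicate_words)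
      show "f2 ` {1..4} \<subseteq> P" "f3 ` {1..4} \<subseteq> P"
        unfolding f2_def f3_def P_def using w adj nbrs_sym[OF w(1) adj] by (simp_all add: image_subset_iff)
    qed
    ultimately show ?thesis by blast
  qed
  then have "sum g (f1 ` I1 \<union> f2 ` {1..4} \<union> f3 ` {1..4}) \<le> sum g P"
    using finP by (intro sum_mono2) auto
  moreover have "sum g (f1 ` I1 \<union> f2 ` {1..4} \<union> f3 ` {1..4}) = sum g (f1 ` I1) + sum g (f2 ` {1..4}) + sum g (f3 ` {1..4})"
    using finP d by (subst sum.union_disjoint, simp, simp, simp, subst sum.union_disjoint) auto
  ultimately show ?thesis unfolding c 1 2 3 by simp
qed

text \<open>The chain follows the tree: at most three cells of the first generation and two
  crossings. Its length satisfies \<open>l (Suc k) = 3 * l k + 2\<close> with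
  \<open>l 0 = 1\<close>, which is solved by \<open>2 * 3 ^ k - 1\<close>. No step is used twice, so
  the sum of energies carries no further factor.\<close>

lemma chain_bound:
  assumes p: "1 \<le> p"
  shows "weighted_triangle p k G \<Longrightarrow> u \<in> words k \<Longrightarrow> u' \<in> words k \<Longrightarrow>
    G u u' \<le> ennreal ((2 * 3 ^ k - 1) powr (p - 1)) * chain_sum k G"
proof (induction k arbitrary: G u u')
  case 0
  have "nbrs 0 [] = {[]}" using nbrs_self[of "[]" 0] by (auto simp: nbrs_def)
  with 0 show ?case by (simp add: chain_sum_def)
next
  case (Suc k)
  let ?L = "2 * 3 ^ k - 1 :: real"
  have L1: "1 \<le> ?L" using one_le_power[of "3::real" k] by simp
  have L3: "0 \<le> ?L + 1 + ?L" "?L + 1 + ?L \<le> 3 * ?L + 2" "0 \<le> ?L + (1 + ?L)" "?L + (1 + ?L) \<le> 3 * ?L + 2"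
    "0 \<le> ?L + 1 + ?L + (1 + ?L)" "?L + 1 + ?L + (1 + ?L) \<le> 3 * ?L + 2"
  proof -
    have *: "0 \<le> L + 1 + L \<and> L + 1 + L \<le> 3 * L + 2 \<and> 0 \<le> L + (1 + L) \<and> L + (1 + L) \<le> 3 * L + 2 \<and>
      0 \<le> L + 1 + L + (1 + L) \<and> L + 1 + L + (1 + L) \<le> 3 * L + 2" if "1 \<le> L" for L :: real
      using that by linarith
    show "0 \<le> ?L + 1 + ?L" "?L + 1 + ?L \<le> 3 * ?L + 2" "0 \<le> ?L + (1 + ?L)" "?L + (1 + ?L) \<le> 3 * ?L + 2"
      "0 \<le> ?L + 1 + ?L + (1 + ?L)" "?L + 1 + ?L + (1 + ?L) \<le> 3 * ?L + 2"
      using *[OF L1] by blast+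
  qed
  have mono: "ennreal (l powr (p - 1)) * S \<le> ennreal ((2 * 3 ^ Suc k - 1) powr (p - 1)) * chain_sum (Suc k) G"
    if "0 \<le> l" "l \<le> 3 * ?L + 2" "S \<le> chain_sum (Suc k) G" for l S
    using that p by (intro mult_mono ennreal_leI powr_mono2) auto
  define T where "T i = chain_sum k (\<lambda>v v'. G (i # v) (i # v'))" for i
  define X where "X a = G (a # replicate k (opp a)) (5 # replicate k a)" for a
  define Y where "Y a = G (5 # replicate k a) (a # replicate k (opp a))" for a
  have S: "sum T {1..5} + sum X {1..4} + sum Y {1..4} \<le> chain_sum (Suc k) G"
    using chain_sum_Suc_ge[of k G] by (simp add: T_def X_def Y_def)
  have IH: "G (i # v) (i # v') \<le> ennreal (?L powr (p - 1)) * T i" if "i \<in> {1..5}" "v \<in> words k" "v' \<in> words k" for i v v'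
  proof -
    have "weighted_triangle p k (\<lambda>v v'. G (i # v) (i # v'))"
      using Suc.prems(1) that(1) by (auto simp: weighted_triangle_def words_Cons)
    from Suc.IH[OF this that(2,3)] show ?thesis by (simp add: T_def)
  qed
  note chain = weighted_triangle_chain[OF Suc.prems(1)]
  have w: "a # replicate k (opp a) \<in> words (Suc k)" "5 # replicate k a \<in> words (Suc k)" "replicate k (opp a) \<in> words k" "replicate k a \<in> words k"
    if "a \<in> {1..4}" for a
    using that opp_le4[OF that] by (auto simp: words_Cons intro!: replicate_words)
  obtain i v where u: "u = i # v" "i \<in> {1..5}" "v \<in> words k" using Suc.prems(2) by (auto simp: words_Suc)
  obtain j v' where u': "u' = j # v'" "j \<in> {1..5}" "v' \<in> words k" using Suc.prems(3) by (auto simp: words_Suc)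
  have L0: "0 < ?L" "0 < ?L + 1" "0 < 1 + ?L" "0 < ?L + 1 + ?L" using L1 by linarith+
  have one: "G x y \<le> ennreal (1 powr (p - 1)) * G x y" for x y by simp
  have out: "G (i # v) (5 # replicate k i) \<le> ennreal ((?L + 1) powr (p - 1)) * (T i + X i)" if i: "i \<in> {1..4}" and v: "v \<in> words k" for i v
  proof -
    have i5: "i \<in> {1..5}" using i by auto
    show ?thesis unfolding X_def
      by (rule chain[OF _ w(1)[OF i] w(2)[OF i] L0(1) zero_less_one IH[OF i5 v w(3)[OF i]] one]) (use L1 i5 v in \<open>auto simp: words_Cons\<close>)
  qed
  have into: "G (5 # replicate k j) (j # v) \<le> ennreal ((1 + ?L) powr (p - 1)) * (Y j + T j)" if j: "j \<in> {1..4}" and v: "v \<in> words k" for j v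
  proof -
    have j5: "j \<in> {1..5}" using j by auto
    show ?thesis unfolding Y_def
      by (rule chain[OF w(2)[OF j] w(1)[OF j] _ zero_less_one L0(1) one IH[OF j5 w(3)[OF j] v]]) (use L1 j5 v in \<open>auto simp: words_Cons\<close>)
  qed
  have w5: "5 # v \<in> words (Suc k)" if "v \<in> words k" for v using that by (simp add: words_Cons)
  consider "i = j" | "i \<in> {1..4}" "j = 5" | "i = 5" "j \<in> {1..4}" | "i \<in> {1..4}" "j \<in> {1..4}" "i \<noteq> j"
    using u(2) u'(2) by (elim le5_cases) auto
  then show ?case
  proof cases
    case 1
    have "T i \<le> sum T {1..5}" using u(2) by (intro member_le_sum) auto
    also have "\<dots> \<le> sum T {1..5} + sum X {1..4} + sum Y {1..4}" by (simp add: add.assoc)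
    finally have "T i \<le> chain_sum (Suc k) G" using S by (rule order_trans)
    then have "ennreal (?L powr (p - 1)) * T i \<le> ennreal ((2 * 3 ^ Suc k - 1) powr (p - 1)) * chain_sum (Suc k) G"
    proof (rule mono[rotated 2])
      show "0 \<le> ?L" using L1 by linarith
      show "?L \<le> 3 * ?L + 2" using L1 by (simp add: algebra_simps)
    qed
    then show ?thesis using IH[OF u(2,3) u'(3)] u u' 1 by (auto intro: order_trans)
  next
    case 2
    have "G u u' \<le> ennreal ((?L + 1 + ?L) powr (p - 1)) * (T i + X i + T 5)"
      unfolding u u' 2(2)
      by (rule chain[OF _ w(2)[OF 2(1)] _ L0(2,1) out[OF 2(1) u(3)] IH[OF _ w(4)[OF 2(1)] u'(3)]])
        (use L1 u u' in \<open>auto simp: words_Cons\<close>)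
    also have "\<dots> \<le> ennreal ((2 * 3 ^ Suc k - 1) powr (p - 1)) * chain_sum (Suc k) G"
    proof (rule mono)
      have "T i + T 5 = sum T {i, 5}" using 2 by simp
      also have "\<dots> \<le> sum T {1..5}" using 2 by (intro sum_mono2) auto
      finally have "T i + T 5 + X i \<le> sum T {1..5} + sum X {1..4}" using 2 by (intro add_mono member_le_sum) auto
      also have "\<dots> \<le> sum T {1..5} + sum X {1..4} + sum Y {1..4}" by simp
      finally show "T i + X i + T 5 \<le> chain_sum (Suc k) G" using S by (simp add: ac_simps)
    qed (rule L3)+
    finally show ?thesis .
  next
    case 3
    have "G u u' \<le> ennreal ((?L + (1 + ?L)) powr (p - 1)) * (T 5 + (Y j + T j))"
      unfolding u u' 3(1)
      by (rule chain[OF _ w(2)[OF 3(2)] _ L0(1,3) IH[OF _ u(3) w(4)[OF 3(2)]] into[OF 3(2) u'(3)]])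
        (use L1 u u' in \<open>auto simp: words_Cons\<close>)
    also have "\<dots> \<le> ennreal ((2 * 3 ^ Suc k - 1) powr (p - 1)) * chain_sum (Suc k) G"
    proof (rule mono)
      have "T j + T 5 = sum T {j, 5}" using 3 by simp
      also have "\<dots> \<le> sum T {1..5}" using 3 by (intro sum_mono2) auto
      finally have "T j + T 5 + Y j \<le> sum T {1..5} + sum Y {1..4}" using 3 by (intro add_mono member_le_sum) auto
      also have "\<dots> \<le> sum T {1..5} + sum X {1..4} + sum Y {1..4}" by (simp add: add_mono)
      finally show "T 5 + (Y j + T j) \<le> chain_sum (Suc k) G" using S by (simp add: ac_simps)
    qed (rule L3)+
    finally show ?thesis .
  next
    case 4
    have half: "G (i # v) (5 # replicate k j) \<le> ennreal ((?L + 1 + ?L) powr (p - 1)) * (T i + X i + T 5)"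
      by (rule chain[OF _ w(2)[OF 4(1)] _ L0(2,1) out[OF 4(1) u(3)] IH[OF _ w(4)[OF 4(1)] w(4)[OF 4(2)]]])
        (use L1 u u' w(2)[OF 4(2)] in \<open>auto simp: words_Cons\<close>)
    have "G u u' \<le> ennreal ((?L + 1 + ?L + (1 + ?L)) powr (p - 1)) * (T i + X i + T 5 + (Y j + T j))"
      unfolding u u'
      by (rule chain[OF _ w(2)[OF 4(2)] _ L0(4,3) half into[OF 4(2) u'(3)]])
        (use L1 u u' in \<open>auto simp: words_Cons\<close>)
    also have "\<dots> \<le> ennreal ((2 * 3 ^ Suc k - 1) powr (p - 1)) * chain_sum (Suc k) G"
    proof (rule mono)
      \<comment> \<open>The three cells are distinct, so their sums are different parts of the total
        and nothing is counted twice.\<close>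
      have "T i + T j + T 5 = sum T {i, j, 5}" using 4 by (simp add: add.assoc)
      also have "\<dots> \<le> sum T {1..5}" using 4 by (intro sum_mono2) auto
      finally have "T i + T j + T 5 + X i + Y j \<le> sum T {1..5} + sum X {1..4} + sum Y {1..4}"
        using 4 by (intro add_mono member_le_sum) auto
      then show "T i + X i + T 5 + (Y j + T j) \<le> chain_sum (Suc k) G" using S by (simp add: ac_simps)
    qed (rule L3)+
    finally show ?thesis .
  qed
qed

lemma cell_pair_energy_triangle:
  assumes f: "f \<in> borel_measurable vicsek_mu" and p: "1 \<le> p"
  shows "weighted_triangle p n (\<lambda>v v'. pair_energy p f (vicsek_cell v) (vicsek_cell v'))"
  unfolding weighted_triangle_def
proof (intro ballI allI impI)
  fix u v w and s t :: real
  assume w: "u \<in> words n" "v \<in> words n" "w \<in> words n" and st: "0 < s" "0 < t"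
  show "pair_energy p f (vicsek_cell u) (vicsek_cell w) \<le> ennreal (((s + t) / s) powr (p - 1)) * pair_energy p f (vicsek_cell u) (vicsek_cell v)
      + ennreal (((s + t) / t) powr (p - 1)) * pair_energy p f (vicsek_cell v) (vicsek_cell w)"
    by (rule pair_energy_triangle[OF f cell_sets[OF w(1)] cell_sets[OF w(2)] cell_sets[OF w(3)]
        emeasure_cell[OF w(1)] emeasure_cell[OF w(2)] emeasure_cell[OF w(3)]])
      (use p st powr_add_weighted[OF p st] in auto)
qed

lemma cell_subset_subcells:
  assumes "w \<in> words n" shows "vicsek_cell w = (\<Union>u\<in>words k. vicsek_cell (w @ u))"
proof -
  have "vicsek_cell w = psi_word w ` (\<Union>u\<in>words k. vicsek_cell u)" using K_cells[of k] by (simp add: cell_eq)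
  then show ?thesis by (simp add: cell_simps image_UN)
qed

lemma sum_words_add: "(\<Sum>v\<in>words (n + k). g v) = (\<Sum>w\<in>words n. \<Sum>u\<in>words k. g (w @ u))"
proof -
  have "inj_on (\<lambda>(w, u). w @ u) (words n \<times> words k)" by (auto simp: inj_on_def words_def)
  then show ?thesis unfolding words_add by (subst sum.reindex) (auto simp: sum.cartesian_product case_prod_unfold)
qed

lemma sum_nbrs_swap: "(\<Sum>w\<in>words n. \<Sum>w'\<in>nbrs n w. g w w') = (\<Sum>w'\<in>words n. \<Sum>w\<in>nbrs n w'. g w w')"
proof -
  have "(\<Sum>w\<in>words n. \<Sum>w'\<in>nbrs n w. g w w') = (\<Sum>w\<in>words n. \<Sum>w'\<in>words n. if vicsek_cell w \<inter> vicsek_cell w' \<noteq> {} then g w w' else 0)"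
    unfolding nbrs_def by (intro sum.cong refl sum.inter_filter) auto
  also have "\<dots> = (\<Sum>w'\<in>words n. \<Sum>w\<in>words n. if vicsek_cell w' \<inter> vicsek_cell w \<noteq> {} then g w w' else 0)"
    by (subst sum.swap) (simp add: Int_commute)
  also have "\<dots> = (\<Sum>w'\<in>words n. \<Sum>w\<in>nbrs n w'. g w w')"
    unfolding nbrs_def by (intro sum.cong refl sum.inter_filter[symmetric]) auto
  finally show ?thesis .
qed

lemma sum_nbrs_le:
  fixes R :: "nat list \<Rightarrow> ennreal"
  shows "(\<Sum>w\<in>words n. \<Sum>w'\<in>nbrs n w. R w) \<le> 8 * (\<Sum>w\<in>words n. R w)"
    "(\<Sum>w\<in>words n. \<Sum>w'\<in>nbrs n w. R w') \<le> 8 * (\<Sum>w\<in>words n. R w)"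
proof -
  have *: "(\<Sum>w\<in>words n. \<Sum>w'\<in>nbrs n w. R w) \<le> 8 * (\<Sum>w\<in>words n. R w)"
  proof -
    have "of_nat (card (nbrs n w)) * R w \<le> 8 * R w" if "w \<in> words n" for w
      using card_nbrs[OF that] by (intro mult_right_mono) (metis of_nat_le_iff of_nat_numeral, simp)
    then show ?thesis by (simp add: sum_distrib_left sum_mono)
  qed
  show "(\<Sum>w\<in>words n. \<Sum>w'\<in>nbrs n w. R w) \<le> 8 * (\<Sum>w\<in>words n. R w)" by (rule *)
  show "(\<Sum>w\<in>words n. \<Sum>w'\<in>nbrs n w. R w') \<le> 8 * (\<Sum>w\<in>words n. R w)"
    using * by (subst sum_nbrs_swap)
qed

text \<open>Two subcells of intersecting cells are joined by a chain in each cell and one crossing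
  at the common corner, of total length at most \<open>4 * 3 ^ k\<close>. The constant
  \<open>24\<close> is \<open>8 * (2 + 1)\<close>: at most eight neighbours, and the local energies
  enter as \<open>2 * R w + R w'\<close>.\<close>

lemma cell_energy_mono:
  assumes f: "f \<in> borel_measurable vicsek_mu" and p: "1 \<le> p"
  shows "cell_energy p f n \<le> ennreal (24 * 4 powr (p - 1) * (5 * 3 powr (p - 1)) ^ k) * cell_energy p f (n + k)"
proof -
  define G where "G v v' = pair_energy p f (vicsek_cell v) (vicsek_cell v')" for v v'
  \<comment> \<open>Only the first cell of a pair is required to lie in \<open>w\<close>, so the
    crossings to neighbouring cells are included.\<close>
  define R where "R w = (\<Sum>v\<in>words k. \<Sum>v'\<in>nbrs (n + k) (w @ v). G (w @ v) v')" for w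
  let ?L = "2 * 3 ^ k - 1 :: real"
  let ?C = "ennreal ((4 * 3 ^ k) powr (p - 1))"
  have L1: "1 \<le> ?L" using one_le_power[of "3::real" k] by simp
  have L2: "0 \<le> ?L" "?L \<le> 4 * 3 ^ k" "0 \<le> p - 1" using L1 p zero_le_power[of "3::real" k] by linarith+
  have tr: "weighted_triangle p (n + k) G" unfolding G_def[abs_def] by (rule cell_pair_energy_triangle[OF f p])
  have loc: "G (w @ u) (w @ u') \<le> ennreal (?L powr (p - 1)) * R w" if w: "w \<in> words n" and u: "u \<in> words k" "u' \<in> words k" for w u u'
  proof -
    have "weighted_triangle p k (\<lambda>v v'. G (w @ v) (w @ v'))"
      using tr w words_append[OF w] unfolding weighted_triangle_def by blast
    from chain_bound[OF p this u] have "G (w @ u) (w @ u') \<le> ennreal (?L powr (p - 1)) * chain_sum k (\<lambda>v v'. G (w @ v) (w @ v'))" .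
    also have "chain_sum k (\<lambda>v v'. G (w @ v) (w @ v')) \<le> R w"
      unfolding chain_sum_def R_def
    proof (rule sum_mono)
      fix v assume v: "v \<in> words k"
      have "(\<Sum>v'\<in>nbrs k v. G (w @ v) (w @ v')) = (\<Sum>v'\<in>(@) w ` nbrs k v. G (w @ v) v')"
        by (subst sum.reindex) (auto simp: inj_on_def)
      also have "\<dots> \<le> (\<Sum>v'\<in>nbrs (n + k) (w @ v). G (w @ v) v')"
        using nbrs_append[OF w] by (intro sum_mono2) auto
      finally show "(\<Sum>v'\<in>nbrs k v. G (w @ v) (w @ v')) \<le> (\<Sum>v'\<in>nbrs (n + k) (w @ v). G (w @ v) v')" .
    qed
    finally show ?thesis by (simp add: mult_left_mono)
  qed
  have far: "G (w @ u) (w' @ u') \<le> ?C * (2 * R w + R w')"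
    if w: "w \<in> words n" "w' \<in> nbrs n w" and u: "u \<in> words k" "u' \<in> words k" for w w' u u'
  proof (cases "w = w'")
    case True
    have "G (w @ u) (w' @ u') \<le> ennreal (?L powr (p - 1)) * R w" using loc[OF w(1) u] True by simp
    also have "\<dots> \<le> ?C * (2 * R w + R w')"
    proof (intro mult_mono ennreal_leI powr_mono2)
      have "R w \<le> 2 * R w" by (metis add_increasing2 mult_2 order_refl zero_le)
      then show "R w \<le> 2 * R w + R w'" by (simp add: add_increasing2)
    qed (rule L2 zero_le)+
    finally show ?thesis .
  next
    case False
    have w': "w' \<in> words n" using nbrs_words w by blast
    obtain z where z: "z \<in> vicsek_cell w" "z \<in> vicsek_cell w'" using w(2) by (auto simp: nbrs_def)
    obtain a where a: "a \<in> {1..4}" "z = psi_word w (vicsek_q a)" using cells_meet_in_corner[OF w(1) w' False z] by blast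
    obtain b where b: "b \<in> {1..4}" "z = psi_word w' (vicsek_q b)" using cells_meet_in_corner[OF w' w(1) _ z(2,1)] False by auto
    have ab5: "a \<in> {1..5}" "b \<in> {1..5}" using a b by auto
    let ?a = "replicate k a" and ?b = "replicate k b"
    have rw: "?a \<in> words k" "?b \<in> words k" using ab5 replicate_words by auto
    have "z \<in> vicsek_cell (w @ ?a)" "z \<in> vicsek_cell (w' @ ?b)"
      using imageI[OF replicate_cell[OF ab5(1), of k], of "psi_word w"] imageI[OF replicate_cell[OF ab5(2), of k], of "psi_word w'"]
      by (simp_all only: cell_simps a(2)[symmetric] b(2)[symmetric])
    then have nb: "w' @ ?b \<in> nbrs (n + k) (w @ ?a)" using words_append[OF w' rw(2)] by (auto simp: nbrs_def)
    \<comment> \<open>The crossing is charged to \<open>w\<close>, which is why \<open>R w\<close>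
      appears twice in the bound.\<close>
    have cross: "G (w @ ?a) (w' @ ?b) \<le> ennreal (1 powr (p - 1)) * R w"
    proof -
      have "G (w @ ?a) (w' @ ?b) \<le> (\<Sum>v'\<in>nbrs (n + k) (w @ ?a). G (w @ ?a) v')" using nb by (intro member_le_sum) auto
      also have "\<dots> \<le> R w" unfolding R_def using rw by (intro member_le_sum[of ?a "words k"]) auto
      finally show ?thesis by simp
    qed
    note W = words_append[OF w(1)] words_append[OF w']
    have L0: "0 < ?L" "0 < ?L + 1" using L1 by linarith+
    have "G (w @ u) (w' @ ?b) \<le> ennreal ((?L + 1) powr (p - 1)) * (R w + R w)"
      by (rule weighted_triangle_chain[OF tr W(1)[OF u(1)] W(1)[OF rw(1)] W(2)[OF rw(2)] L0(1) zero_less_one loc[OF w(1) u(1) rw(1)] cross])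
    from this have "G (w @ u) (w' @ u') \<le> ennreal ((?L + 1 + ?L) powr (p - 1)) * (R w + R w + R w')"
      by (rule weighted_triangle_chain[OF tr W(1)[OF u(1)] W(2)[OF rw(2)] W(2)[OF u(2)] L0(2,1) _ loc[OF w' rw(2) u(2)]])
    also have "\<dots> \<le> ?C * (2 * R w + R w')"
    proof (intro mult_mono ennreal_leI powr_mono2)
      show "R w + R w + R w' \<le> 2 * R w + R w'" by (simp only: mult_2)
      show "?L + 1 + ?L \<le> 4 * 3 ^ k" "0 \<le> ?L + 1 + ?L" using L1 by linarith+
    qed (rule L2 zero_le)+
    finally show ?thesis .
  qed
  have pair: "G w w' \<le> 25 ^ k * (?C * (2 * R w + R w'))" if w: "w \<in> words n" "w' \<in> nbrs n w" for w w'
  proof -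
    have w': "w' \<in> words n" using nbrs_words w by blast
    have "G w w' \<le> (\<Sum>u\<in>words k. \<Sum>u'\<in>words k. G (w @ u) (w' @ u'))"
      unfolding G_def using cell_subset_subcells[OF w(1), of k] cell_subset_subcells[OF w', of k] cell_sets[OF words_append]  w(1) w'
      by (intro pair_energy_cover[OF f]) auto
    also have "\<dots> \<le> (\<Sum>u\<in>words k. \<Sum>u'\<in>words k. ?C * (2 * R w + R w'))" by (intro sum_mono far w)
    also have "\<dots> = 25 ^ k * (?C * (2 * R w + R w'))"
    proof -
      have "(25::ennreal) ^ k = 5 ^ k * 5 ^ k" by (simp flip: power_mult_distrib)
      then show ?thesis by (simp add: card_words mult.assoc)
    qed
    finally show ?thesis .
  qed
  define RR where "RR = (\<Sum>w\<in>words n. R w)"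
  have RR: "cell_energy p f (n + k) = 5 ^ (n + k) * RR"
    unfolding cell_energy_def RR_def R_def G_def sum_words_add ..
  have "(\<Sum>w\<in>words n. \<Sum>w'\<in>nbrs n w. G w w') \<le> (\<Sum>w\<in>words n. \<Sum>w'\<in>nbrs n w. 25 ^ k * (?C * (2 * R w + R w')))"
    by (intro sum_mono pair)
  also have "\<dots> = 25 ^ k * (?C * (2 * (\<Sum>w\<in>words n. \<Sum>w'\<in>nbrs n w. R w) + (\<Sum>w\<in>words n. \<Sum>w'\<in>nbrs n w. R w')))"
    by (simp only: sum_distrib_left distrib_left sum.distrib)
  also have "\<dots> \<le> 25 ^ k * (?C * (2 * (8 * RR) + 8 * RR))"
    unfolding RR_def by (intro mult_left_mono add_mono sum_nbrs_le) auto
  also have "\<dots> = 25 ^ k * (?C * (24 * RR))" by (simp add: mult.assoc[symmetric] flip: distrib_right)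
  finally have "cell_energy p f n \<le> 5 ^ n * (25 ^ k * (?C * (24 * RR)))"
    unfolding cell_energy_def G_def by (rule mult_left_mono) simp
  also have "\<dots> = ennreal (24 * 4 powr (p - 1) * (5 * 3 powr (p - 1)) ^ k) * (5 ^ (n + k) * RR)"
  proof -
    have "(4 * 3 ^ k) powr (p - 1) = 4 powr (p - 1) * (3 powr (p - 1)) ^ k"
      by (simp add: powr_mult powr_powr powr_realpow[symmetric] mult.commute)
    then have "ennreal (24 * 4 powr (p - 1) * (5 * 3 powr (p - 1)) ^ k) = 24 * (?C * 5 ^ k)"
      by (simp add: ennreal_mult' ennreal_power[symmetric] power_mult_distrib ac_simps)
    moreover have "(25::ennreal) ^ k = 5 ^ k * 5 ^ k" by (simp flip: power_mult_distrib)
    ultimately show ?thesis by (simp only: power_add ac_simps)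
  qed
  also have "\<dots> = ennreal (24 * 4 powr (p - 1) * (5 * 3 powr (p - 1)) ^ k) * cell_energy p f (n + k)" by (simp only: RR)
  finally show ?thesis .
qed

lemma cell_energy_add:
  assumes g: "g \<in> borel_measurable vicsek_mu" and h: "h \<in> borel_measurable vicsek_mu" and p: "1 \<le> p"
  shows "cell_energy p (\<lambda>x. g x + h x) n \<le> ennreal (2 powr p) * (cell_energy p g n + cell_energy p h n)"
proof -
  note [measurable] = g h
  have e: "ennreal (\<bar>g y + h y - (g x + h x)\<bar> powr p) \<le> ennreal (2 powr p) * ennreal (\<bar>g y - g x\<bar> powr p) + ennreal (2 powr p) * ennreal (\<bar>h y - h x\<bar> powr p)" for x y
  proof -
    have "\<bar>g y + h y - (g x + h x)\<bar> powr p \<le> (\<bar>g y - g x\<bar> + \<bar>h y - h x\<bar>) powr p" using p by (intro powr_mono2) auto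
    also have "\<dots> \<le> 2 powr p * (\<bar>g y - g x\<bar> powr p + \<bar>h y - h x\<bar> powr p)" by (rule powr_add_le[OF p]) auto
    finally show ?thesis by (simp add: ennreal_mult[symmetric] distrib_left flip: ennreal_plus)
  qed
  have d: "pair_energy p (\<lambda>x. g x + h x) A B \<le> ennreal (2 powr p) * (pair_energy p g A B + pair_energy p h A B)"
    if [measurable]: "A \<in> sets vicsek_mu" "B \<in> sets vicsek_mu" for A B
  proof -
    have "pair_energy p (\<lambda>x. g x + h x) A B \<le> (\<integral>\<^sup>+x. (\<integral>\<^sup>+y. ennreal (2 powr p) * (ennreal (\<bar>g y - g x\<bar> powr p) * indicator B y)
      + ennreal (2 powr p) * (ennreal (\<bar>h y - h x\<bar> powr p) * indicator B y) \<partial>vicsek_mu) * indicator A x \<partial>vicsek_mu)"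
      unfolding pair_energy_def using e by (intro nn_integral_mono mult_right_mono) (auto split: split_indicator)
    also have "\<dots> = (\<integral>\<^sup>+x. ennreal (2 powr p) * ((\<integral>\<^sup>+y\<in>B. ennreal (\<bar>g y - g x\<bar> powr p) \<partial>vicsek_mu) * indicator A x)
      + ennreal (2 powr p) * ((\<integral>\<^sup>+y\<in>B. ennreal (\<bar>h y - h x\<bar> powr p) \<partial>vicsek_mu) * indicator A x) \<partial>vicsek_mu)"
      by (intro nn_integral_cong) (simp add: nn_integral_add nn_integral_cmult distrib_right mult.assoc)
    also have "\<dots> = ennreal (2 powr p) * (pair_energy p g A B + pair_energy p h A B)"
      unfolding pair_energy_def by (simp add: nn_integral_add nn_integral_cmult distrib_left)
    finally show ?thesis .
  qed
  have "cell_energy p (\<lambda>x. g x + h x) n \<le> 5 ^ n * (\<Sum>w\<in>words n. \<Sum>w'\<in>nbrs n w.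
    ennreal (2 powr p) * (pair_energy p g (vicsek_cell w) (vicsek_cell w') + pair_energy p h (vicsek_cell w) (vicsek_cell w')))"
    unfolding cell_energy_def by (intro mult_left_mono sum_mono d cell_sets) (auto dest: nbrs_words)
  also have "\<dots> = ennreal (2 powr p) * (cell_energy p g n + cell_energy p h n)"
    unfolding cell_energy_def by (simp add: sum.distrib distrib_left sum_distrib_left ac_simps)
  finally show ?thesis .
qed

lemma sum_cell_integral_le:
  assumes [measurable]: "g \<in> borel_measurable vicsek_mu"
  shows "(\<Sum>w\<in>words n. \<integral>\<^sup>+x\<in>vicsek_cell w. g x \<partial>vicsek_mu) \<le> 2 * (\<integral>\<^sup>+x. g x \<partial>vicsek_mu)"
proof -
  note [measurable] = cell_sets
  have "(\<Sum>w\<in>words n. \<integral>\<^sup>+x\<in>vicsek_cell w. g x \<partial>vicsek_mu) = (\<integral>\<^sup>+x. (\<Sum>w\<in>words n. g x * indicator (vicsek_cell w) x) \<partial>vicsek_mu)"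
    by (rule nn_integral_sum[symmetric]) measurable
  also have "\<dots> \<le> (\<integral>\<^sup>+x. 2 * g x \<partial>vicsek_mu)"
  proof (rule nn_integral_mono)
    fix x assume "x \<in> space vicsek_mu"
    then have "g x * (\<Sum>w\<in>words n. indicator (vicsek_cell w) x) \<le> g x * 2"
      by (intro mult_left_mono sum_indicator_cells_le) auto
    then show "(\<Sum>w\<in>words n. g x * indicator (vicsek_cell w) x) \<le> 2 * g x" by (simp add: sum_distrib_left mult.commute)
  qed
  also have "\<dots> = 2 * (\<integral>\<^sup>+x. g x \<partial>vicsek_mu)" by (rule nn_integral_cmult) measurable
  finally show ?thesis .
qed

text \<open>The prefactor is cancelled by the mass of the other cell of the pair. The constant
  \<open>32\<close> is \<open>8 + 8\<close> neighbours for the two terms, times \<open>2\<close>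
  because a point may lie in two cells.\<close>

lemma cell_energy_le_norm:
  assumes g: "g \<in> borel_measurable vicsek_mu" and p: "1 \<le> p"
  shows "cell_energy p g n \<le> ennreal (32 * 2 powr p) * (\<integral>\<^sup>+x. ennreal (\<bar>g x\<bar> powr p) \<partial>vicsek_mu)"
proof -
  note [measurable] = g
  define N where "N w = (\<integral>\<^sup>+x\<in>vicsek_cell w. ennreal (\<bar>g x\<bar> powr p) \<partial>vicsek_mu)" for w
  let ?c = "ennreal (2 powr p)"
  have e: "ennreal (\<bar>g y - g x\<bar> powr p) \<le> ?c * ennreal (\<bar>g x\<bar> powr p) + ?c * ennreal (\<bar>g y\<bar> powr p)" for x y
  proof -
    have "\<bar>g y - g x\<bar> powr p \<le> (\<bar>g x\<bar> + \<bar>g y\<bar>) powr p" using p by (intro powr_mono2) auto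
    also have "\<dots> \<le> 2 powr p * (\<bar>g x\<bar> powr p + \<bar>g y\<bar> powr p)" by (rule powr_add_le[OF p]) auto
    finally show ?thesis by (simp add: ennreal_mult[symmetric] distrib_left flip: ennreal_plus)
  qed
  have d: "pair_energy p g (vicsek_cell w) (vicsek_cell w') \<le> ?c * ennreal ((1/5) ^ n) * (N w + N w')" if w: "w \<in> words n" "w' \<in> words n" for w w'
  proof -
    note [measurable] = cell_sets[OF w(1)] cell_sets[OF w(2)]
    have "pair_energy p g (vicsek_cell w) (vicsek_cell w') \<le> (\<integral>\<^sup>+x. (\<integral>\<^sup>+y. ?c * ennreal (\<bar>g x\<bar> powr p) * indicator (vicsek_cell w') y
      + ?c * (ennreal (\<bar>g y\<bar> powr p) * indicator (vicsek_cell w') y) \<partial>vicsek_mu) * indicator (vicsek_cell w) x \<partial>vicsek_mu)"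
      unfolding pair_energy_def using e by (intro nn_integral_mono mult_right_mono) (auto split: split_indicator)
    also have "\<dots> = (\<integral>\<^sup>+x. ?c * ennreal ((1/5) ^ n) * (ennreal (\<bar>g x\<bar> powr p) * indicator (vicsek_cell w) x)
      + ?c * N w' * indicator (vicsek_cell w) x \<partial>vicsek_mu)"
    proof (rule nn_integral_cong)
      fix x
      have inner: "(\<integral>\<^sup>+y. ?c * ennreal (\<bar>g x\<bar> powr p) * indicator (vicsek_cell w') y
      + ?c * (ennreal (\<bar>g y\<bar> powr p) * indicator (vicsek_cell w') y) \<partial>vicsek_mu) =
        ?c * ennreal (\<bar>g x\<bar> powr p) * ennreal ((1/5) ^ n) + ?c * N w'"
        unfolding N_def by (subst nn_integral_add) (simp_all add: nn_integral_cmult nn_integral_cmult_indicator emeasure_cell[OF w(2)])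
      show "(\<integral>\<^sup>+y. ?c * ennreal (\<bar>g x\<bar> powr p) * indicator (vicsek_cell w') y
      + ?c * (ennreal (\<bar>g y\<bar> powr p) * indicator (vicsek_cell w') y) \<partial>vicsek_mu) * indicator (vicsek_cell w) x
        = ?c * ennreal ((1/5) ^ n) * (ennreal (\<bar>g x\<bar> powr p) * indicator (vicsek_cell w) x)
      + ?c * N w' * indicator (vicsek_cell w) x"
        unfolding inner by (simp only: distrib_right distrib_left ac_simps)
    qed
    also have "\<dots> = ?c * ennreal ((1/5) ^ n) * (N w + N w')"
    proof -
      have "(\<integral>\<^sup>+x. ?c * ennreal ((1/5) ^ n) * (ennreal (\<bar>g x\<bar> powr p) * indicator (vicsek_cell w) x)
        + ?c * N w' * indicator (vicsek_cell w) x \<partial>vicsek_mu) = ?c * ennreal ((1/5) ^ n) * N w + ?c * N w' * ennreal ((1/5) ^ n)"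
        unfolding N_def[of w]
        by (subst nn_integral_add) (simp_all add: nn_integral_cmult nn_integral_cmult_indicator emeasure_cell[OF w(1)])
      then show ?thesis by (simp only: distrib_left distrib_right ac_simps)
    qed
    finally show ?thesis .
  qed
  have "cell_energy p g n \<le> 5 ^ n * (\<Sum>w\<in>words n. \<Sum>w'\<in>nbrs n w. ?c * ennreal ((1/5) ^ n) * (N w + N w'))"
    unfolding cell_energy_def by (intro mult_left_mono sum_mono d) (auto dest: nbrs_words)
  also have "\<dots> = 5 ^ n * (?c * ennreal ((1/5) ^ n) * ((\<Sum>w\<in>words n. \<Sum>w'\<in>nbrs n w. N w) + (\<Sum>w\<in>words n. \<Sum>w'\<in>nbrs n w. N w')))"
    by (simp only: sum_distrib_left distrib_left sum.distrib)
  also have "\<dots> \<le> 5 ^ n * (?c * ennreal ((1/5) ^ n) * (8 * (\<Sum>w\<in>words n. N w) + 8 * (\<Sum>w\<in>words n. N w)))"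
    by (intro mult_left_mono add_mono sum_nbrs_le) auto
  also have "\<dots> = (5 ^ n * ennreal ((1/5) ^ n)) * (16 * (?c * (\<Sum>w\<in>words n. N w)))"
  proof -
    have "8 * S + 8 * S = 16 * S" for S :: ennreal by (simp flip: distrib_right)
    then show ?thesis by (simp only: ac_simps)
  qed
  also have "5 ^ n * ennreal ((1/5) ^ n) = 1"
  proof -
    have "5 ^ n * ennreal ((1/5) ^ n) = ennreal (5 ^ n * (1/5) ^ n)" by (simp add: ennreal_mult ennreal_power[symmetric])
    then show ?thesis by (simp flip: power_mult_distrib)
  qed
  also have "1 * (16 * (?c * (\<Sum>w\<in>words n. N w))) \<le> 1 * (16 * (?c * (2 * (\<integral>\<^sup>+x. ennreal (\<bar>g x\<bar> powr p) \<partial>vicsek_mu))))"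
    unfolding N_def by (intro mult_left_mono sum_cell_integral_le) auto
  also have "\<dots> = ennreal (32 * 2 powr p) * (\<integral>\<^sup>+x. ennreal (\<bar>g x\<bar> powr p) \<partial>vicsek_mu)"
  proof -
    have "ennreal (32 * 2 powr p) = 32 * ?c" by (simp add: ennreal_mult')
    moreover have "16 * (?c * (2 * X)) = (16 * 2) * (?c * X)" for X :: ennreal by (simp only: ac_simps)
    ultimately show ?thesis by (simp add: mult.assoc)
  qed
  finally show ?thesis .
qed

subsection \<open>Functions varying along a single arm\<close>

lemma dist_two_corners:
  assumes "i \<in> {1..4}" "j \<in> {1..4}" "i \<noteq> j" shows "vicsek_dist (vicsek_q i) (vicsek_q j) = 2"
  using skel_arms(1)[OF assms, of 1 1] vicsek_dist_extends(2)[OF q_skel q_skel, of i j] assms by simp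

lemma corner_dist_own:
  assumes b: "b \<in> {1..4}" and x: "x \<in> vicsek_K"
  shows "vicsek_dist (vicsek_q b) (vicsek_psi b x) = vicsek_dist (vicsek_q b) x / 3"
  using vicsek_dist_psi[OF _ q_K x, of b b] b by simp

lemma corner_dist_junction:
  assumes b: "b \<in> {1..4}" shows "vicsek_dist (vicsek_q b) ((1/3) *\<^sub>R vicsek_q b) = 2/3"
proof -
  have "vicsek_dist (vicsek_q b) (vicsek_psi b (vicsek_q (opp b))) = 2/3"
    using corner_dist_own[OF b q_K] dist_two_corners[OF b opp_le4[OF b]] opp_neq[OF b] opp_le4[OF b] by simp
  then show ?thesis by (simp add: psi_opp)
qed

lemma corner_dist_center:
  assumes b: "b \<in> {1..4}" and x: "x \<in> vicsek_K"
  shows "vicsek_dist (vicsek_q b) (vicsek_psi 5 x) = 2/3 + vicsek_dist (vicsek_q b) x / 3"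
proof -
  have b5: "b \<in> {1..5}" using b by auto
  have "vicsek_dist ((1/3) *\<^sub>R vicsek_q b) (vicsek_psi 5 x) = vicsek_dist (vicsek_q b) x / 3"
    using vicsek_dist_psi[OF _ q_K[OF b5] x, of 5] by (simp add: psi_5)
  then show ?thesis
    using vicsek_dist_corner_center[OF b q_K[OF b5] x] corner_dist_junction[OF b] by simp
qed

lemma corner_dist_other:
  assumes b: "b \<in> {1..4}" and c: "c \<in> {1..4}" "c \<noteq> b" and x: "x \<in> vicsek_K"
  shows "vicsek_dist (vicsek_q b) (vicsek_psi c x) = 4/3 + vicsek_dist (vicsek_q (opp c)) x / 3"
proof -
  have c5: "c \<in> {1..5}" "opp c \<in> {1..5}" "b \<in> {1..5}" using b c opp_le4[OF c(1)] by auto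
  have "vicsek_dist ((1/3) *\<^sub>R vicsek_q c) (vicsek_psi c x) = vicsek_dist (vicsek_q (opp c)) x / 3"
    using vicsek_dist_psi[OF c5(1) q_K[OF c5(2)] x] by (simp add: psi_opp)
  then show ?thesis
    using vicsek_dist_corners[OF b c(1) c(2)[symmetric] q_K[OF c5(3)] x] corner_dist_junction[OF b] by simp
qed

text \<open>A Gromov product: the signed coordinate of the projection of \<open>x\<close> to the diagonal through the corner
  \<open>a\<close>, which is constant on the cells that do not meet the diagonal in more than a point.\<close>

definition arm_coord :: "nat \<Rightarrow> real^2 \<Rightarrow> real" where
  "arm_coord a x = (vicsek_dist (vicsek_q (opp a)) x - vicsek_dist (vicsek_q a) x) / 2"

text \<open>In a corner cell off the diagonal both distances have the form \<open>4/3\<close> plus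
  the same term, so the coordinate vanishes. In the three cells on the diagonal it is an affine
  function of the coordinate inside the cell.\<close>

lemma arm_coord_psi:
  assumes a: "a \<in> {1..4}" and i: "i \<in> {1..5}" and x: "x \<in> vicsek_K"
  shows "arm_coord a (vicsek_psi i x) =
    (if i = 5 then arm_coord a x / 3 else if i = a then 2/3 + arm_coord a x / 3
     else if i = opp a then arm_coord a x / 3 - 2/3 else 0)"
proof -
  note o = opp_le4[OF a] opp_opp[OF a] opp_neq[OF a]
  show ?thesis
    using i
  proof (cases rule: le5_cases)
    case 2
    then show ?thesis using corner_dist_center[OF a x] corner_dist_center[OF o(1) x]
      by (simp add: arm_coord_def diff_divide_distrib)
  next
    case 1
    then have i5: "i \<noteq> 5" by auto
    consider "i = a" | "i = opp a" | "i \<noteq> a" "i \<noteq> opp a" by blast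
    then show ?thesis
    proof cases
      case 1
      then show ?thesis using i5 corner_dist_own[OF a x] corner_dist_other[OF o(1) a _ x] o
        by (simp add: arm_coord_def field_simps)
    next
      case 2
      then show ?thesis using i5 corner_dist_own[OF o(1) x] corner_dist_other[OF a o(1) o(3) x] o
        by (simp add: arm_coord_def field_simps)
    next
      case 3
      then show ?thesis using i5 corner_dist_other[OF a 1 _ x] corner_dist_other[OF o(1) 1 _ x]
        by (simp add: arm_coord_def)
    qed
  qed
qed

lemma arm_coord_abs_le:
  assumes a: "a \<in> {1..4}" and x: "x \<in> vicsek_K" shows "\<bar>arm_coord a x\<bar> \<le> 1"
proof -
  note o = opp_le4[OF a] opp_neq[OF a]
  have K: "vicsek_q a \<in> vicsek_K" "vicsek_q (opp a) \<in> vicsek_K" using q_K a o by auto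
  show ?thesis
    using vicsek_dist_triangle[OF K(1,2) x] vicsek_dist_triangle[OF K(2,1) x] dist_two_corners[OF a o(1)] dist_two_corners[OF o(1) a] o(2)
    by (simp add: arm_coord_def abs_le_iff)
qed

text \<open>Words in \<open>a\<close>, \<open>opp a\<close> and \<open>5\<close> index the cells
  along the diagonal. The coordinate takes values in an interval of length \<open>2\<close>, scaled
  by a third with every letter.\<close>

definition arm_osc :: "nat \<Rightarrow> nat list \<Rightarrow> real" where
  "arm_osc a u = (if set u \<subseteq> {a, opp a, 5} then 2 / 3 ^ length u else 0)"

lemma arm_osc_nonneg: "0 \<le> arm_osc a u" by (simp add: arm_osc_def)

lemma arm_coord_osc:
  assumes a: "a \<in> {1..4}" and xy: "x \<in> vicsek_K" "y \<in> vicsek_K"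
  shows "u \<in> words k \<Longrightarrow> \<bar>arm_coord a (psi_word u x) - arm_coord a (psi_word u y)\<bar> \<le> arm_osc a u"
proof (induction u arbitrary: k)
  case Nil
  then show ?case using arm_coord_abs_le[OF a xy(1)] arm_coord_abs_le[OF a xy(2)] by (simp add: arm_osc_def)
next
  case (Cons i u)
  then obtain m where u: "i \<in> {1..5}" "u \<in> words m" by (auto simp: words_def)
  have K: "psi_word u x \<in> vicsek_K" "psi_word u y \<in> vicsek_K" using psi_word_K[OF u(2)] xy by auto
  have IH: "\<bar>arm_coord a (psi_word u x) - arm_coord a (psi_word u y)\<bar> \<le> arm_osc a u" by (rule Cons.IH[OF u(2)])
  show ?case
  proof (cases "i \<in> {a, opp a, 5}")
    case True
    then have "arm_coord a (psi_word (i # u) x) - arm_coord a (psi_word (i # u) y) = (arm_coord a (psi_word u x) - arm_coord a (psi_word u y)) / 3"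
      using arm_coord_psi[OF a u(1)] K by (auto simp: diff_divide_distrib)
    then have "\<bar>arm_coord a (psi_word (i # u) x) - arm_coord a (psi_word (i # u) y)\<bar> \<le> arm_osc a u / 3" using IH by (simp only: abs_divide) simp
    also have "\<dots> = arm_osc a (i # u)" using True by (simp add: arm_osc_def)
    finally show ?thesis .
  next
    case False
    then show ?thesis using arm_coord_psi[OF a u(1)] K arm_osc_nonneg[of a "i # u"] by simp
  qed
qed

text \<open>The positive part keeps only the half of the diagonal that ends at \<open>a\<close>, so
  that the four functions form a nodal basis at the corners.\<close>

definition bump :: "nat \<Rightarrow> real^2 \<Rightarrow> real" where "bump a x = max 0 (arm_coord a x)"

lemma bump_corner:
  assumes a: "a \<in> {1..4}" and b: "b \<in> {1..4}" shows "bump a (vicsek_q b) = (if b = a then 1 else 0)"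
proof -
  note o = opp_le4[OF a] opp_neq[OF a]
  have K: "vicsek_dist (vicsek_q c) (vicsek_q c) = 0" if "c \<in> {1..4}" for c using vicsek_dist_self q_K that by auto
  show ?thesis
    using dist_two_corners[OF o(1) b] dist_two_corners[OF a b] K[OF b] o
    by (cases "b = a"; cases "opp a = b") (auto simp: bump_def arm_coord_def)
qed

lemma bump_bounds: "a \<in> {1..4} \<Longrightarrow> x \<in> vicsek_K \<Longrightarrow> 0 \<le> bump a x \<and> bump a x \<le> 1"
  using arm_coord_abs_le[of a x] by (auto simp: bump_def)

lemma bump_osc:
  assumes "a \<in> {1..4}" "x \<in> vicsek_K" "y \<in> vicsek_K" "u \<in> words k"
  shows "\<bar>bump a (psi_word u x) - bump a (psi_word u y)\<bar> \<le> arm_osc a u"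
  using arm_coord_osc[OF assms] by (auto simp: bump_def max_def)

lemma continuous_bump: assumes a: "a \<in> {1..4}" shows "continuous_on vicsek_K (bump a)"
proof -
  have c: "continuous_on vicsek_K (\<lambda>y. vicsek_dist (vicsek_q b) y)" if "b \<in> {1..4}" for b
  proof -
    have "continuous_on vicsek_K (\<lambda>y. (\<lambda>(x, y). vicsek_dist x y) (vicsek_q b, y))"
      by (rule continuous_on_compose2[OF continuous_vicsek_dist]) (use q_K[of b] that in \<open>auto intro!: continuous_intros\<close>)
    then show ?thesis by simp
  qed
  show ?thesis unfolding bump_def[abs_def] arm_coord_def
    by (intro continuous_on_max continuous_on_const continuous_on_divide continuous_on_diff c a opp_le4) auto
qed

subsection \<open>Interpolation of cell values\<close>

definition cell_of :: "nat \<Rightarrow> real^2 \<Rightarrow> nat list" where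
  "cell_of n z = (SOME w. w \<in> words n \<and> z \<in> vicsek_cell w)"

lemma cell_of: assumes "z \<in> vicsek_K" shows "cell_of n z \<in> words n" "z \<in> vicsek_cell (cell_of n z)"
proof -
  have "\<exists>w. w \<in> words n \<and> z \<in> vicsek_cell w" using cell_exists[OF assms] by metis
  then have "cell_of n z \<in> words n \<and> z \<in> vicsek_cell (cell_of n z)" unfolding cell_of_def by (rule someI_ex)
  then show "cell_of n z \<in> words n" "z \<in> vicsek_cell (cell_of n z)" by auto
qed

definition psi_word_inv :: "nat list \<Rightarrow> real^2 \<Rightarrow> real^2" where "psi_word_inv w = inv (psi_word w)"

lemma psi_word_inv [simp]: "psi_word_inv w (psi_word w x) = x"
  unfolding psi_word_inv_def by (rule inv_f_f) (simp add: inj_def)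

lemma continuous_psi_word_inv: "continuous_on (vicsek_cell w) (psi_word_inv w)"
  unfolding cell_eq by (rule continuous_on_inv[OF continuous_psi_word compact_K]) simp

text \<open>At a corner shared by two cells either of the two values may be used for the interpolation, as
  long as both cells use the same one; \<open>cell_of\<close> makes this choice.\<close>

definition jump :: "nat \<Rightarrow> (nat list \<Rightarrow> real) \<Rightarrow> nat list \<Rightarrow> nat \<Rightarrow> real" where
  "jump n F w a = F (cell_of n (psi_word w (vicsek_q a))) - F w"

definition interp_cell :: "nat \<Rightarrow> (nat list \<Rightarrow> real) \<Rightarrow> nat list \<Rightarrow> real^2 \<Rightarrow> real" where
  "interp_cell n F w x = F w + (\<Sum>a\<in>{1..4}. jump n F w a * bump a (psi_word_inv w x))"

definition interpolant :: "nat \<Rightarrow> (nat list \<Rightarrow> real) \<Rightarrow> real^2 \<Rightarrow> real" where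
  "interpolant n F x = interp_cell n F (cell_of n x) x"

lemma interp_cell_corner:
  assumes a: "a \<in> {1..4}" shows "interp_cell n F w (psi_word w (vicsek_q a)) = F (cell_of n (psi_word w (vicsek_q a)))"
proof -
  have "(\<Sum>b\<in>{1..4}. jump n F w b * bump b (vicsek_q a)) = (\<Sum>b\<in>{1..4}. if a = b then jump n F w b else 0)"
    using a by (intro sum.cong refl) (auto simp: bump_corner)
  also have "\<dots> = jump n F w a" using a by (subst sum.delta') auto
  finally show ?thesis by (simp add: interp_cell_def jump_def)
qed

text \<open>Distinct cells meet only in corners, and there both formulas give the value of the cell
  chosen by \<open>cell_of\<close>. This makes the piecewise definition consistent and
  continuous.\<close>

lemma interpolant_on_cell:
  assumes w: "w \<in> words n" and x: "x \<in> vicsek_cell w"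
  shows "interpolant n F x = interp_cell n F w x"
proof (cases "cell_of n x = w")
  case True then show ?thesis by (simp add: interpolant_def)
next
  case False
  have xK: "x \<in> vicsek_K" using x cell_K[OF w] by auto
  note c = cell_of[OF xK, of n]
  obtain a where a: "a \<in> {1..4}" "x = psi_word w (vicsek_q a)"
    using cells_meet_in_corner[OF w c(1) False[symmetric] x c(2)] by blast
  obtain b where b: "b \<in> {1..4}" "x = psi_word (cell_of n x) (vicsek_q b)"
    using cells_meet_in_corner[OF c(1) w False c(2) x] by blast
  have "interp_cell n F w x = F (cell_of n x)" using interp_cell_corner[OF a(1), of n F w] a(2) by simp
  moreover have "interp_cell n F (cell_of n x) x = F (cell_of n x)"
    using interp_cell_corner[OF b(1), of n F "cell_of n x"] b(2)[symmetric] by simp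
  ultimately show ?thesis by (simp add: interpolant_def)
qed

lemma continuous_interpolant: "continuous_on vicsek_K (interpolant n F)"
proof -
  have "continuous_on (vicsek_cell w) (interpolant n F)" if w: "w \<in> words n" for w
  proof -
    have im: "psi_word_inv w ` vicsek_cell w \<subseteq> vicsek_K" by (auto simp: cell_eq)
    have "continuous_on (vicsek_cell w) (\<lambda>x. bump a (psi_word_inv w x))" if "a \<in> {1..4}" for a
      by (rule continuous_on_compose2[OF continuous_bump[OF that] continuous_psi_word_inv im])
    then have "continuous_on (vicsek_cell w) (interp_cell n F w)"
      unfolding interp_cell_def[abs_def] by (intro continuous_intros) auto
    then show ?thesis using interpolant_on_cell[OF w] by (metis continuous_on_cong)
  qed
  then have "continuous_on (\<Union>w\<in>words n. vicsek_cell w) (interpolant n F)"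
    by (intro continuous_on_closed_Union closed_cell) auto
  then show ?thesis using K_cells[of n] by simp
qed

lemma measurable_continuous_K: "continuous_on vicsek_K g \<Longrightarrow> g \<in> borel_measurable vicsek_mu"
  using borel_measurable_continuous_on_restrict[of vicsek_K g] measurable_cong_sets[OF sets_mu refl] by blast

lemma interpolant_osc:
  assumes w: "w \<in> words n" and u: "u \<in> words k" and xy: "x \<in> vicsek_cell (w @ u)" "y \<in> vicsek_cell (w @ u)"
  shows "\<bar>interpolant n F x - interpolant n F y\<bar> \<le> (\<Sum>a\<in>{1..4}. \<bar>jump n F w a\<bar> * arm_osc a u)"
proof -
  obtain x' y' where x': "x' \<in> vicsek_K" "x = psi_word w (psi_word u x')" and y': "y' \<in> vicsek_K" "y = psi_word w (psi_word u y')"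
    using xy by (auto simp: cell_eq)
  have c: "x \<in> vicsek_cell w" "y \<in> vicsek_cell w" using x' y' psi_word_K[OF u] by (auto simp: cell_eq)
  have "interpolant n F x - interpolant n F y = (\<Sum>a\<in>{1..4}. jump n F w a * (bump a (psi_word u x') - bump a (psi_word u y')))"
  proof -
    have "interpolant n F x = F w + (\<Sum>a\<in>{1..4}. jump n F w a * bump a (psi_word u x'))"
      "interpolant n F y = F w + (\<Sum>a\<in>{1..4}. jump n F w a * bump a (psi_word u y'))"
      using interpolant_on_cell[OF w c(1), of F] interpolant_on_cell[OF w c(2), of F] x'(2) y'(2) by (simp_all add: interp_cell_def)
    then show ?thesis by (simp add: sum_subtractf right_diff_distrib)
  qed
  also have "\<bar>\<dots>\<bar> \<le> (\<Sum>a\<in>{1..4}. \<bar>jump n F w a * (bump a (psi_word u x') - bump a (psi_word u y'))\<bar>)" by (rule sum_abs)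
  also have "\<dots> \<le> (\<Sum>a\<in>{1..4}. \<bar>jump n F w a\<bar> * arm_osc a u)"
    unfolding abs_mult by (intro sum_mono mult_left_mono bump_osc[OF _ x'(1) y'(1) u]) auto
  finally show ?thesis .
qed

text \<open>The sum is at most the number of terms times the largest one, whose power is among the
  summands on the right.\<close>

lemma sum_powr_le:
  fixes x :: "'i \<Rightarrow> real"
  assumes A: "finite A" and x: "\<And>a. a \<in> A \<Longrightarrow> 0 \<le> x a" and p: "0 < p"
  shows "(\<Sum>a\<in>A. x a) powr p \<le> real (card A) powr p * (\<Sum>a\<in>A. x a powr p)"
proof (cases "A = {}")
  case True then show ?thesis using p by simp
next
  case False
  have "Max (x ` A) \<in> x ` A" using A False by (intro Max_in) auto
  then obtain m where mA: "m \<in> A" "Max (x ` A) = x m" by blast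
  then have m: "m \<in> A" "\<And>a. a \<in> A \<Longrightarrow> x a \<le> x m" using A Max_ge[of "x ` A"] by auto
  have "(\<Sum>a\<in>A. x a) \<le> real (card A) * x m" using sum_bounded_above[of A x "x m"] m(2) by simp
  then have "(\<Sum>a\<in>A. x a) powr p \<le> (real (card A) * x m) powr p"
    using x p by (intro powr_mono2) (auto intro: sum_nonneg)
  also have "\<dots> = real (card A) powr p * x m powr p" by (rule powr_mult)
  also have "\<dots> \<le> real (card A) powr p * (\<Sum>a\<in>A. x a powr p)"
    using m(1) A by (intro mult_left_mono member_le_sum) auto
  finally show ?thesis .
qed

lemma sum_arm_osc_le:
  assumes p: "0 < p" shows "(\<Sum>u\<in>words k. arm_osc a u powr p) \<le> 2 powr p / (3 powr (p - 1)) ^ k"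
proof -
  let ?U = "{u. set u \<subseteq> {a, opp a, 5} \<and> length u = k}"
  have "(\<Sum>u\<in>words k. arm_osc a u powr p) = (\<Sum>u\<in>words k \<inter> ?U. (2 / 3 ^ k) powr p)"
    using p by (intro sum.mono_neutral_cong_right finite_words) (auto simp: arm_osc_def words_def)
  also have "\<dots> = real (card (words k \<inter> ?U)) * (2 / 3 ^ k) powr p" by simp
  also have "\<dots> \<le> 3 ^ k * (2 / 3 ^ k) powr p"
  proof (rule mult_right_mono)
    have fin: "finite {a, opp a, 5}" by simp
    have "card (words k \<inter> ?U) \<le> card ?U" by (intro card_mono finite_lists_length_eq[OF fin]) auto
    also have "\<dots> = card {a, opp a, 5} ^ k" by (rule card_lists_length_eq[OF fin])
    also have "\<dots> \<le> 3 ^ k" by (intro power_mono) (auto simp: card_insert_if)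
    finally have "real (card (words k \<inter> ?U)) \<le> real (3 ^ k)" by (rule of_nat_mono)
    then show "real (card (words k \<inter> ?U)) \<le> 3 ^ k" by simp
  qed simp
  also have "\<dots> = 2 powr p / (3 powr (p - 1)) ^ k"
  proof -
    have "((3::real) ^ k) powr p = 3 ^ k * (3 powr (p - 1)) ^ k"
      using powr_add[of "(3::real) ^ k" 1 "p - 1"]
      by (simp add: powr_powr powr_realpow[symmetric] mult.commute)
    then show ?thesis by (simp add: powr_divide)
  qed
  finally show ?thesis .
qed

definition jump_sum :: "real \<Rightarrow> nat \<Rightarrow> (nat list \<Rightarrow> real) \<Rightarrow> nat list \<Rightarrow> real" where
  "jump_sum p n F w = (\<Sum>a\<in>{1..4}. \<bar>jump n F w a\<bar> powr p)"

lemma jump_sum_nonneg: "0 \<le> jump_sum p n F w" by (simp add: jump_sum_def sum_nonneg)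

text \<open>Points of two intersecting cells are compared through a common point, which bounds the
  difference by the two oscillations. Of the constants, \<open>16\<close> counts neighbours for both
  terms, one \<open>2 powr p\<close> splits the two oscillations, \<open>4 powr p\<close> the four
  arms, and the other \<open>2 powr p\<close> comes from \<open>arm_osc\<close>.\<close>

lemma interpolant_energy:
  assumes p: "1 \<le> p"
  shows "cell_energy p (interpolant n F) (n + k) \<le>
    ennreal (16 * 2 powr p * 4 powr p * 2 powr p * (1/5) ^ (n + k) / (3 powr (p - 1)) ^ k * (\<Sum>w\<in>words n. jump_sum p n F w))"
proof -
  let ?h = "interpolant n F"
  let ?m = "(1/5 :: real) ^ (n + k)"
  have p0: "0 < p" using p by simp
  \<comment> \<open>The first \<open>n\<close> letters name the coarse cell that carries the jumps,
    the remaining ones the position inside it.\<close>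
  define Os where "Os v = (\<Sum>a\<in>{1..4}. \<bar>jump n F (take n v) a\<bar> * arm_osc a (drop n v))" for v
  have Os0: "0 \<le> Os v" for v unfolding Os_def by (intro sum_nonneg mult_nonneg_nonneg arm_osc_nonneg) auto
  have osc: "\<bar>?h x - ?h y\<bar> \<le> Os v" if v: "v \<in> words (n + k)" and xy: "x \<in> vicsek_cell v" "y \<in> vicsek_cell v" for v x y
  proof -
    obtain w u where wu: "w \<in> words n" "u \<in> words k" "v = w @ u" using v unfolding words_add by fast
    have "\<bar>?h x - ?h y\<bar> \<le> (\<Sum>a\<in>{1..4}. \<bar>jump n F w a\<bar> * arm_osc a u)"
      by (rule interpolant_osc[OF wu(1,2)]) (use xy wu(3) in simp_all)
    then show ?thesis using wu(3) words_length[OF wu(1)] by (simp add: Os_def)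
  qed
  have d: "pair_energy p ?h (vicsek_cell v) (vicsek_cell v') \<le> ennreal (2 powr p * ?m * ?m) * (ennreal (Os v powr p) + ennreal (Os v' powr p))"
    if v: "v \<in> words (n + k)" "v' \<in> nbrs (n + k) v" for v v'
  proof -
    have v': "v' \<in> words (n + k)" using nbrs_words v by blast
    obtain z where z: "z \<in> vicsek_cell v" "z \<in> vicsek_cell v'" using v by (auto simp: nbrs_def)
    let ?b = "2 powr p * (Os v powr p + Os v' powr p)"
    have pt: "\<bar>?h y - ?h x\<bar> powr p \<le> ?b" if "x \<in> vicsek_cell v" "y \<in> vicsek_cell v'" for x y
    proof -
      have "\<bar>?h y - ?h x\<bar> \<le> Os v + Os v'" using osc[OF v(1) that(1) z(1)] osc[OF v' that(2) z(2)] by linarith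
      then have "\<bar>?h y - ?h x\<bar> powr p \<le> (Os v + Os v') powr p" using p by (intro powr_mono2) auto
      also have "\<dots> \<le> ?b" by (rule powr_add_le[OF p Os0 Os0])
      finally show ?thesis .
    qed
    note [measurable] = cell_sets[OF v(1)] cell_sets[OF v']
    have "pair_energy p ?h (vicsek_cell v) (vicsek_cell v') \<le> (\<integral>\<^sup>+x\<in>vicsek_cell v. (\<integral>\<^sup>+y\<in>vicsek_cell v'. ennreal ?b \<partial>vicsek_mu) \<partial>vicsek_mu)"
      unfolding pair_energy_def
    proof (rule nn_integral_mono)
      fix x
      show "(\<integral>\<^sup>+y\<in>vicsek_cell v'. ennreal (\<bar>?h y - ?h x\<bar> powr p) \<partial>vicsek_mu) * indicator (vicsek_cell v) x \<le>
        (\<integral>\<^sup>+y\<in>vicsek_cell v'. ennreal ?b \<partial>vicsek_mu) * indicator (vicsek_cell v) x"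
      proof (cases "x \<in> vicsek_cell v")
        case True
        have "(\<integral>\<^sup>+y\<in>vicsek_cell v'. ennreal (\<bar>?h y - ?h x\<bar> powr p) \<partial>vicsek_mu) \<le> (\<integral>\<^sup>+y\<in>vicsek_cell v'. ennreal ?b \<partial>vicsek_mu)"
          by (rule nn_integral_mono) (use pt[OF True] in \<open>auto simp: indicator_def intro!: ennreal_leI\<close>)
        then show ?thesis by (rule mult_right_mono) simp
      qed simp
    qed
    also have "\<dots> = ennreal ?b * ennreal ?m * ennreal ?m"
      by (simp only: nn_integral_cmult_indicator[OF cell_sets[OF v']] emeasure_cell[OF v'] nn_integral_cmult_indicator[OF cell_sets[OF v(1)]] emeasure_cell[OF v(1)])
    also have "\<dots> = ennreal (2 powr p * ?m * ?m) * (ennreal (Os v powr p) + ennreal (Os v' powr p))"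
      by (simp add: ennreal_mult[symmetric] ac_simps flip: ennreal_plus)
    finally show ?thesis .
  qed
  define SS where "SS = (\<Sum>v\<in>words (n + k). Os v powr p)"
  have SS: "(\<Sum>v\<in>words (n + k). ennreal (Os v powr p)) = ennreal SS" unfolding SS_def by (rule sum_ennreal) simp
  have SS0: "0 \<le> SS" unfolding SS_def by (rule sum_nonneg) simp
  have "cell_energy p ?h (n + k) \<le> 5 ^ (n + k) * (\<Sum>v\<in>words (n + k). \<Sum>v'\<in>nbrs (n + k) v.
      ennreal (2 powr p * ?m * ?m) * (ennreal (Os v powr p) + ennreal (Os v' powr p)))"
    unfolding cell_energy_def by (intro mult_left_mono sum_mono d) auto
  also have "\<dots> = 5 ^ (n + k) * (ennreal (2 powr p * ?m * ?m) * ((\<Sum>v\<in>words (n + k). \<Sum>v'\<in>nbrs (n + k) v. ennreal (Os v powr p)) + (\<Sum>v\<in>words (n + k). \<Sum>v'\<in>nbrs (n + k) v. ennreal (Os v' powr p))))"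
    by (simp only: sum_distrib_left distrib_left sum.distrib)
  also have "\<dots> \<le> 5 ^ (n + k) * (ennreal (2 powr p * ?m * ?m) * (8 * ennreal SS + 8 * ennreal SS))"
    unfolding SS[symmetric] by (intro mult_left_mono add_mono sum_nbrs_le) auto
  also have "\<dots> = ennreal (5 ^ (n + k) * (2 powr p * ?m * ?m * (8 * SS + 8 * SS)))"
  proof -
    have "8 * ennreal SS = ennreal (8 * SS)" using SS0 by (simp add: ennreal_mult)
    then have "8 * ennreal SS + 8 * ennreal SS = ennreal (8 * SS + 8 * SS)" using SS0 by (simp only: ennreal_plus mult_nonneg_nonneg zero_le_numeral)
    moreover have "(5::ennreal) ^ (n + k) = ennreal (5 ^ (n + k))" by (simp add: ennreal_power[symmetric])
    ultimately show ?thesis using SS0 by (simp only: ennreal_mult[symmetric] zero_le_mult_iff) (simp add: ennreal_mult)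
  qed
  also have "\<dots> \<le> ennreal (16 * 2 powr p * 4 powr p * 2 powr p * (1/5) ^ (n + k) / (3 powr (p - 1)) ^ k * (\<Sum>w\<in>words n. jump_sum p n F w))"
  proof (rule ennreal_leI)
    have "SS = (\<Sum>w\<in>words n. \<Sum>u\<in>words k. (\<Sum>a\<in>{1..4}. \<bar>jump n F w a\<bar> * arm_osc a u) powr p)"
      unfolding SS_def sum_words_add Os_def by (intro sum.cong refl) (simp add: words_length)
    also have "\<dots> \<le> (\<Sum>w\<in>words n. \<Sum>u\<in>words k. 4 powr p * (\<Sum>a\<in>{1..4}. (\<bar>jump n F w a\<bar> * arm_osc a u) powr p))"
      using sum_powr_le[of "{1..4::nat}" _ p] p0 arm_osc_nonneg by (intro sum_mono) fastforce
    also have "\<dots> = (\<Sum>w\<in>words n. 4 powr p * (\<Sum>a\<in>{1..4}. \<bar>jump n F w a\<bar> powr p * (\<Sum>u\<in>words k. arm_osc a u powr p)))"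
      by (intro sum.cong refl) (simp add: sum_distrib_left powr_mult sum.swap[of _ "words k"] mult.assoc)
    also have "\<dots> \<le> (\<Sum>w\<in>words n. 4 powr p * (\<Sum>a\<in>{1..4}. \<bar>jump n F w a\<bar> powr p * (2 powr p / (3 powr (p - 1)) ^ k)))"
      by (intro sum_mono mult_left_mono sum_arm_osc_le p0) auto
    also have "\<dots> = 4 powr p * (2 powr p / (3 powr (p - 1)) ^ k) * (\<Sum>w\<in>words n. jump_sum p n F w)"
    proof -
      have "(\<Sum>w\<in>words n. 4 powr p * (\<Sum>a\<in>{1..4}. \<bar>jump n F w a\<bar> powr p * c)) = 4 powr p * c * (\<Sum>w\<in>words n. jump_sum p n F w)" for c
        unfolding jump_sum_def sum_distrib_left by (intro sum.cong refl) (simp only: ac_simps)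
      then show ?thesis .
    qed
    finally have S: "SS \<le> 4 powr p * (2 powr p / (3 powr (p - 1)) ^ k) * (\<Sum>w\<in>words n. jump_sum p n F w)" .
    have "5 ^ (n + k) * (2 powr p * ?m * ?m * (8 * SS + 8 * SS)) = 16 * 2 powr p * ?m * SS"
      by (simp add: power_one_over field_simps)
    also have "\<dots> \<le> 16 * 2 powr p * ?m * (4 powr p * (2 powr p / (3 powr (p - 1)) ^ k) * (\<Sum>w\<in>words n. jump_sum p n F w))"
      by (intro mult_left_mono S) auto
    finally show "5 ^ (n + k) * (2 powr p * ?m * ?m * (8 * SS + 8 * SS)) \<le>
      16 * 2 powr p * 4 powr p * 2 powr p * (1/5) ^ (n + k) / (3 powr (p - 1)) ^ k * (\<Sum>w\<in>words n. jump_sum p n F w)"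
      by (simp add: ac_simps)
  qed
  finally show ?thesis .
qed

section \<open>Choice of the cell values and the resulting estimates\<close>

definition local_energy :: "real \<Rightarrow> (real^2 \<Rightarrow> real) \<Rightarrow> nat \<Rightarrow> nat list \<Rightarrow> ennreal" where
  "local_energy p f n w = (\<Sum>w'\<in>nbrs n w. pair_energy p f (vicsek_cell w) (vicsek_cell w'))"

lemma cell_energy_local: "cell_energy p f n = 5 ^ n * (\<Sum>w\<in>words n. local_energy p f n w)"
  by (simp add: cell_energy_def local_energy_def)

text \<open>Otherwise \<open>g\<close> would exceed its mean at every point of a set of positive
  measure, against strict monotonicity of the integral.\<close>

lemma nn_integral_attained_le:
  assumes [measurable]: "g \<in> borel_measurable M" "A \<in> sets M" and pos: "emeasure M A = ennreal m" "0 < m"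
  shows "\<exists>x\<in>A. g x * ennreal m \<le> (\<integral>\<^sup>+x\<in>A. g x \<partial>M)"
proof (rule ccontr)
  assume "\<not> ?thesis"
  then have gt: "(\<integral>\<^sup>+x\<in>A. g x \<partial>M) < g x * ennreal m" if "x \<in> A" for x using that by (auto simp: not_le)
  let ?I = "\<integral>\<^sup>+x\<in>A. g x \<partial>M"
  have "A \<noteq> {}" using pos by auto
  then obtain x0 where "x0 \<in> A" by blast
  \<comment> \<open>Strict monotonicity needs a finite integral. Finiteness is part of the
    contradiction hypothesis, since the integral is strictly below some value.\<close>
  then have fin: "?I < \<infinity>" using order_less_le_trans[OF gt top_greatest] by simp
  have c: "?I / ennreal m < g x" if "x \<in> A" for x
    using gt[OF that] pos(2) by (simp add: divide_less_ennreal)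
  have I: "(\<integral>\<^sup>+x. ?I / ennreal m * indicator A x \<partial>M) = ?I"
  proof -
    have "(\<integral>\<^sup>+x. ?I / ennreal m * indicator A x \<partial>M) = ?I / ennreal m * ennreal m"
      unfolding pos(1)[symmetric] by (rule nn_integral_cmult_indicator) fact
    also have "\<dots> = ?I" using pos(2) by (simp add: ennreal_divide_times ennreal_divide_self)
    finally show ?thesis .
  qed
  have "(\<integral>\<^sup>+x. ?I / ennreal m * indicator A x \<partial>M) < (\<integral>\<^sup>+x. g x * indicator A x \<partial>M)"
  proof (rule nn_integral_less)
    show "(\<integral>\<^sup>+x. ?I / ennreal m * indicator A x \<partial>M) \<noteq> \<infinity>" using I fin by auto
    show "AE x in M. ?I / ennreal m * indicator A x \<le> g x * indicator A x"
      using c by (auto simp: indicator_def less_imp_le)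
    show "\<not> (AE x in M. g x * indicator A x \<le> ?I / ennreal m * indicator A x)"
    proof
      assume "AE x in M. g x * indicator A x \<le> ?I / ennreal m * indicator A x"
      then have "AE x in M. x \<notin> A" by eventually_elim (use c in \<open>auto simp: indicator_def not_le[symmetric] split: if_splits\<close>)
      then have "emeasure M A = 0" by (subst (asm) AE_iff_null_sets[symmetric]) auto
      then show False using pos by simp
    qed
  qed measurable
  then show False using I by simp
qed

text \<open>The value of a cell is the value of \<open>f\<close> at a point where the local energy is at most average, rather than
  the mean of \<open>f\<close>: all estimates then remain inequalities between nonnegative integrals.\<close>

lemma good_cell_values:
  assumes f: "f \<in> borel_measurable vicsek_mu"
  obtains F where "\<And>w w'. w \<in> words n \<Longrightarrow> w' \<in> nbrs n w \<Longrightarrow>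
     (\<integral>\<^sup>+y\<in>vicsek_cell w'. ennreal (\<bar>f y - F w\<bar> powr p) \<partial>vicsek_mu) \<le> 5 ^ n * local_energy p f n w"
proof -
  note [measurable] = f
  have ex: "\<exists>c. \<forall>w'\<in>nbrs n w. (\<integral>\<^sup>+y\<in>vicsek_cell w'. ennreal (\<bar>f y - c\<bar> powr p) \<partial>vicsek_mu) \<le> 5 ^ n * local_energy p f n w"
    if w: "w \<in> words n" for w
  proof -
    note [measurable] = cell_sets[OF w] cell_sets[OF nbrs_words]
    \<comment> \<open>Summing over all neighbours before the point is chosen makes a single value
      good for all of them at once.\<close>
    define g where "g x = (\<Sum>w'\<in>nbrs n w. \<integral>\<^sup>+y\<in>vicsek_cell w'. ennreal (\<bar>f y - f x\<bar> powr p) \<partial>vicsek_mu)" for x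
    have gm[measurable]: "g \<in> borel_measurable vicsek_mu" unfolding g_def by measurable
    obtain x where x: "x \<in> vicsek_cell w" "g x * ennreal ((1/5) ^ n) \<le> (\<integral>\<^sup>+x\<in>vicsek_cell w. g x \<partial>vicsek_mu)"
      using nn_integral_attained_le[OF gm cell_sets[OF w] emeasure_cell[OF w]] by auto
    have "(\<integral>\<^sup>+x\<in>vicsek_cell w. g x \<partial>vicsek_mu) = local_energy p f n w"
      unfolding g_def local_energy_def pair_energy_def sum_distrib_right by (rule nn_integral_sum) measurable
    then have le: "g x * ennreal ((1/5) ^ n) \<le> local_energy p f n w" using x(2) by simp
    have five: "5 ^ n * ennreal ((1/5) ^ n) = 1"
    proof -
      have "5 ^ n * ennreal ((1/5) ^ n) = ennreal (5 ^ n * (1/5) ^ n)" by (simp add: ennreal_mult ennreal_power[symmetric])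
      then show ?thesis by (simp flip: power_mult_distrib)
    qed
    have "g x = 5 ^ n * (g x * ennreal ((1/5) ^ n))" using five by (metis mult.assoc mult.commute mult_1_left)
    also have "\<dots> \<le> 5 ^ n * local_energy p f n w" by (intro mult_left_mono le) simp
    finally have "g x \<le> 5 ^ n * local_energy p f n w" .
    moreover have "(\<integral>\<^sup>+y\<in>vicsek_cell w'. ennreal (\<bar>f y - f x\<bar> powr p) \<partial>vicsek_mu) \<le> g x" if "w' \<in> nbrs n w" for w'
      unfolding g_def using that by (intro member_le_sum) auto
    ultimately show ?thesis by (intro exI[of _ "f x"]) (auto intro: order_trans)
  qed
  then have "\<forall>w\<in>words n. \<exists>c. \<forall>w'\<in>nbrs n w. (\<integral>\<^sup>+y\<in>vicsek_cell w'. ennreal (\<bar>f y - c\<bar> powr p) \<partial>vicsek_mu) \<le> 5 ^ n * local_energy p f n w"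
    by (intro ballI)
  from bchoice[OF this] obtain F where F: "\<forall>w\<in>words n. \<forall>w'\<in>nbrs n w. (\<integral>\<^sup>+y\<in>vicsek_cell w'. ennreal (\<bar>f y - F w\<bar> powr p) \<partial>vicsek_mu) \<le> 5 ^ n * local_energy p f n w"
    by (elim exE)
  show ?thesis by (rule that) (rule F[rule_format])
qed

lemma ennreal_powr_add_le:
  assumes p: "1 \<le> p"
  shows "ennreal (\<bar>a + b\<bar> powr p) \<le> ennreal (2 powr p) * (ennreal (\<bar>a\<bar> powr p) + ennreal (\<bar>b\<bar> powr p))"
proof -
  have "\<bar>a + b\<bar> powr p \<le> (\<bar>a\<bar> + \<bar>b\<bar>) powr p" using p by (intro powr_mono2) auto
  also have "\<dots> \<le> 2 powr p * (\<bar>a\<bar> powr p + \<bar>b\<bar> powr p)" by (rule powr_add_le[OF p]) auto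
  finally show ?thesis by (simp add: ennreal_mult[symmetric] flip: ennreal_plus)
qed

lemma five_power_cancel: "ennreal ((1/5) ^ n) * 5 ^ n = 1"
proof -
  have "ennreal ((1/5) ^ n) * 5 ^ n = ennreal ((1/5) ^ n * 5 ^ n)" by (simp add: ennreal_mult ennreal_power[symmetric])
  then show ?thesis by (simp flip: power_mult_distrib)
qed

text \<open>Both values are compared with \<open>f\<close> on the cell of \<open>w'\<close>: it is a
  neighbour of \<open>w\<close>, and a neighbour of itself. One \<open>5 ^ n\<close> comes from the
  choice of the values, the other undoes the mass of the cell.\<close>

lemma cell_value_differences:
  assumes f: "f \<in> borel_measurable vicsek_mu" and p: "1 \<le> p"
    and F: "\<And>w w'. w \<in> words n \<Longrightarrow> w' \<in> nbrs n w \<Longrightarrow>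
     (\<integral>\<^sup>+y\<in>vicsek_cell w'. ennreal (\<bar>f y - F w\<bar> powr p) \<partial>vicsek_mu) \<le> 5 ^ n * local_energy p f n w"
    and w: "w \<in> words n" "w' \<in> nbrs n w"
  shows "ennreal (\<bar>F w' - F w\<bar> powr p) \<le> ennreal (2 powr p) * 25 ^ n * (local_energy p f n w + local_energy p f n w')"
proof -
  note [measurable] = f
  have w': "w' \<in> words n" using nbrs_words w by blast
  note [measurable] = cell_sets[OF w']
  let ?c = "ennreal (2 powr p)"
  have "ennreal (\<bar>F w' - F w\<bar> powr p) * ennreal ((1/5) ^ n) = (\<integral>\<^sup>+y. ennreal (\<bar>F w' - F w\<bar> powr p) * indicator (vicsek_cell w') y \<partial>vicsek_mu)"
    by (simp add: nn_integral_cmult_indicator emeasure_cell[OF w'])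
  also have "\<dots> \<le> (\<integral>\<^sup>+y. ?c * (ennreal (\<bar>f y - F w\<bar> powr p) * indicator (vicsek_cell w') y) + ?c * (ennreal (\<bar>f y - F w'\<bar> powr p) * indicator (vicsek_cell w') y) \<partial>vicsek_mu)"
  proof (rule nn_integral_mono)
    fix y
    show "ennreal (\<bar>F w' - F w\<bar> powr p) * indicator (vicsek_cell w') y \<le>
      ?c * (ennreal (\<bar>f y - F w\<bar> powr p) * indicator (vicsek_cell w') y) + ?c * (ennreal (\<bar>f y - F w'\<bar> powr p) * indicator (vicsek_cell w') y)"
      using ennreal_powr_add_le[OF p, of "f y - F w" "F w' - f y"]
      by (simp add: indicator_def abs_minus_commute[of "F w'" "f y"] distrib_left)
  qed
  also have "\<dots> = ?c * (\<integral>\<^sup>+y\<in>vicsek_cell w'. ennreal (\<bar>f y - F w\<bar> powr p) \<partial>vicsek_mu) + ?c * (\<integral>\<^sup>+y\<in>vicsek_cell w'. ennreal (\<bar>f y - F w'\<bar> powr p) \<partial>vicsek_mu)"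
    by (subst nn_integral_add) (auto simp: nn_integral_cmult)
  also have "\<dots> \<le> ?c * (5 ^ n * local_energy p f n w) + ?c * (5 ^ n * local_energy p f n w')"
    by (intro add_mono mult_left_mono F w w' nbrs_self) auto
  finally have "5 ^ n * (ennreal (\<bar>F w' - F w\<bar> powr p) * ennreal ((1/5) ^ n)) \<le> 5 ^ n * (?c * (5 ^ n * local_energy p f n w) + ?c * (5 ^ n * local_energy p f n w'))"
    by (rule mult_left_mono) simp
  moreover have "5 ^ n * (X * ennreal ((1/5) ^ n)) = X" for X :: ennreal
    using five_power_cancel[of n] by (metis mult.assoc mult.commute mult_1_left)
  moreover have "5 ^ n * (?c * (5 ^ n * A) + ?c * (5 ^ n * B)) = ?c * 25 ^ n * (A + B)" for A B :: ennreal
  proof -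
    have "(25::ennreal) ^ n = 5 ^ n * 5 ^ n" by (simp flip: power_mult_distrib)
    then show ?thesis by (simp only: distrib_left distrib_right ac_simps)
  qed
  ultimately show ?thesis by simp
qed

text \<open>A jump compares \<open>w\<close> with the cell chosen at one of its corners, which is a
  neighbour. The constant \<open>64\<close> is four corners times \<open>8 + 8\<close>.\<close>

lemma jump_sum_total:
  assumes f: "f \<in> borel_measurable vicsek_mu" and p: "1 \<le> p"
    and F: "\<And>w w'. w \<in> words n \<Longrightarrow> w' \<in> nbrs n w \<Longrightarrow>
     (\<integral>\<^sup>+y\<in>vicsek_cell w'. ennreal (\<bar>f y - F w\<bar> powr p) \<partial>vicsek_mu) \<le> 5 ^ n * local_energy p f n w"
  shows "ennreal (\<Sum>w\<in>words n. jump_sum p n F w) \<le> ennreal (64 * 2 powr p) * 5 ^ n * cell_energy p f n"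
proof -
  let ?R = "local_energy p f n" and ?c = "ennreal (2 powr p)"
  have J: "ennreal (jump_sum p n F w) \<le> 4 * (\<Sum>w'\<in>nbrs n w. ?c * 25 ^ n * (?R w + ?R w'))" if w: "w \<in> words n" for w
  proof -
    have "ennreal (jump_sum p n F w) = (\<Sum>a\<in>{1..4}. ennreal (\<bar>jump n F w a\<bar> powr p))"
      unfolding jump_sum_def by (rule sum_ennreal[symmetric]) simp
    also have "\<dots> \<le> (\<Sum>a\<in>{1..4::nat}. \<Sum>w'\<in>nbrs n w. ?c * 25 ^ n * (?R w + ?R w'))"
    proof (rule sum_mono)
      fix a :: nat assume a: "a \<in> {1..4}"
      have qK: "vicsek_q a \<in> vicsek_K" using q_K a by auto
      let ?z = "psi_word w (vicsek_q a)" and ?w' = "cell_of n (psi_word w (vicsek_q a))"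
      have "?w' \<in> nbrs n w"
        using cell_of[OF psi_word_K[OF w qK], of n] qK by (auto simp: nbrs_def cell_eq)
      then show "ennreal (\<bar>jump n F w a\<bar> powr p) \<le> (\<Sum>w'\<in>nbrs n w. ?c * 25 ^ n * (?R w + ?R w'))"
        unfolding jump_def
        using cell_value_differences[OF f p F w, of ?w'] by (intro order_trans[OF _ member_le_sum[of ?w']]) auto
    qed
    also have "\<dots> = 4 * (\<Sum>w'\<in>nbrs n w. ?c * 25 ^ n * (?R w + ?R w'))" by simp
    finally show ?thesis .
  qed
  have "ennreal (\<Sum>w\<in>words n. jump_sum p n F w) = (\<Sum>w\<in>words n. ennreal (jump_sum p n F w))"
    by (rule sum_ennreal[symmetric]) (rule jump_sum_nonneg)
  also have "\<dots> \<le> (\<Sum>w\<in>words n. 4 * (\<Sum>w'\<in>nbrs n w. ?c * 25 ^ n * (?R w + ?R w')))" by (intro sum_mono J)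
  also have "\<dots> = 4 * (?c * 25 ^ n * ((\<Sum>w\<in>words n. \<Sum>w'\<in>nbrs n w. ?R w) + (\<Sum>w\<in>words n. \<Sum>w'\<in>nbrs n w. ?R w')))"
    by (simp only: sum_distrib_left distrib_left sum.distrib)
  also have "\<dots> \<le> 4 * (?c * 25 ^ n * (8 * (\<Sum>w\<in>words n. ?R w) + 8 * (\<Sum>w\<in>words n. ?R w)))"
    by (intro mult_left_mono add_mono sum_nbrs_le) auto
  also have "\<dots> = ennreal (64 * 2 powr p) * 5 ^ n * cell_energy p f n"
  proof -
    have "(25::ennreal) ^ n = 5 ^ n * 5 ^ n" by (simp flip: power_mult_distrib)
    moreover have S: "8 * S + 8 * S = 16 * S" for S :: ennreal by (simp flip: distrib_right)
    moreover have "ennreal (64 * 2 powr p) = (4 * 16) * ?c" by (simp add: ennreal_mult')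
    ultimately show ?thesis unfolding cell_energy_local S by (simp only: ac_simps)
  qed
  finally show ?thesis .
qed

text \<open>One constant for two estimates: the factor \<open>1024 = 16 * 64\<close> combines
  \<open>interpolant_energy\<close> with \<open>jump_sum_total\<close>, and together with the
  summand \<open>2 powr p\<close> it dominates the \<open>L\<^sup>p\<close> error.\<close>

definition approx_const :: "real \<Rightarrow> real" where
  "approx_const p = 2 powr p + 1024 * 2 powr p * 4 powr p * 2 powr p * 2 powr p"

text \<open>On a cell the error is \<open>f - F w\<close> plus \<open>F w\<close> minus the
  interpolant. The first part is small by the choice of \<open>F\<close>; the second is at most the
  sum of the jumps, as the bumps are bounded by \<open>1\<close>.\<close>

lemma interpolant_approximates:
  assumes f: "f \<in> borel_measurable vicsek_mu" and p: "1 \<le> p"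
    and F: "\<And>w w'. w \<in> words n \<Longrightarrow> w' \<in> nbrs n w \<Longrightarrow>
     (\<integral>\<^sup>+y\<in>vicsek_cell w'. ennreal (\<bar>f y - F w\<bar> powr p) \<partial>vicsek_mu) \<le> 5 ^ n * local_energy p f n w"
  shows "(\<integral>\<^sup>+x. ennreal (\<bar>f x - interpolant n F x\<bar> powr p) \<partial>vicsek_mu) \<le> ennreal (approx_const p) * cell_energy p f n"
proof -
  let ?h = "interpolant n F" and ?R = "local_energy p f n" and ?J = "jump_sum p n F" and ?c = "ennreal (2 powr p)"
  note hm = measurable_continuous_K[OF continuous_interpolant[of n F]]
  note [measurable] = f hm
  have p0: "0 < p" using p by simp
  have cell: "(\<integral>\<^sup>+x\<in>vicsek_cell w. ennreal (\<bar>f x - ?h x\<bar> powr p) \<partial>vicsek_mu) \<le>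
      ?c * (5 ^ n * ?R w) + ?c * (ennreal (4 powr p * ?J w) * ennreal ((1/5) ^ n))" if w: "w \<in> words n" for w
  proof -
    note [measurable] = cell_sets[OF w]
    have pt: "ennreal (\<bar>f x - ?h x\<bar> powr p) \<le> ?c * ennreal (\<bar>f x - F w\<bar> powr p) + ?c * ennreal (4 powr p * ?J w)"
      if x: "x \<in> vicsek_cell w" for x
    proof -
      obtain x' where x': "x' \<in> vicsek_K" "x = psi_word w x'" using x by (auto simp: cell_eq)
      have "\<bar>F w - ?h x\<bar> = \<bar>\<Sum>a\<in>{1..4}. jump n F w a * bump a x'\<bar>"
        using interpolant_on_cell[OF w x, of F] x'(2) by (simp add: interp_cell_def)
      also have "\<dots> \<le> (\<Sum>a\<in>{1..4}. \<bar>jump n F w a * bump a x'\<bar>)" by (rule sum_abs)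
      also have "\<dots> \<le> (\<Sum>a\<in>{1..4}. \<bar>jump n F w a\<bar>)"
        using bump_bounds[OF _ x'(1)] by (intro sum_mono) (auto simp: abs_mult intro!: mult_left_le)
      finally have "\<bar>F w - ?h x\<bar> powr p \<le> (\<Sum>a\<in>{1..4}. \<bar>jump n F w a\<bar>) powr p" using p by (intro powr_mono2) auto
      also have "\<dots> \<le> 4 powr p * ?J w"
        using sum_powr_le[of "{1..4::nat}" "\<lambda>a. \<bar>jump n F w a\<bar>", OF _ _ p0] by (simp add: jump_sum_def)
      finally have "ennreal (\<bar>F w - ?h x\<bar> powr p) \<le> ennreal (4 powr p * ?J w)" by (rule ennreal_leI)
      then have "?c * (ennreal (\<bar>f x - F w\<bar> powr p) + ennreal (\<bar>F w - ?h x\<bar> powr p)) \<le>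
          ?c * (ennreal (\<bar>f x - F w\<bar> powr p) + ennreal (4 powr p * ?J w))" by (intro mult_left_mono add_left_mono) auto
      with ennreal_powr_add_le[OF p, of "f x - F w" "F w - ?h x"]
      have "ennreal (\<bar>f x - ?h x\<bar> powr p) \<le> ?c * (ennreal (\<bar>f x - F w\<bar> powr p) + ennreal (4 powr p * ?J w))"
        by (auto intro: order_trans)
      then show ?thesis by (simp only: distrib_left)
    qed
    have "(\<integral>\<^sup>+x\<in>vicsek_cell w. ennreal (\<bar>f x - ?h x\<bar> powr p) \<partial>vicsek_mu) \<le>
      (\<integral>\<^sup>+x. ?c * (ennreal (\<bar>f x - F w\<bar> powr p) * indicator (vicsek_cell w) x) + ?c * ennreal (4 powr p * ?J w) * indicator (vicsek_cell w) x \<partial>vicsek_mu)"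
      using pt by (intro nn_integral_mono) (auto simp: indicator_def)
    also have "\<dots> = ?c * (\<integral>\<^sup>+x\<in>vicsek_cell w. ennreal (\<bar>f x - F w\<bar> powr p) \<partial>vicsek_mu) + ?c * ennreal (4 powr p * ?J w) * ennreal ((1/5) ^ n)"
      by (subst nn_integral_add) (simp_all add: nn_integral_cmult nn_integral_cmult_indicator emeasure_cell[OF w])
    also have "\<dots> \<le> ?c * (5 ^ n * ?R w) + ?c * ennreal (4 powr p * ?J w) * ennreal ((1/5) ^ n)"
      by (intro add_right_mono mult_left_mono F w nbrs_self) auto
    finally show ?thesis by (simp only: mult.assoc)
  qed
  have "(\<integral>\<^sup>+x. ennreal (\<bar>f x - ?h x\<bar> powr p) \<partial>vicsek_mu) \<le> (\<integral>\<^sup>+x. (\<Sum>w\<in>words n. ennreal (\<bar>f x - ?h x\<bar> powr p) * indicator (vicsek_cell w) x) \<partial>vicsek_mu)"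
  proof (rule nn_integral_mono)
    fix x assume "x \<in> space vicsek_mu"
    then obtain w where w: "w \<in> words n" "x \<in> vicsek_cell w" using cell_exists[of x n] by auto
    have "ennreal (\<bar>f x - ?h x\<bar> powr p) = ennreal (\<bar>f x - ?h x\<bar> powr p) * indicator (vicsek_cell w) x" using w by simp
    also have "\<dots> \<le> (\<Sum>w\<in>words n. ennreal (\<bar>f x - ?h x\<bar> powr p) * indicator (vicsek_cell w) x)"
      using w by (intro member_le_sum) auto
    finally show "ennreal (\<bar>f x - ?h x\<bar> powr p) \<le> (\<Sum>w\<in>words n. ennreal (\<bar>f x - ?h x\<bar> powr p) * indicator (vicsek_cell w) x)" .
  qed
  also have "\<dots> = (\<Sum>w\<in>words n. \<integral>\<^sup>+x\<in>vicsek_cell w. ennreal (\<bar>f x - ?h x\<bar> powr p) \<partial>vicsek_mu)"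
    by (rule nn_integral_sum) (use cell_sets in measurable)
  also have "\<dots> \<le> (\<Sum>w\<in>words n. ?c * (5 ^ n * ?R w) + ?c * (ennreal (4 powr p * ?J w) * ennreal ((1/5) ^ n)))"
    by (intro sum_mono cell)
  also have "\<dots> = ?c * cell_energy p f n + ?c * (ennreal (4 powr p) * (ennreal ((1/5) ^ n) * ennreal (\<Sum>w\<in>words n. ?J w)))"
  proof -
    have "ennreal (\<Sum>w\<in>words n. ?J w) = (\<Sum>w\<in>words n. ennreal (?J w))" by (rule sum_ennreal[symmetric]) (rule jump_sum_nonneg)
    moreover have "ennreal (4 powr p * ?J w) * ennreal ((1/5) ^ n) = ennreal (4 powr p) * (ennreal ((1/5) ^ n) * ennreal (?J w))" for w
      by (simp add: ennreal_mult jump_sum_nonneg ac_simps)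
    ultimately show ?thesis by (simp only: cell_energy_local sum.distrib sum_distrib_left)
  qed
  also have "\<dots> \<le> ?c * cell_energy p f n + ?c * (ennreal (4 powr p) * (ennreal ((1/5) ^ n) * (ennreal (64 * 2 powr p) * 5 ^ n * cell_energy p f n)))"
    by (intro add_left_mono mult_left_mono jump_sum_total[OF f p F]) auto
  also have "\<dots> = ?c * cell_energy p f n + ?c * (ennreal (4 powr p) * (ennreal (64 * 2 powr p) * cell_energy p f n))"
  proof -
    have "ennreal ((1/5) ^ n) * (a * 5 ^ n * b) = a * b" for a b :: ennreal
      using five_power_cancel[of n] by (metis mult.assoc mult.commute mult_1_left)
    then show ?thesis by simp
  qed
  also have "\<dots> = ennreal (2 powr p + 2 powr p * (4 powr p * (64 * 2 powr p))) * cell_energy p f n"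
    by (simp add: ennreal_plus ennreal_mult distrib_right mult.assoc)
  also have "\<dots> \<le> ennreal (approx_const p) * cell_energy p f n"
  proof (intro mult_right_mono ennreal_leI)
    have "1 \<le> (2::real) powr p" using p by (intro ge_one_powr_ge_zero) auto
    then have "1 * 1 \<le> (2::real) powr p * 2 powr p" by (intro mult_mono) auto
    then have "64 * (2 powr p * 4 powr p * 2 powr p) * 1 \<le> 1024 * (2 powr p * 4 powr p * 2 powr p) * (2 powr p :: real)"
      using \<open>1 \<le> 2 powr p\<close> by (intro mult_mono) auto
    then show "2 powr p + 2 powr p * (4 powr p * (64 * 2 powr p)) \<le> approx_const p"
      by (simp add: approx_const_def ac_simps)
  qed simp
  finally show ?thesis .
qed

lemma interpolant_energy_le:
  assumes f: "f \<in> borel_measurable vicsek_mu" and p: "1 \<le> p"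
    and F: "\<And>w w'. w \<in> words n \<Longrightarrow> w' \<in> nbrs n w \<Longrightarrow>
     (\<integral>\<^sup>+y\<in>vicsek_cell w'. ennreal (\<bar>f y - F w\<bar> powr p) \<partial>vicsek_mu) \<le> 5 ^ n * local_energy p f n w"
  shows "cell_energy p (interpolant n F) (n + k) \<le> ennreal (approx_const p / (5 * 3 powr (p - 1)) ^ k) * cell_energy p f n"
proof -
  let ?B = "16 * 2 powr p * 4 powr p * 2 powr p * (1/5) ^ (n + k) / (3 powr (p - 1)) ^ k"
  have "cell_energy p (interpolant n F) (n + k) \<le> ennreal (?B * (\<Sum>w\<in>words n. jump_sum p n F w))"
    by (rule interpolant_energy[OF p])
  also have "\<dots> = ennreal ?B * ennreal (\<Sum>w\<in>words n. jump_sum p n F w)"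
    by (rule ennreal_mult) (auto intro: sum_nonneg jump_sum_nonneg)
  also have "\<dots> \<le> ennreal ?B * (ennreal (64 * 2 powr p) * 5 ^ n * cell_energy p f n)"
    by (intro mult_left_mono jump_sum_total[OF f p F]) auto
  also have "\<dots> = ennreal (?B * (64 * 2 powr p * 5 ^ n)) * cell_energy p f n"
  proof -
    have "(5::ennreal) ^ n = ennreal (5 ^ n)" by (simp add: ennreal_power[symmetric])
    moreover have "ennreal b * (ennreal c * ennreal d * E) = ennreal (b * (c * d)) * E" if "0 \<le> b" "0 \<le> c" "0 \<le> d" for b c d E
      using that by (simp add: ennreal_mult mult.assoc)
    ultimately show ?thesis by simp
  qed
  also have "\<dots> \<le> ennreal (approx_const p / (5 * 3 powr (p - 1)) ^ k) * cell_energy p f n"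
  proof (intro mult_right_mono ennreal_leI)
    have "?B * (64 * 2 powr p * 5 ^ n) = 1024 * 2 powr p * 4 powr p * 2 powr p * 2 powr p / (5 * 3 powr (p - 1)) ^ k"
      by (simp add: power_add power_one_over power_mult_distrib field_simps)
    also have "\<dots> \<le> approx_const p / (5 * 3 powr (p - 1)) ^ k"
      by (intro divide_right_mono) (auto simp: approx_const_def)
    finally show "?B * (64 * 2 powr p * 5 ^ n) \<le> approx_const p / (5 * 3 powr (p - 1)) ^ k" .
  qed simp
  finally show ?thesis .
qed

section \<open>Real powers of extended nonnegative numbers\<close>

lemma power_powr_swap:
  fixes b a :: real assumes "0 < b" shows "(b ^ k) powr a = (b powr a) ^ k"
proof -
  have "(b ^ k) powr a = (b powr real k) powr a" using assms by (simp add: powr_realpow)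
  also have "\<dots> = (b powr a) powr real k" by (simp add: powr_powr mult.commute)
  also have "\<dots> = (b powr a) ^ k" using assms by (simp add: powr_realpow)
  finally show ?thesis .
qed

lemma ennreal_powr_mono: "0 \<le> a \<Longrightarrow> x \<le> y \<Longrightarrow> ennreal_powr x a \<le> ennreal_powr y a"
  unfolding ennreal_powr_def
  by (cases x; cases y) (auto intro!: ennreal_leI powr_mono2 simp: top_unique)

lemma ennreal_powr_cmult:
  assumes "0 < c" shows "ennreal_powr (ennreal c * x) a = ennreal (c powr a) * ennreal_powr x a"
  using assms by (cases x) (auto simp: ennreal_powr_def ennreal_mult_top ennreal_mult[symmetric] powr_mult enn2real_mult)

lemma ennreal_powr_add:
  assumes p: "1 \<le> p" shows "ennreal_powr (x + y) (1 / p) \<le> 2 * (ennreal_powr x (1 / p) + ennreal_powr y (1 / p))"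
proof -
  have a: "0 \<le> 1 / p" "1 / p \<le> 1" using p by auto
  have "x + y \<le> ennreal 2 * max x y" by (auto simp: mult_2 max_def intro: add_mono)
  then have "ennreal_powr (x + y) (1 / p) \<le> ennreal (2 powr (1 / p)) * ennreal_powr (max x y) (1 / p)"
    using ennreal_powr_mono[OF a(1)] ennreal_powr_cmult[of 2 "max x y" "1 / p"] by (metis zero_less_numeral)
  also have "\<dots> \<le> ennreal 2 * (ennreal_powr x (1 / p) + ennreal_powr y (1 / p))"
  proof (intro mult_mono ennreal_leI)
    show "2 powr (1 / p) \<le> (2::real)" using powr_mono[OF a(2), of 2] by simp
    show "ennreal_powr (max x y) (1 / p) \<le> ennreal_powr x (1 / p) + ennreal_powr y (1 / p)" by (simp add: max_def)
  qed auto
  finally show ?thesis by simp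
qed

lemma ennreal_powr_less_top [simp]: "ennreal_powr x a < top \<longleftrightarrow> x < top"
  by (cases x) (auto simp: ennreal_powr_def)

subsection \<open>Root energies\<close>

definition root_energy :: "real \<Rightarrow> (real^2 \<Rightarrow> real) \<Rightarrow> nat \<Rightarrow> ennreal" where
  "root_energy p f n = ennreal_powr (cell_energy p f n) (1 / p)"

definition root_E :: "real \<Rightarrow> (real^2 \<Rightarrow> real) \<Rightarrow> real \<Rightarrow> ennreal" where
  "root_E p f r = ennreal_powr (vicsek_E p f r) (1 / p)"

lemma ennreal_powr_le_cmult:
  assumes "x \<le> ennreal c * y" "0 < c" "0 \<le> a"
  shows "ennreal_powr x a \<le> ennreal (c powr a) * ennreal_powr y a"
  using ennreal_powr_mono[OF assms(3,1)] ennreal_powr_cmult[OF assms(2)] by simp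

text \<open>By \<open>5 = 3 powr vicsek_dh\<close> the base on the left is
  \<open>3 powr (p * vicsek_alpha p)\<close>; this is where the critical exponent enters.\<close>

lemma three_powr_alpha:
  assumes p: "1 \<le> p"
  shows "(5 * 3 powr (p - 1)) powr (1 / p) = 3 powr vicsek_alpha p"
proof -
  have "5 = 3 powr vicsek_dh" by (simp add: vicsek_dh_def powr_def)
  then have "5 * 3 powr (p - 1) = 3 powr (vicsek_dh + (p - 1))" by (simp add: powr_add)
  then have "(5 * 3 powr (p - 1)) powr (1 / p) = 3 powr ((vicsek_dh + (p - 1)) * (1 / p))" by (simp add: powr_powr)
  also have "(vicsek_dh + (p - 1)) * (1 / p) = vicsek_alpha p" using p by (simp add: vicsek_alpha_def field_simps)
  finally show ?thesis .
qed

lemma alpha_pos: "1 < p \<Longrightarrow> 0 < vicsek_alpha p"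
  by (auto simp: vicsek_alpha_def vicsek_dh_def intro!: add_pos_pos divide_pos_pos)

lemma root_energy_le_E:
  assumes "f \<in> borel_measurable vicsek_mu" "1 \<le> p"
  shows "root_energy p f n \<le> ennreal (800 powr (1 / p)) * root_E p f (4 / 3 ^ n)"
  unfolding root_energy_def root_E_def
  using cell_energy_le_E[OF assms(1), of p n] assms(2) by (intro ennreal_powr_le_cmult) auto

lemma root_E_le_energy:
  assumes "f \<in> borel_measurable vicsek_mu" "0 < r" "1 \<le> p"
  obtains n where "2 / 3 ^ Suc n \<le> r" "root_E p f r \<le> ennreal (5 powr (1 / p)) * root_energy p f n"
proof -
  obtain n where n: "2 / 3 ^ Suc n \<le> r" "vicsek_E p f r \<le> 5 * cell_energy p f n"
    using E_le_cell_energy[OF assms(1,2)] by blast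
  then have "root_E p f r \<le> ennreal (5 powr (1 / p)) * root_energy p f n"
    unfolding root_energy_def root_E_def using assms(3) by (intro ennreal_powr_le_cmult) auto
  then show ?thesis using that n by blast
qed

lemma root_energy_le_norm:
  assumes "g \<in> borel_measurable vicsek_mu" "1 \<le> p"
  shows "root_energy p g n \<le> ennreal ((32 * 2 powr p) powr (1 / p)) * Lp_norm vicsek_mu p g"
  unfolding root_energy_def Lp_norm_def
  by (rule ennreal_powr_le_cmult[OF cell_energy_le_norm[OF assms]]) (use assms in auto)

lemma root_energy_add:
  assumes "g \<in> borel_measurable vicsek_mu" "h \<in> borel_measurable vicsek_mu" and p: "1 \<le> p"
  shows "root_energy p (\<lambda>x. g x + h x) n \<le> 4 * (root_energy p g n + root_energy p h n)"
proof -
  have "root_energy p (\<lambda>x. g x + h x) n \<le> ennreal ((2 powr p) powr (1 / p)) * ennreal_powr (cell_energy p g n + cell_energy p h n) (1 / p)"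
    unfolding root_energy_def by (rule ennreal_powr_le_cmult[OF cell_energy_add[OF assms]]) (use p in auto)
  also have "\<dots> = 2 * ennreal_powr (cell_energy p g n + cell_energy p h n) (1 / p)" using p by (simp add: powr_powr)
  also have "\<dots> \<le> 2 * (2 * (root_energy p g n + root_energy p h n))"
    unfolding root_energy_def by (intro mult_left_mono ennreal_powr_add p) auto
  finally show ?thesis by (simp add: mult.assoc[symmetric])
qed

lemma root_energy_mono:
  assumes "f \<in> borel_measurable vicsek_mu" and p: "1 \<le> p"
  shows "root_energy p f n \<le> ennreal ((24 * 4 powr (p - 1)) powr (1 / p) * (3 powr vicsek_alpha p) ^ k) * root_energy p f (n + k)"
proof -
  have "root_energy p f n \<le> ennreal ((24 * 4 powr (p - 1) * (5 * 3 powr (p - 1)) ^ k) powr (1 / p)) * root_energy p f (n + k)"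
    unfolding root_energy_def by (rule ennreal_powr_le_cmult[OF cell_energy_mono[OF assms]]) (use p in auto)
  also have "(24 * 4 powr (p - 1) * (5 * 3 powr (p - 1)) ^ k) powr (1 / p) = (24 * 4 powr (p - 1)) powr (1 / p) * (3 powr vicsek_alpha p) ^ k"
    unfolding three_powr_alpha[OF p, symmetric]
    by (subst power_powr_swap[symmetric], simp) (rule powr_mult)
  finally show ?thesis .
qed

lemma bounded_in_Lp:
  assumes h: "continuous_on vicsek_K h" and p: "1 \<le> p"
  shows "h \<in> Lp vicsek_mu p"
proof -
  have "bounded (h ` vicsek_K)" by (intro compact_imp_bounded compact_continuous_image h compact_K)
  then obtain B where B: "\<And>x. x \<in> vicsek_K \<Longrightarrow> \<bar>h x\<bar> \<le> B" by (auto simp: bounded_iff)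
  have "(\<integral>\<^sup>+x. ennreal (\<bar>h x\<bar> powr p) \<partial>vicsek_mu) \<le> (\<integral>\<^sup>+x. ennreal (B powr p) \<partial>vicsek_mu)"
    using B p by (intro nn_integral_mono ennreal_leI powr_mono2) auto
  also have "\<dots> = ennreal (B powr p)" using mu.emeasure_space_1 by simp
  also have "\<dots> < \<infinity>" by simp
  finally show ?thesis using measurable_continuous_K[OF h] by (simp add: Lp_def Lp_norm_def)
qed

lemma Lp_norm_finite_iff: "Lp_norm M p g < top \<longleftrightarrow> (\<integral>\<^sup>+x. ennreal (\<bar>g x\<bar> powr p) \<partial>M) < top"
  by (simp add: Lp_norm_def)

lemma Lp_add:
  assumes g: "g \<in> Lp M p" and h: "h \<in> Lp M p" and p: "1 \<le> p"
  shows "(\<lambda>x. g x + h x) \<in> Lp M p"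
proof -
  have m[measurable]: "g \<in> borel_measurable M" "h \<in> borel_measurable M" using g h by (auto simp: Lp_def)
  have "(\<integral>\<^sup>+x. ennreal (\<bar>g x + h x\<bar> powr p) \<partial>M) \<le> (\<integral>\<^sup>+x. ennreal (2 powr p) * (ennreal (\<bar>g x\<bar> powr p) + ennreal (\<bar>h x\<bar> powr p)) \<partial>M)"
    by (intro nn_integral_mono ennreal_powr_add_le p)
  also have "\<dots> = ennreal (2 powr p) * ((\<integral>\<^sup>+x. ennreal (\<bar>g x\<bar> powr p) \<partial>M) + (\<integral>\<^sup>+x. ennreal (\<bar>h x\<bar> powr p) \<partial>M))"
    by (simp add: nn_integral_cmult nn_integral_add)
  also have "\<dots> < \<infinity>" using g h by (simp add: Lp_def Lp_norm_finite_iff ennreal_mult_less_top)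
  finally show ?thesis by (simp add: Lp_def Lp_norm_finite_iff)
qed

lemma Lp_diff:
  assumes g: "g \<in> Lp M p" and h: "h \<in> Lp M p" and p: "1 \<le> p"
  shows "(\<lambda>x. g x - h x) \<in> Lp M p"
proof -
  have "(\<lambda>x. - h x) \<in> Lp M p" using h by (simp add: Lp_def Lp_norm_def)
  from Lp_add[OF g this p] show ?thesis by simp
qed

lemma smooth_approximation:
  assumes f: "f \<in> borel_measurable vicsek_mu" and p: "1 \<le> p"
  obtains h where "h \<in> Lp vicsek_mu p"
    "Lp_norm vicsek_mu p (\<lambda>x. f x - h x) \<le> ennreal (approx_const p powr (1 / p)) * root_energy p f n"
    "\<And>k. root_energy p h (n + k) \<le> ennreal (approx_const p powr (1 / p) / (3 powr vicsek_alpha p) ^ k) * root_energy p f n"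
proof -
  obtain F where F: "\<And>w w'. w \<in> words n \<Longrightarrow> w' \<in> nbrs n w \<Longrightarrow>
     (\<integral>\<^sup>+y\<in>vicsek_cell w'. ennreal (\<bar>f y - F w\<bar> powr p) \<partial>vicsek_mu) \<le> 5 ^ n * local_energy p f n w"
    using good_cell_values[OF f] by blast
  have c: "0 < approx_const p" by (auto simp: approx_const_def intro!: add_pos_pos)
  show ?thesis
  proof (rule that[of "interpolant n F"])
    show "interpolant n F \<in> Lp vicsek_mu p" by (rule bounded_in_Lp[OF continuous_interpolant p])
    show "Lp_norm vicsek_mu p (\<lambda>x. f x - interpolant n F x) \<le> ennreal (approx_const p powr (1 / p)) * root_energy p f n"
      unfolding Lp_norm_def root_energy_def
      by (rule ennreal_powr_le_cmult[OF interpolant_approximates[OF f p F] c]) (use p in auto)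
    fix k
    have "root_energy p (interpolant n F) (n + k) \<le> ennreal ((approx_const p / (5 * 3 powr (p - 1)) ^ k) powr (1 / p)) * root_energy p f n"
      unfolding root_energy_def
      by (rule ennreal_powr_le_cmult[OF interpolant_energy_le[OF f p F]]) (use p c in auto)
    also have "(approx_const p / (5 * 3 powr (p - 1)) ^ k) powr (1 / p) = approx_const p powr (1 / p) / (3 powr vicsek_alpha p) ^ k"
      unfolding three_powr_alpha[OF p, symmetric] using c
      by (subst power_powr_swap[symmetric], simp, subst powr_divide) auto
    finally show "root_energy p (interpolant n F) (n + k) \<le> ennreal (approx_const p powr (1 / p) / (3 powr vicsek_alpha p) ^ k) * root_energy p f n" .
  qed
qed

text \<open>At generation \<open>0\<close> the only cell is the whole set, so a good cell value is a
  constant.\<close>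

lemma constant_approximation:
  assumes f: "f \<in> borel_measurable vicsek_mu" and p: "1 \<le> p"
  obtains c where "Lp_norm vicsek_mu p (\<lambda>x. f x - c) \<le> root_energy p f 0"
proof -
  obtain F where F: "\<And>w w'. w \<in> words 0 \<Longrightarrow> w' \<in> nbrs 0 w \<Longrightarrow>
     (\<integral>\<^sup>+y\<in>vicsek_cell w'. ennreal (\<bar>f y - F w\<bar> powr p) \<partial>vicsek_mu) \<le> 5 ^ 0 * local_energy p f 0 w"
    using good_cell_values[OF f] by blast
  have "(\<integral>\<^sup>+y. ennreal (\<bar>f y - F []\<bar> powr p) \<partial>vicsek_mu) = (\<integral>\<^sup>+y\<in>vicsek_cell []. ennreal (\<bar>f y - F []\<bar> powr p) \<partial>vicsek_mu)"
    by (intro nn_integral_cong) (simp add: cell_simps)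
  also have "\<dots> \<le> cell_energy p f 0" using F[of "[]" "[]"] nbrs_self[of "[]" 0] by (simp add: cell_energy_local)
  finally show ?thesis using p that unfolding Lp_norm_def root_energy_def by (meson ennreal_powr_mono divide_nonneg_nonneg order_trans zero_le_one)
qed

subsection \<open>The two inequalities\<close>

text \<open>The factors of \<open>root_energy_mono\<close> and \<open>root_energy_le_E\<close>; the
  last one comes from the radius \<open>4 / 3 ^ (n + k)\<close>.\<close>

definition sobolev_const :: "real \<Rightarrow> real" where
  "sobolev_const p = (24 * 4 powr (p - 1)) powr (1 / p) * 800 powr (1 / p) * 4 powr vicsek_alpha p"

lemma sobolev_const_pos: "0 < sobolev_const p" by (simp add: sobolev_const_def)

lemma sobolev_seminorm_alt:
  "sobolev_seminorm p f = Limsup (at_right 0) (\<lambda>r. ennreal (r powr (- vicsek_alpha p)) * root_E p f r)"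
  by (simp add: sobolev_seminorm_def root_E_def)

lemma ennreal_inverse_cancel: "0 < c \<Longrightarrow> ennreal (1 / c) * (ennreal c * x) = x"
  by (simp add: mult.assoc[symmetric] ennreal_mult[symmetric])

lemma ennreal_le_cmultI:
  assumes "0 < c" "ennreal (1 / c) * x \<le> y" shows "x \<le> ennreal c * y"
proof -
  have "x = ennreal c * (ennreal (1 / c) * x)" using assms(1) by (simp add: mult.assoc[symmetric] ennreal_mult[symmetric])
  also have "\<dots> \<le> ennreal c * y" by (intro mult_left_mono assms) simp
  finally show ?thesis .
qed

lemma powr_three_power: "(c / 3 ^ n) powr a = c powr a / (3 powr a) ^ n" if "0 \<le> c" for c a :: real
  using that power_powr_swap[of 3 n a] by (simp add: powr_divide)

text \<open>The upper limit controls only small radii. Such a radius is taken of the form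
  \<open>4 / 3 ^ (n + k)\<close>, and monotonicity leads back to generation \<open>n\<close>; the
  growth in \<open>k\<close> cancels exactly against the power of the radius.\<close>

lemma root_energy_le_sobolev:
  assumes h: "h \<in> borel_measurable vicsek_mu" and p: "1 < p"
  shows "root_energy p h n \<le> ennreal (sobolev_const p / (3 powr vicsek_alpha p) ^ n) * sobolev_seminorm p h"
proof -
  let ?a = "vicsek_alpha p"
  let ?T = "3 powr ?a" and ?e = "root_energy p h n"
  let ?c = "sobolev_const p / ?T ^ n"
  have c: "0 < ?c" using sobolev_const_pos by simp
  have p1: "1 \<le> p" using p by simp
  have a: "0 < ?a" by (rule alpha_pos[OF p])
  have "ennreal (1 / ?c) * ?e \<le> sobolev_seminorm p h"
  \<comment> \<open>An arbitrary \<open>M\<close> strictly above the seminorm turns the upper limit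
    into a bound for all small radii; for an infinite seminorm there is no such
    \<open>M\<close>.\<close>
  proof (rule dense_ge)
    fix M assume "sobolev_seminorm p h < M"
    then have "eventually (\<lambda>r. ennreal (r powr (- ?a)) * root_E p h r < M) (at_right 0)"
      unfolding sobolev_seminorm_alt by (rule Limsup_lessD)
    then obtain d where d: "0 < d" "\<And>r. 0 < r \<Longrightarrow> r < d \<Longrightarrow> ennreal (r powr (- ?a)) * root_E p h r < M"
      by (auto simp: eventually_at_right_field)
    obtain k where k: "(1/3::real) ^ k < d / 4" using real_arch_pow_inv[of "d / 4" "1/3"] d(1) by auto
    define r :: real where "r = 4 / 3 ^ (n + k)"
    have r: "0 < r" by (simp add: r_def)
    have "r \<le> 4 / 3 ^ k" unfolding r_def by (intro divide_left_mono power_increasing) auto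
    also have "\<dots> < d" using k by (simp add: power_one_over field_simps)
    finally have rd: "r < d" .
    have rE: "root_E p h r \<le> ennreal (r powr ?a) * M"
    proof -
      have "root_E p h r = ennreal (r powr ?a) * (ennreal (r powr (- ?a)) * root_E p h r)"
        using r by (simp add: mult.assoc[symmetric] ennreal_mult[symmetric] powr_add[symmetric])
      also have "\<dots> \<le> ennreal (r powr ?a) * M" using d(2)[OF r rd] by (intro mult_left_mono) auto
      finally show ?thesis .
    qed
    let ?c5 = "(24 * 4 powr (p - 1)) powr (1 / p)" and ?c8 = "800 powr (1 / p) :: real"
    have "?e \<le> ennreal (?c5 * ?T ^ k) * root_energy p h (n + k)" by (rule root_energy_mono[OF h p1])
    also have "\<dots> \<le> ennreal (?c5 * ?T ^ k) * (ennreal ?c8 * root_E p h r)"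
      unfolding r_def by (intro mult_left_mono root_energy_le_E[OF h p1]) simp
    also have "\<dots> \<le> ennreal (?c5 * ?T ^ k) * (ennreal ?c8 * (ennreal (r powr ?a) * M))"
      by (intro mult_left_mono rE) auto
    also have "\<dots> = ennreal (?c5 * ?T ^ k * ?c8 * r powr ?a) * M"
      by (simp add: ennreal_mult mult.assoc)
    also have "?c5 * ?T ^ k * ?c8 * r powr ?a = ?c"
      unfolding r_def by (subst powr_three_power) (auto simp: sobolev_const_def power_add)
    finally have "?e \<le> ennreal ?c * M" .
    then have "ennreal (1 / ?c) * ?e \<le> ennreal (1 / ?c) * (ennreal ?c * M)" by (intro mult_left_mono) auto
    then show "ennreal (1 / ?c) * ?e \<le> M" using ennreal_inverse_cancel[OF c] by simp
  qed
  then show ?thesis by (rule ennreal_le_cmultI[OF c])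
qed

definition lower_const :: "real \<Rightarrow> real" where
  "lower_const p = 5 powr (1 / p) * 4 * ((32 * 2 powr p) powr (1 / p) + sobolev_const p * (3/2) powr vicsek_alpha p)"

lemma lower_const_pos: "0 < lower_const p"
  using sobolev_const_pos[of p] by (simp add: lower_const_def add_nonneg_pos)

lemma root_E_decomposition:
  assumes g: "g \<in> borel_measurable vicsek_mu" and h: "h \<in> borel_measurable vicsek_mu" and p: "1 < p" and r: "0 < r"
  shows "root_E p (\<lambda>x. g x + h x) r \<le>
    ennreal (lower_const p) * (Lp_norm vicsek_mu p g + ennreal (r powr vicsek_alpha p) * sobolev_seminorm p h)"
proof -
  let ?a = "vicsek_alpha p" and ?f = "\<lambda>x. g x + h x"
  let ?c3 = "(32 * 2 powr p) powr (1 / p)" and ?cs = "sobolev_const p * (3/2) powr ?a"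
  have p1: "1 \<le> p" and a: "0 < ?a" using p alpha_pos by auto
  have f: "?f \<in> borel_measurable vicsek_mu" using g h by measurable
  obtain n where n: "2 / 3 ^ Suc n \<le> r" "root_E p ?f r \<le> ennreal (5 powr (1 / p)) * root_energy p ?f n"
    using root_E_le_energy[OF f r p1] by blast
  have scale: "sobolev_const p / (3 powr ?a) ^ n \<le> ?cs * r powr ?a"
  proof -
    \<comment> \<open>The generation found for \<open>r\<close> satisfies
      \<open>2 / 3 ^ Suc n \<le> r\<close>, which explains the factor \<open>3/2\<close> in
      \<open>lower_const\<close>.\<close>
    have "1 / 3 ^ n \<le> 3/2 * r" using n(1) by (simp add: field_simps)
    then have "(1 / 3 ^ n) powr ?a \<le> (3/2 * r) powr ?a" using a by (intro powr_mono2) auto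
    also have "(3/2 * r) powr ?a = (3/2) powr ?a * r powr ?a" by (rule powr_mult)
    finally have "1 / (3 powr ?a) ^ n \<le> (3/2) powr ?a * r powr ?a" by (simp add: powr_three_power)
    then have "sobolev_const p * (1 / (3 powr ?a) ^ n) \<le> sobolev_const p * ((3/2) powr ?a * r powr ?a)"
      using sobolev_const_pos[of p] by (intro mult_left_mono) auto
    then show ?thesis by (simp add: mult.assoc)
  qed
  have "root_energy p h n \<le> ennreal (sobolev_const p / (3 powr ?a) ^ n) * sobolev_seminorm p h"
    by (rule root_energy_le_sobolev[OF h p])
  also have "\<dots> \<le> ennreal (?cs * r powr ?a) * sobolev_seminorm p h"
    by (intro mult_right_mono ennreal_leI scale) simp
  also have "\<dots> = ennreal ?cs * (ennreal (r powr ?a) * sobolev_seminorm p h)"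
    using sobolev_const_pos[of p] by (simp add: ennreal_mult mult.assoc)
  finally have eh: "root_energy p h n \<le> ennreal ?cs * (ennreal (r powr ?a) * sobolev_seminorm p h)" .
  have cs: "0 \<le> ?cs" "?cs \<le> ?c3 + ?cs" "?c3 \<le> ?c3 + ?cs" using sobolev_const_pos[of p] by auto
  have "root_E p ?f r \<le> ennreal (5 powr (1 / p)) * (4 * (root_energy p g n + root_energy p h n))"
    using n(2) mult_left_mono[OF root_energy_add[OF g h p1, of n], of "ennreal (5 powr (1 / p))"] by (auto intro: order_trans)
  also have "\<dots> \<le> ennreal (5 powr (1 / p)) * (4 * (ennreal ?c3 * Lp_norm vicsek_mu p g + ennreal ?cs * (ennreal (r powr ?a) * sobolev_seminorm p h)))"
    by (intro mult_left_mono add_mono root_energy_le_norm[OF g p1] eh) auto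
  also have "\<dots> \<le> ennreal (5 powr (1 / p)) * (4 * (ennreal (?c3 + ?cs) * Lp_norm vicsek_mu p g + ennreal (?c3 + ?cs) * (ennreal (r powr ?a) * sobolev_seminorm p h)))"
    using cs by (intro mult_left_mono add_mono mult_right_mono ennreal_leI) auto
  also have "\<dots> = ennreal (lower_const p) * (Lp_norm vicsek_mu p g + ennreal (r powr ?a) * sobolev_seminorm p h)"
  proof -
    have "ennreal (lower_const p) = ennreal (5 powr (1 / p)) * (4 * ennreal (?c3 + ?cs))"
      unfolding lower_const_def using cs by (simp only: ennreal_mult mult.assoc powr_ge_zero add_nonneg_nonneg zero_le_numeral mult_nonneg_nonneg) simp
    then show ?thesis by (simp only: distrib_left mult.assoc)
  qed
  finally show ?thesis .
qed

lemma besov_seminorm_alt: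
  "besov_seminorm p \<alpha> f = (SUP r\<in>{0<..}. ennreal (r powr (- \<alpha>)) * root_E p f r)"
  by (simp add: besov_seminorm_def root_E_def)

abbreviation "K_Lp_W p \<equiv> K_functional (Lp vicsek_mu p) (Lp_norm vicsek_mu p) (sobolev_space p) (sobolev_seminorm p)"
abbreviation "interp_Lp_W p \<equiv> interp_seminorm (Lp vicsek_mu p) (Lp_norm vicsek_mu p) (sobolev_space p) (sobolev_seminorm p)"

lemma besov_le_interp:
  assumes p: "1 < p"
  shows "besov_seminorm p \<alpha> f \<le> ennreal (lower_const p) * interp_Lp_W p (\<alpha> / vicsek_alpha p) f"
  unfolding besov_seminorm_alt
proof (rule SUP_least)
  let ?a = "vicsek_alpha p" let ?\<theta> = "\<alpha> / ?a"
  fix r :: real assume "r \<in> {0<..}"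
  then have r: "0 < r" by simp
  have a: "0 < ?a" by (rule alpha_pos[OF p])
  let ?t = "r powr ?a"
  have "ennreal (1 / lower_const p) * root_E p f r \<le> K_Lp_W p f ?t"
    unfolding K_functional_def
  proof (rule INF_greatest, clarify)
    fix g h assume g: "g \<in> Lp vicsek_mu p" and h: "h \<in> sobolev_space p" and f: "f = (\<lambda>x. g x + h x)"
    have m: "g \<in> borel_measurable vicsek_mu" "h \<in> borel_measurable vicsek_mu"
      using g h by (auto simp: sobolev_space_def Lp_def)
    have "ennreal (1 / lower_const p) * root_E p (\<lambda>x. g x + h x) r \<le>
      ennreal (1 / lower_const p) * (ennreal (lower_const p) * (Lp_norm vicsek_mu p g + ennreal ?t * sobolev_seminorm p h))"
      by (intro mult_left_mono root_E_decomposition[OF m p r]) simp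
    then show "ennreal (1 / lower_const p) * root_E p (\<lambda>x. g x + h x) r \<le> Lp_norm vicsek_mu p g + ennreal ?t * sobolev_seminorm p h"
      unfolding ennreal_inverse_cancel[OF lower_const_pos] .
  qed
  then have K: "root_E p f r \<le> ennreal (lower_const p) * K_Lp_W p f ?t" by (rule ennreal_le_cmultI[OF lower_const_pos])
  \<comment> \<open>The substitution \<open>t = r powr vicsek_alpha p\<close> matches the weights of
    the two suprema.\<close>
  have "?t powr (- ?\<theta>) = r powr (- \<alpha>)" using a by (simp add: powr_powr)
  then have "ennreal (r powr (- \<alpha>)) * root_E p f r \<le> ennreal (?t powr (- ?\<theta>)) * (ennreal (lower_const p) * K_Lp_W p f ?t)"
    using K by (simp add: mult_left_mono)
  also have "\<dots> = ennreal (lower_const p) * (ennreal (?t powr (- ?\<theta>)) * K_Lp_W p f ?t)" by (rule mult.left_commute)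
  also have "\<dots> \<le> ennreal (lower_const p) * interp_Lp_W p ?\<theta> f"
    unfolding interp_seminorm_def using r by (intro mult_left_mono SUP_upper) auto
  finally show "ennreal (r powr (- \<alpha>)) * root_E p f r \<le> ennreal (lower_const p) * interp_Lp_W p ?\<theta> f" .
qed

lemma root_energy_le_besov:
  assumes f: "f \<in> borel_measurable vicsek_mu" and p: "1 \<le> p"
  shows "root_energy p f n \<le> ennreal (800 powr (1 / p) * (4 / 3 ^ n) powr \<alpha>) * besov_seminorm p \<alpha> f"
proof -
  let ?r = "4 / 3 ^ n :: real"
  have "root_E p f ?r = ennreal (?r powr \<alpha>) * (ennreal (?r powr (- \<alpha>)) * root_E p f ?r)"
    by (simp add: mult.assoc[symmetric] ennreal_mult[symmetric] powr_add[symmetric])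
  also have "\<dots> \<le> ennreal (?r powr \<alpha>) * besov_seminorm p \<alpha> f"
    unfolding besov_seminorm_alt by (intro mult_left_mono SUP_upper) auto
  finally have "ennreal (800 powr (1 / p)) * root_E p f ?r \<le> ennreal (800 powr (1 / p)) * (ennreal (?r powr \<alpha>) * besov_seminorm p \<alpha> f)"
    by (rule mult_left_mono) simp
  then show ?thesis using root_energy_le_E[OF f p, of n] by (simp add: ennreal_mult mult.assoc)
qed

text \<open>With \<open>m = n + k\<close> the weight \<open>r powr (- vicsek_alpha p)\<close> grows
  at most like the \<open>m\<close>-th power of \<open>3 powr vicsek_alpha p\<close>. The assumed
  decay removes the part in \<open>k\<close>, and the power with exponent \<open>n\<close>
  remains.\<close>

lemma sobolev_seminorm_le_energy:
  assumes h: "h \<in> borel_measurable vicsek_mu" and p: "1 < p"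
    and e: "\<And>k. root_energy p h (n + k) \<le> ennreal (c / (3 powr vicsek_alpha p) ^ k) * E" and c: "0 \<le> c"
  shows "sobolev_seminorm p h \<le> ennreal (5 powr (1 / p) * (3/2) powr vicsek_alpha p * c * (3 powr vicsek_alpha p) ^ n) * E"
  unfolding sobolev_seminorm_alt
proof (rule Limsup_bounded)
  let ?a = "vicsek_alpha p" let ?T = "3 powr ?a"
  have p1: "1 \<le> p" and a: "0 < ?a" using p alpha_pos by auto
  have "ennreal (r powr (- ?a)) * root_E p h r \<le> ennreal (5 powr (1 / p) * (3/2) powr ?a * c * ?T ^ n) * E"
    if r: "0 < r" "r < 2 / 3 ^ Suc n" for r
  proof -
    obtain m where m: "2 / 3 ^ Suc m \<le> r" "root_E p h r \<le> ennreal (5 powr (1 / p)) * root_energy p h m"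
      using root_E_le_energy[OF h r(1) p1] by blast
    \<comment> \<open>Small radii are needed only here: they force a generation at which the decay
      assumption speaks.\<close>
    have "n \<le> m"
    proof (rule ccontr)
      assume "\<not> n \<le> m"
      then have "(3::real) ^ Suc m \<le> 3 ^ Suc n" by (intro power_increasing) auto
      then have "2 / 3 ^ Suc n \<le> 2 / (3::real) ^ Suc m" by (intro divide_left_mono) auto
      then show False using m(1) r(2) by linarith
    qed
    then obtain k where k: "m = n + k" using le_Suc_ex by blast
    have "r powr (- ?a) \<le> (2 / 3 ^ Suc m) powr (- ?a)" using m(1) a by (intro powr_mono2') auto
    also have "\<dots> = (2/3 / 3 ^ m) powr (- ?a)" by simp
    also have "\<dots> = (3/2) powr ?a * ?T ^ m"
    proof -
      have "(3 powr (- ?a)) ^ m = 1 / ?T ^ m" by (simp add: powr_minus power_inverse divide_inverse)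
      moreover have "(2/3::real) powr (- ?a) = (3/2) powr ?a" by (simp add: powr_minus powr_divide)
      moreover have "(2/3 / 3 ^ m) powr (- ?a) = (2/3) powr (- ?a) / (3 powr (- ?a)) ^ m" by (rule powr_three_power) simp
      ultimately show ?thesis by (simp only: divide_divide_eq_right div_by_1)
    qed
    finally have rm: "r powr (- ?a) \<le> (3/2) powr ?a * ?T ^ m" .
    have "ennreal (r powr (- ?a)) * root_E p h r \<le> ennreal ((3/2) powr ?a * ?T ^ m) * (ennreal (5 powr (1 / p)) * (ennreal (c / ?T ^ k) * E))"
    proof (intro mult_mono ennreal_leI rm)
      show "root_E p h r \<le> ennreal (5 powr (1 / p)) * (ennreal (c / ?T ^ k) * E)"
        by (rule order_trans[OF m(2)[unfolded k] mult_left_mono[OF e]]) simp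
    qed auto
    also have "\<dots> = ennreal ((3/2) powr ?a * ?T ^ m * (5 powr (1 / p) * (c / ?T ^ k))) * E"
      using c by (simp only: ennreal_mult[symmetric] mult.assoc[symmetric] powr_ge_zero mult_nonneg_nonneg zero_le_power divide_nonneg_nonneg)
    also have "(3/2) powr ?a * ?T ^ m * (5 powr (1 / p) * (c / ?T ^ k)) = 5 powr (1 / p) * (3/2) powr ?a * c * ?T ^ n"
      by (simp add: k power_add)
    finally show ?thesis .
  qed
  then show "eventually (\<lambda>r. ennreal (r powr (- ?a)) * root_E p h r \<le> ennreal (5 powr (1 / p) * (3/2) powr ?a * c * ?T ^ n) * E) (at_right 0)"
    unfolding eventually_at_right_field by (intro exI[of _ "2 / 3 ^ Suc n"]) auto
qed

lemma sobolev_const_function: "1 \<le> p \<Longrightarrow> sobolev_seminorm p (\<lambda>_. c) = 0"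
proof -
  assume p: "1 \<le> p"
  have "vicsek_E p (\<lambda>_. c) r = 0" for r using p by (simp add: vicsek_E_def)
  then have "root_E p (\<lambda>_. c) r = 0" for r by (simp add: root_E_def ennreal_powr_def)
  then show ?thesis unfolding sobolev_seminorm_alt by (simp add: Limsup_const)
qed

lemma K_Lp_W_le:
  assumes "f \<in> Lp vicsek_mu p" "h \<in> sobolev_space p" "1 \<le> p"
  shows "K_Lp_W p f t \<le> Lp_norm vicsek_mu p (\<lambda>x. f x - h x) + ennreal t * sobolev_seminorm p h"
proof -
  have "(\<lambda>x. f x - h x) \<in> Lp vicsek_mu p" using assms by (intro Lp_diff) (auto simp: sobolev_space_def)
  then show ?thesis unfolding K_functional_def using assms(2)
    by (intro INF_lower2[of "(\<lambda>x. f x - h x, h)"]) auto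
qed

lemma interp_le_besov:
  assumes p: "1 < p" and \<alpha>: "0 \<le> \<alpha>"
  shows "\<exists>C>0. \<forall>f\<in>besov_space p \<alpha>. interp_Lp_W p (\<alpha> / vicsek_alpha p) f \<le> ennreal C * besov_seminorm p \<alpha> f"
proof -
  let ?a = "vicsek_alpha p" let ?T = "3 powr ?a" and ?\<theta> = "\<alpha> / ?a"
  let ?ca = "approx_const p powr (1 / p)" and ?c8 = "800 powr (1 / p) :: real"
  let ?cs = "5 powr (1 / p) * (3/2) powr ?a * ?ca"
  \<comment> \<open>The \<open>12\<close> is \<open>4 * 3\<close>, from the radius
    \<open>4 / 3 ^ n\<close> and the gap of one generation between \<open>r\<close> and
    \<open>n\<close>. The \<open>+ 1\<close> makes the constant also cover the case
    \<open>1 \<le> t\<close>.\<close>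
  let ?C = "(?ca + ?cs + 1) * ?c8 * 12 powr \<alpha>"
  have p1: "1 \<le> p" and a: "0 < ?a" using p alpha_pos by auto
  have \<theta>: "0 \<le> ?\<theta>" using \<alpha> a by simp
  have C0: "0 < ?C" by (intro mult_pos_pos add_nonneg_pos) auto
  have "interp_Lp_W p ?\<theta> f \<le> ennreal ?C * besov_seminorm p \<alpha> f" if fB: "f \<in> besov_space p \<alpha>" for f
    unfolding interp_seminorm_def
  proof (rule SUP_least)
    fix t :: real assume "t \<in> {0<..}"
    then have t: "0 < t" by simp
    have fL: "f \<in> Lp vicsek_mu p" and Sfin: "besov_seminorm p \<alpha> f < top" using fB by (auto simp: besov_space_def)
    then have fm: "f \<in> borel_measurable vicsek_mu" by (simp add: Lp_def)
    let ?S = "besov_seminorm p \<alpha> f"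
    show "ennreal (t powr (- ?\<theta>)) * K_Lp_W p f t \<le> ennreal ?C * ?S"
    proof (cases "1 \<le> t")
      case True
      \<comment> \<open>No generation corresponds to radii above \<open>1\<close>. A constant has
        zero Sobolev seminorm, so its cost does not grow with \<open>t\<close>, while
        \<open>t powr (- ?\<theta>)\<close> is at most \<open>1\<close>.\<close>
      obtain c where c: "Lp_norm vicsek_mu p (\<lambda>x. f x - c) \<le> root_energy p f 0"
        using constant_approximation[OF fm p1] by blast
      have cW: "(\<lambda>_. c) \<in> sobolev_space p"
        using sobolev_const_function[OF p1] bounded_in_Lp[OF continuous_on_const p1] by (simp add: sobolev_space_def)
      have "K_Lp_W p f t \<le> root_energy p f 0"
        using K_Lp_W_le[OF fL cW p1, of t] c sobolev_const_function[OF p1] by (auto intro: order_trans)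
      also have "\<dots> \<le> ennreal (?c8 * (4 / 3 ^ 0) powr \<alpha>) * ?S" by (rule root_energy_le_besov[OF fm p1])
      also have "\<dots> \<le> ennreal ?C * ?S"
      proof (intro mult_right_mono ennreal_leI)
        have "1 * ?c8 * 4 powr \<alpha> \<le> (?ca + ?cs + 1) * ?c8 * 12 powr \<alpha>"
          using \<alpha> p1 by (intro mult_mono powr_mono2) auto
        then show "?c8 * (4 / 3 ^ 0) powr \<alpha> \<le> ?C" by simp
      qed simp
      finally have K: "K_Lp_W p f t \<le> ennreal ?C * ?S" .
      have "t powr (- ?\<theta>) \<le> t powr 0" using True \<theta> by (intro powr_mono) auto
      then have "ennreal (t powr (- ?\<theta>)) \<le> ennreal 1" using t by (intro ennreal_leI) simp
      then have "ennreal (t powr (- ?\<theta>)) * K_Lp_W p f t \<le> ennreal 1 * (ennreal ?C * ?S)" by (intro mult_mono K) auto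
      then show ?thesis by simp
    next
      case False
      define r where "r = t powr (1 / ?a)"
      have r0: "0 < r" using t by (simp add: r_def)
      have r1: "r \<le> 1" using False t a powr_mono2[of "1 / ?a" t 1] by (simp add: r_def)
      have tr: "t = r powr ?a" using t a by (simp add: r_def powr_powr)
      \<comment> \<open>Minimality gives \<open>r \<le> 1 / 3 ^ n\<close>, which for
        \<open>n = 0\<close> is just \<open>r \<le> 1\<close>; the defining inequality bounds
        \<open>r\<close> from below by a third of that.\<close>
      define n where "n = (LEAST n. (1/3::real) ^ Suc n < r)"
      obtain k where "(1/3::real) ^ k < r" using real_arch_pow_inv[OF r0, of "1/3"] by auto
      moreover have "(1/3::real) ^ Suc k \<le> (1/3) ^ k" by simp
      ultimately have "(1/3::real) ^ Suc k < r" by linarith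
      then have n1: "(1/3::real) ^ Suc n < r" unfolding n_def by (rule LeastI)
      have n0: "r \<le> 1 / 3 ^ n"
      proof (cases n)
        case 0 then show ?thesis using r1 by simp
      next
        case (Suc m)
        then have "m < n" by simp
        then have "\<not> (1/3::real) ^ Suc m < r" unfolding n_def by (rule not_less_Least)
        then show ?thesis using Suc by (simp add: power_one_over)
      qed
      obtain h where h: "h \<in> Lp vicsek_mu p"
        "Lp_norm vicsek_mu p (\<lambda>x. f x - h x) \<le> ennreal ?ca * root_energy p f n"
        "\<And>k. root_energy p h (n + k) \<le> ennreal (?ca / ?T ^ k) * root_energy p f n"
        using smooth_approximation[OF fm p1] by blast
      have hm: "h \<in> borel_measurable vicsek_mu" using h(1) by (simp add: Lp_def)
      have W: "sobolev_seminorm p h \<le> ennreal (?cs * ?T ^ n) * root_energy p f n"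
        using sobolev_seminorm_le_energy[OF hm p h(3)] by simp
      have e: "root_energy p f n \<le> ennreal (?c8 * (4 / 3 ^ n) powr \<alpha>) * ?S" by (rule root_energy_le_besov[OF fm p1])
      \<comment> \<open>Finiteness is what makes \<open>h\<close> a member of
        \<open>sobolev_space p\<close>, hence admissible in the infimum.\<close>
      then have "root_energy p f n < top" using Sfin by (auto simp: ennreal_mult_less_top intro: order_le_less_trans)
      then have "ennreal (?cs * ?T ^ n) * root_energy p f n < top" by (simp add: ennreal_mult_less_top)
      then have hW: "h \<in> sobolev_space p" using h(1) W by (auto simp: sobolev_space_def intro: order_le_less_trans)
      \<comment> \<open>This balances the decomposition: the weighted Sobolev term is no larger than
        the order of the \<open>L\<^sup>p\<close> error.\<close>
      have tT: "t * ?T ^ n \<le> 1"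
      proof -
        have "t \<le> (1 / 3 ^ n) powr ?a" unfolding tr using n0 r0 a by (intro powr_mono2) auto
        then have "t \<le> 1 / ?T ^ n" by (simp add: powr_three_power)
        then show ?thesis by (simp add: field_simps)
      qed
      have "K_Lp_W p f t \<le> ennreal ?ca * root_energy p f n + ennreal t * (ennreal (?cs * ?T ^ n) * root_energy p f n)"
        using K_Lp_W_le[OF fL hW p1, of t] add_mono[OF h(2) mult_left_mono[OF W, of "ennreal t"]] by (auto intro: order_trans)
      also have "\<dots> = ennreal (?ca + ?cs * (t * ?T ^ n)) * root_energy p f n"
      proof -
        have "ennreal t * (ennreal (?cs * ?T ^ n) * E) = ennreal (?cs * (t * ?T ^ n)) * E" for E
          using t by (simp add: mult.assoc[symmetric] ennreal_mult[symmetric]) (simp add: ac_simps)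
        moreover have "ennreal ?ca * E + ennreal (?cs * (t * ?T ^ n)) * E = ennreal (?ca + ?cs * (t * ?T ^ n)) * E" for E
          using t by (simp add: ennreal_plus distrib_right)
        ultimately show ?thesis by simp
      qed
      also have "\<dots> \<le> ennreal (?ca + ?cs + 1) * (ennreal (?c8 * (4 / 3 ^ n) powr \<alpha>) * ?S)"
      proof (intro mult_mono e ennreal_leI)
        have "?cs * (t * ?T ^ n) \<le> ?cs * 1" by (intro mult_left_mono tT) auto
        then show "?ca + ?cs * (t * ?T ^ n) \<le> ?ca + ?cs + 1" by linarith
      qed auto
      also have "\<dots> \<le> ennreal (?ca + ?cs + 1) * (ennreal (?c8 * (12 powr \<alpha> * t powr ?\<theta>)) * ?S)"
      proof (intro mult_left_mono mult_right_mono ennreal_leI)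
        have "4 / 3 ^ n \<le> 12 * r" using n1 by (simp add: power_one_over field_simps)
        then have "(4 / 3 ^ n) powr \<alpha> \<le> (12 * r) powr \<alpha>" using \<alpha> by (intro powr_mono2) auto
        also have "\<dots> = 12 powr \<alpha> * t powr ?\<theta>" using r0 a by (simp add: powr_mult tr powr_powr)
        finally show "(4 / 3 ^ n) powr \<alpha> \<le> 12 powr \<alpha> * t powr ?\<theta>" .
      qed auto
      finally have K: "K_Lp_W p f t \<le> ennreal (?ca + ?cs + 1) * (ennreal (?c8 * (12 powr \<alpha> * t powr ?\<theta>)) * ?S)" .
      then have "ennreal (t powr (- ?\<theta>)) * K_Lp_W p f t \<le> ennreal (t powr (- ?\<theta>)) * (ennreal (?ca + ?cs + 1) * (ennreal (?c8 * (12 powr \<alpha> * t powr ?\<theta>)) * ?S))"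
        by (rule mult_left_mono) simp
      also have "\<dots> = ennreal (t powr (- ?\<theta>) * ((?ca + ?cs + 1) * (?c8 * (12 powr \<alpha> * t powr ?\<theta>)))) * ?S"
      proof -
        have *: "ennreal x * (ennreal y * (ennreal z * E)) = ennreal (x * (y * z)) * E" if "0 \<le> x" "0 \<le> y" "0 \<le> z" for x y z E
          using that by (simp add: ennreal_mult mult.assoc)
        show ?thesis by (rule *) auto
      qed
      also have "t powr (- ?\<theta>) * ((?ca + ?cs + 1) * (?c8 * (12 powr \<alpha> * t powr ?\<theta>))) = ?C"
      proof -
        have "t powr (- ?\<theta>) * t powr ?\<theta> = 1" using t by (simp add: powr_add[symmetric])
        then have "t powr (- ?\<theta>) * (x * (y * (z * t powr ?\<theta>))) = x * y * z" for x y z :: real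
          by (metis (no_types, opaque_lifting) mult.assoc mult.commute mult_1_right)
        then show ?thesis .
      qed
      finally show ?thesis .
    qed
  qed
  then show ?thesis using C0 by blast
qed

theorem theorem5p3:
  fixes p \<alpha> :: real
  assumes "1 < p" and "0 \<le> \<alpha>" and "\<alpha> \<le> vicsek_alpha p"
  shows
    "besov_space p \<alpha> =
       interp_space (Lp vicsek_mu p) (Lp_norm vicsek_mu p) (sobolev_space p) (sobolev_seminorm p)
         (\<alpha> / vicsek_alpha p) \<and>
     (\<exists>c C :: real. 0 < c \<and> 0 < C \<and>
        (\<forall>f\<in>besov_space p \<alpha>.
           ennreal c * besov_seminorm p \<alpha> f
             \<le> interp_seminorm (Lp vicsek_mu p) (Lp_norm vicsek_mu p)
                 (sobolev_space p) (sobolev_seminorm p) (\<alpha> / vicsek_alpha p) f \<and>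
           interp_seminorm (Lp vicsek_mu p) (Lp_norm vicsek_mu p)
                 (sobolev_space p) (sobolev_seminorm p) (\<alpha> / vicsek_alpha p) f
             \<le> ennreal C * besov_seminorm p \<alpha> f))"
proof -
  let ?\<theta> = "\<alpha> / vicsek_alpha p"
  let ?I = "interp_space (Lp vicsek_mu p) (Lp_norm vicsek_mu p) (sobolev_space p) (sobolev_seminorm p) ?\<theta>"
  have p1: "1 \<le> p" using assms(1) by simp
  obtain C where C: "0 < C" "\<And>f. f \<in> besov_space p \<alpha> \<Longrightarrow> interp_Lp_W p ?\<theta> f \<le> ennreal C * besov_seminorm p \<alpha> f"
    using interp_le_besov[OF assms(1,2)] by blast
  have lower: "ennreal (1 / lower_const p) * besov_seminorm p \<alpha> f \<le> interp_Lp_W p ?\<theta> f" for f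
  proof -
    have "ennreal (1 / lower_const p) * besov_seminorm p \<alpha> f \<le> ennreal (1 / lower_const p) * (ennreal (lower_const p) * interp_Lp_W p ?\<theta> f)"
      by (intro mult_left_mono besov_le_interp assms(1)) simp
    then show ?thesis unfolding ennreal_inverse_cancel[OF lower_const_pos] .
  qed
  have "f \<in> ?I" if f: "f \<in> besov_space p \<alpha>" for f
  proof -
    have fL: "f \<in> Lp vicsek_mu p" and fin: "besov_seminorm p \<alpha> f < top" using f by (auto simp: besov_space_def)
    have "ennreal C * besov_seminorm p \<alpha> f < top" using fin by (simp add: ennreal_mult_less_top)
    then have "interp_Lp_W p ?\<theta> f < top" using C(2)[OF f] by (rule order_le_less_trans[rotated])
    moreover have "(\<lambda>_. 0) \<in> sobolev_space p"
      using sobolev_const_function[OF p1] bounded_in_Lp[OF continuous_on_const p1] by (simp add: sobolev_space_def)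
    then have "\<exists>g\<in>Lp vicsek_mu p. \<exists>h\<in>sobolev_space p. f = (\<lambda>x. g x + h x)"
      using fL by (intro bexI[of _ f] bexI[of _ "\<lambda>_. 0"]) auto
    ultimately show ?thesis by (simp add: interp_space_def)
  qed
  moreover have "f \<in> besov_space p \<alpha>" if f: "f \<in> ?I" for f
  proof -
    obtain g h where gh: "g \<in> Lp vicsek_mu p" "h \<in> sobolev_space p" "f = (\<lambda>x. g x + h x)"
      using f unfolding interp_space_def by blast
    have fin: "interp_Lp_W p ?\<theta> f < top" using f by (simp add: interp_space_def)
    have "f \<in> Lp vicsek_mu p" unfolding gh(3) using gh(1,2) by (intro Lp_add p1) (auto simp: sobolev_space_def)
    moreover have "ennreal (lower_const p) * interp_Lp_W p ?\<theta> f < top" using fin by (simp add: ennreal_mult_less_top)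
    then have "besov_seminorm p \<alpha> f < top" using besov_le_interp[OF assms(1), of \<alpha> f] by (rule order_le_less_trans[rotated])
    ultimately show ?thesis by (simp add: besov_space_def)
  qed
  ultimately have "besov_space p \<alpha> = ?I" by blast
  moreover have "0 < 1 / lower_const p" using lower_const_pos by simp
  ultimately show ?thesis using C lower by blast
qed

end
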